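(* Let $H_l$ be an $n\times l$ matrix of SRHT or SRFT, where $$4\big(\sqrt r+\sqrt{8\log(rn)}\,\big)^2\log(r)\le l\le n.$$ Let $W_r$ be an $r\times n$ matrix with singular values $\sigma_j=\sigma_j(W_r)$, $j=1,\dots,r$, listed in nonincreasing order, and let $\sigma_r>0$. Then $$0.40\,\sigma_r\le\sigma_r(W_rH_l)\quad\text{and}\quad \sigma_1(W_rH_l)\le 1.48\,\sigma_1$$ with failure probability in $O(1/r)$.
   Context: $\sigma_j(M)$ denotes the $j$th largest singular value of $M$. An $n\times l$ matrix $H_l$ of a subsampled randomized Hadamard or Fourier transform (SRHT or SRFT) is obtained as follows. Let $F$ be the $n\times n$ Walsh–Hadamard matrix (for $n$ a power of $2$) or the $n\times n$ discrete Fourier transform matrix $(\omega_n^{ij})_{i,j=0}^{n-1}$, $\omega_n=\exp(2\pi\sqrt{-1}/n)$, in either case scaled by $1/\sqrt n$ so as to be unitary. The Walsh–Hadamard matrices are defined by $H_2=\begin{pmatrix}1&1\\1&-1\end{pmatrix}$ and $H_{2q}=\begin{pmatrix}H_q&H_q\\H_q&-H_q\end{pmatrix}$. Let $D$ be a random $n\times n$ diagonal matrix whose diagonal entries are independent and uniformly distributed on the complex unit circle, and let $P$ be a random $n\times n$ permutation matrix. Sample $l$ columns of $DFP$ uniformly at random and without replacement and multiply the resulting $n\times l$ matrix by $\sqrt{n/l}$; the result is $H_l$. (SRHT refers to the Hadamard case, SRFT to the Fourier case.) *)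

theory Defs
  imports
    "HOL-Probability.Probability"
    "Jordan_Normal_Form.Schur_Decomposition"
begin

text \<open>Singular values of an m by n matrix: the nonnegative square roots of the eigenvalues of
  \<open>A\<^sup>* A\<close> counted with algebraic multiplicity, in nonincreasing order, of which only the
  min(m,n) largest are kept (the remaining ones are zero). The eigenvalues of \<open>A\<^sup>* A\<close>
  are real and nonnegative, so taking the real part loses nothing.\<close>

definition singular_values :: "complex mat \<Rightarrow> real list" where
  "singular_values A =
     take (min (dim_row A) (dim_col A))
       (rev (sorted_list_of_multiset
          (image_mset (\<lambda>z. sqrt (Re z)) (proots (char_poly (mat_adjoint A * A))))))"

text \<open>The index is 1-based; out of range the value is 0.\<close>

definition singular_value :: "nat \<Rightarrow> complex mat \<Rightarrow> real" where
  "singular_value j A =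
     (if 1 \<le> j \<and> j \<le> length (singular_values A) then singular_values A ! (j - 1) else 0)"

definition dft_matrix :: "nat \<Rightarrow> complex mat" where
  "dft_matrix n = mat n n (\<lambda>(i, j). exp (2 * of_real pi * \<i> / of_nat n) ^ (i * j))"

text \<open>The matrix of order \<open>2 ^ k\<close>. The recursion starts at order 1;
  the case \<open>k = 1\<close> is the usual starting matrix, see below.\<close>

fun hadamard_matrix :: "nat \<Rightarrow> complex mat" where
  "hadamard_matrix 0 = 1\<^sub>m 1"
| "hadamard_matrix (Suc k) =
     (let H = hadamard_matrix k in four_block_mat H H H (- H))"

lemma hadamard_matrix_1: "hadamard_matrix 1 = mat_of_rows_list 2 [[1, 1], [1, - 1]]"
  by (rule eq_matI)
    (auto simp: Let_def mat_of_rows_list_def less_Suc_eq numeral_2_eq_2)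

definition unitary_dft :: "nat \<Rightarrow> complex mat" where
  "unitary_dft n = complex_of_real (1 / sqrt (real n)) \<cdot>\<^sub>m dft_matrix n"

definition unitary_hadamard :: "nat \<Rightarrow> complex mat" where
  "unitary_hadamard k = complex_of_real (1 / sqrt (2 ^ k)) \<cdot>\<^sub>m hadamard_matrix k"

definition is_srht_base :: "nat \<Rightarrow> complex mat \<Rightarrow> bool" where
  "is_srht_base n F \<longleftrightarrow> (\<exists>k. n = 2 ^ k \<and> F = unitary_hadamard k)"

definition is_srft_base :: "nat \<Rightarrow> complex mat \<Rightarrow> bool" where
  "is_srft_base n F \<longleftrightarrow> F = unitary_dft n"

definition uniform_circle :: "complex measure" where
  "uniform_circle = distr (uniform_measure lborel {0..<2 * pi}) borel cis"

text \<open>Ordered samples of size \<open>l\<close> without replacement from the index set below \<open>n\<close>.\<close>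

definition samples :: "nat \<Rightarrow> nat \<Rightarrow> nat list set" where
  "samples n l = {ks. length ks = l \<and> distinct ks \<and> set ks \<subseteq> {..<n}}"

text \<open>An outcome \<open>(d, p, ks)\<close> consists of the diagonal entries of \<open>D\<close>, the permutation
  defining \<open>P\<close> and the list of indices of the sampled columns. The product measure makes the three
  of them independent, as well as the diagonal entries among themselves.\<close>

definition transform_space ::
  "nat \<Rightarrow> nat \<Rightarrow> ((nat \<Rightarrow> complex) \<times> (nat \<Rightarrow> nat) \<times> nat list) measure" where
  "transform_space n l =
     (\<Pi>\<^sub>M i\<in>{..<n}. uniform_circle) \<Otimes>\<^sub>M
     (uniform_count_measure {p. p permutes {..<n}} \<Otimes>\<^sub>M uniform_count_measure (samples n l))"

definition permutation_matrix :: "nat \<Rightarrow> (nat \<Rightarrow> nat) \<Rightarrow> complex mat" where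
  "permutation_matrix n p = mat n n (\<lambda>(i, j). if i = p j then 1 else 0)"

definition subsampled_transform ::
  "complex mat \<Rightarrow> nat \<Rightarrow> nat \<Rightarrow> (nat \<Rightarrow> complex) \<times> (nat \<Rightarrow> nat) \<times> nat list \<Rightarrow> complex mat" where
  "subsampled_transform F n l =
     (\<lambda>(d, p, ks).
        complex_of_real (sqrt (real n / real l)) \<cdot>\<^sub>m
        mat_of_cols n (map (col (mat_diag n d * F * permutation_matrix n p)) ks))"

lemma prob_space_uniform_circle: "prob_space uniform_circle"
proof -
  have "prob_space (uniform_measure lborel {0..<2 * pi})"
    by (rule prob_space_uniform_measure) auto
  moreover have "cis \<in> borel_measurable borel"
    by (intro borel_measurable_continuous_onI continuous_intros)
  ultimately show ?thesis
    unfolding uniform_circle_def by (intro prob_space.prob_space_distr) auto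
qed

lemma finite_samples: "finite (samples n l)"
proof (rule finite_subset)
  show "samples n l \<subseteq> {ks. set ks \<subseteq> {..<n} \<and> length ks = l}"
    by (auto simp: samples_def)
qed (simp add: finite_lists_length_eq)

lemma prob_space_transform_space:
  assumes "l \<le> n"
  shows "prob_space (transform_space n l)"
proof -
  have "[0..<l] \<in> samples n l"
    using assms by (auto simp: samples_def)
  then have s: "prob_space (uniform_count_measure (samples n l))"
    using finite_samples by (intro prob_space_uniform_count_measure) auto
  have "id \<in> {p. p permutes {..<n}}"
    by (simp add: permutes_id)
  then have p: "prob_space (uniform_count_measure {p. p permutes {..<n}})"
    by (intro prob_space_uniform_count_measure finite_permutations) blast+
  have c: "prob_space (\<Pi>\<^sub>M i\<in>{..<n}. uniform_circle)"
    by (intro prob_space_PiM prob_space_uniform_circle)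
  show ?thesis
    unfolding transform_space_def using s p c by (intro prob_space_pair)
qed

end

theory Submission
  imports Defs "Jordan_Normal_Form.Spectral_Radius"
begin

text \<open>
  Let \<open>V\<close> be the matrix \<open>W\<close> with its rows made orthonormal in an eigenbasis of \<open>W W\<^sup>*\<close>
  (lemma \<open>whitening\<close>), and let \<open>x j\<close> be the columns of \<open>V D F\<close>. As \<open>D F\<close> is unitary, the vectors
  \<open>x j\<close> form a tight frame of the \<open>r\<close>-dimensional space, and the squared length of \<open>(W H)\<^sup>* y\<close> is
  \<open>n / l\<close> times the energy that the sampled frame vectors see in a vector whose squared length lies
  between \<open>\<sigma>\<^sub>r\<^sup>2\<close> and \<open>\<sigma>\<^sub>1\<^sup>2\<close> times that of \<open>y\<close>. It remains to show that the Gram matrix of the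
  sampled vectors has its eigenvalues between \<open>0.16 l / n\<close> and \<open>2.1904 l / n\<close>; the permutation only
  relabels the frame. Two independent effects achieve this.

  The random phases make all frame vectors short: with \<open>M = (\<surd>r + \<surd>(8 ln (r n)))\<^sup>2\<close>, each squared
  length exceeds \<open>M / n\<close> with probability at most \<open>1 / (r n)\<close>. The exponential moment of the squared
  length of a combination with random phases is linearised by an auxiliary Gaussian vector; the
  moment generating function of a phase is at most that of a complex Gaussian variable, which
  leaves an explicit Gaussian integral (\<open>phases_exp_moment\<close>, \<open>phases_norm_tail\<close>).

  Sampling \<open>l\<close> vectors of a tight frame of short vectors without replacement then obeys a matrix
  Chernoff bound. The trace of the exponential of the Gram matrix is followed while the sample
  grows. One new vector is a rank-one update, for which \<open>trace_exp_rank_one_update\<close> gives the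
  Golden--Thompson inequality: between eigenbases of the old and the new matrix it reduces to the
  trapezoid inequality for \<open>exp\<close>, applied to many small updates. The dependence between the draws
  only helps: by \<open>exchange_inequality\<close> the vectors that are still available contribute at most
  their proportional share, because the trace of \<open>(P - Q) (e\<^sup>P - e\<^sup>Q)\<close> is nonnegative. Each of the two
  tails has probability at most \<open>r exp (- l / (2 M))\<close>, which is at most \<open>1 / r\<close> when
  \<open>l \<ge> 4 M ln r\<close>.

  Altogether the failure probability is at most \<open>3 / r\<close>. That failure is an event at all follows
  from writing the bounds on the singular values as inequalities between quadratic forms, which
  need to be tested on countably many vectors only.
\<close>

section \<open>Vectors as functions and orthonormal bases\<close>

text \<open>The dimension \<open>r\<close> varies inside the final statement, so vectors of length \<open>r\<close> are
  functions of which only the values below \<open>r\<close> count, and every notion carries \<open>r\<close> as an argument.\<close>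

definition ip :: "nat \<Rightarrow> (nat \<Rightarrow> complex) \<Rightarrow> (nat \<Rightarrow> complex) \<Rightarrow> complex" where
  "ip r x y = (\<Sum>a<r. cnj (x a) * y a)"

definition nrm2 :: "nat \<Rightarrow> (nat \<Rightarrow> complex) \<Rightarrow> real" where
  "nrm2 r x = (\<Sum>a<r. (cmod (x a))\<^sup>2)"

definition mv :: "nat \<Rightarrow> (nat \<Rightarrow> nat \<Rightarrow> complex) \<Rightarrow> (nat \<Rightarrow> complex) \<Rightarrow> nat \<Rightarrow> complex" where
  "mv r A x = (\<lambda>a. \<Sum>b<r. A a b * x b)"

definition hermitian_on :: "nat \<Rightarrow> (nat \<Rightarrow> nat \<Rightarrow> complex) \<Rightarrow> bool" where
  "hermitian_on r A \<longleftrightarrow> (\<forall>a<r. \<forall>b<r. A b a = cnj (A a b))"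

text \<open>The second conjunct is the completeness relation; expansions and Parseval's identity are
  read off from it directly.\<close>

definition orthonormal_basis :: "nat \<Rightarrow> (nat \<Rightarrow> nat \<Rightarrow> complex) \<Rightarrow> bool" where
  "orthonormal_basis r u \<longleftrightarrow>
     (\<forall>i<r. \<forall>j<r. ip r (u i) (u j) = of_bool (i = j)) \<and>
     (\<forall>a<r. \<forall>b<r. (\<Sum>i<r. u i a * cnj (u i b)) = of_bool (a = b))"

definition spectral_basis ::
  "nat \<Rightarrow> (nat \<Rightarrow> nat \<Rightarrow> complex) \<Rightarrow> (nat \<Rightarrow> real) \<Rightarrow> (nat \<Rightarrow> nat \<Rightarrow> complex) \<Rightarrow> bool" where
  "spectral_basis r A lam u \<longleftrightarrow> orthonormal_basis r u \<and>
     (\<forall>i<r. \<forall>a<r. mv r A (u i) a = of_real (lam i) * u i a)"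

lemma sum_of_bool_mult:
  fixes f :: "nat \<Rightarrow> 'a :: comm_semiring_1"
  assumes "i < r"
  shows "(\<Sum>a<r. of_bool (i = a) * f a) = f i" "(\<Sum>a<r. of_bool (a = i) * f a) = f i"
proof -
  have "(\<Sum>a<r. of_bool (i = a) * f a) = (\<Sum>a<r. if a = i then f a else 0)"
    by (intro sum.cong) auto
  with assms show "(\<Sum>a<r. of_bool (i = a) * f a) = f i" by simp
  have "(\<Sum>a<r. of_bool (a = i) * f a) = (\<Sum>a<r. if a = i then f a else 0)"
    by (intro sum.cong) auto
  with assms show "(\<Sum>a<r. of_bool (a = i) * f a) = f i" by simp
qed

lemma ip_self: "ip r x x = of_real (nrm2 r x)"
  unfolding ip_def nrm2_def of_real_sum complex_norm_square by (simp only: mult.commute)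

lemma cnj_ip: "cnj (ip r x y) = ip r y x"
  by (simp add: ip_def mult.commute)

lemma ip_cong: "(\<And>a. a < r \<Longrightarrow> x a = x' a) \<Longrightarrow> (\<And>a. a < r \<Longrightarrow> y a = y' a) \<Longrightarrow> ip r x y = ip r x' y'"
  by (simp add: ip_def)

lemma nrm2_nonneg: "nrm2 r x \<ge> 0"
  by (simp add: nrm2_def sum_nonneg)

lemma ip_scale_right: "ip r x (\<lambda>a. c * y a) = c * ip r x y"
  by (simp add: ip_def sum_distrib_left algebra_simps)

lemma ip_sum_right: "ip r x (\<lambda>a. \<Sum>k\<in>K. c k * y k a) = (\<Sum>k\<in>K. c k * ip r x (y k))"
proof -
  have "ip r x (\<lambda>a. \<Sum>k\<in>K. c k * y k a) = (\<Sum>a<r. \<Sum>k\<in>K. c k * (cnj (x a) * y k a))"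
    by (simp add: ip_def sum_distrib_left algebra_simps)
  also have "\<dots> = (\<Sum>k\<in>K. c k * ip r x (y k))"
    by (subst sum.swap) (simp add: ip_def sum_distrib_left)
  finally show ?thesis .
qed

lemma ip_sum_left: "ip r (\<lambda>a. \<Sum>k\<in>K. c k * y k a) x = (\<Sum>k\<in>K. cnj (c k) * ip r (y k) x)"
proof -
  have "ip r (\<lambda>a. \<Sum>k\<in>K. c k * y k a) x = cnj (ip r x (\<lambda>a. \<Sum>k\<in>K. c k * y k a))"
    by (simp add: cnj_ip)
  also have "\<dots> = (\<Sum>k\<in>K. cnj (c k) * ip r (y k) x)"
    by (simp add: ip_sum_right cnj_ip)
  finally show ?thesis .
qed

lemma ip_mv_hermitian:
  assumes "hermitian_on r A"
  shows "ip r x (mv r A y) = ip r (mv r A x) y"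
proof -
  have "ip r x (mv r A y) = (\<Sum>a<r. \<Sum>b<r. cnj (x a) * A a b * y b)"
    by (simp add: ip_def mv_def sum_distrib_left mult.assoc)
  also have "\<dots> = (\<Sum>b<r. \<Sum>a<r. cnj (x a) * cnj (A b a) * y b)"
    using assms by (subst sum.swap) (intro sum.cong refl, metis hermitian_on_def lessThan_iff)
  also have "\<dots> = ip r (mv r A x) y"
    by (simp add: ip_def mv_def sum_distrib_right sum_distrib_left mult_ac)
  finally show ?thesis .
qed

lemma orthonormal_basisD:
  assumes "orthonormal_basis r u"
  shows "i < r \<Longrightarrow> j < r \<Longrightarrow> ip r (u i) (u j) = of_bool (i = j)"
    and "a < r \<Longrightarrow> b < r \<Longrightarrow> (\<Sum>i<r. u i a * cnj (u i b)) = of_bool (a = b)"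
  using assms by (auto simp: orthonormal_basis_def)

lemma basis_expansion:
  assumes "orthonormal_basis r u" "a < r"
  shows "x a = (\<Sum>i<r. ip r (u i) x * u i a)"
proof -
  have "(\<Sum>i<r. ip r (u i) x * u i a) = (\<Sum>i<r. \<Sum>b<r. u i a * cnj (u i b) * x b)"
    by (simp add: ip_def sum_distrib_right sum_distrib_left mult_ac)
  also have "\<dots> = (\<Sum>b<r. (\<Sum>i<r. u i a * cnj (u i b)) * x b)"
    by (subst sum.swap) (simp add: sum_distrib_right)
  also have "\<dots> = (\<Sum>b<r. of_bool (a = b) * x b)"
    using assms by (intro sum.cong) (auto simp: orthonormal_basisD(2))
  also have "\<dots> = x a"
    using assms by (simp add: sum_of_bool_mult)
  finally show ?thesis by simp
qed

lemma parseval: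
  assumes "orthonormal_basis r u"
  shows "ip r x y = (\<Sum>i<r. ip r x (u i) * ip r (u i) y)"
proof -
  have "ip r x y = ip r x (\<lambda>a. \<Sum>i<r. ip r (u i) y * u i a)"
    using basis_expansion[OF assms] by (intro ip_cong) auto
  also have "\<dots> = (\<Sum>i<r. ip r (u i) y * ip r x (u i))"
    by (rule ip_sum_right)
  finally show ?thesis by (simp add: mult.commute)
qed

lemma cmod_ip_commute: "cmod (ip r x y) = cmod (ip r y x)"
  by (metis cnj_ip complex_mod_cnj)

lemma ip_mult_swap: "ip r x y * ip r y x = of_real ((cmod (ip r x y))\<^sup>2)"
  by (metis cnj_ip complex_norm_square)

lemma parseval_nrm2:
  assumes "orthonormal_basis r u"
  shows "nrm2 r x = (\<Sum>i<r. (cmod (ip r (u i) x))\<^sup>2)"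
proof -
  have "complex_of_real (nrm2 r x) = of_real (\<Sum>i<r. (cmod (ip r (u i) x))\<^sup>2)"
    unfolding ip_self[symmetric] parseval[OF assms, of x x] ip_mult_swap
    by (simp add: cmod_ip_commute)
  then show ?thesis using of_real_eq_iff by blast
qed

lemma nrm2_eq_0: "nrm2 r x = 0 \<longleftrightarrow> (\<forall>a<r. x a = 0)"
  by (auto simp: nrm2_def sum_nonneg_eq_0_iff)

lemma exists_unit_eigenvector:
  assumes "0 < r"
  obtains e v where "nrm2 r v = 1" "\<And>a. a < r \<Longrightarrow> mv r A v a = e * v a"
proof -
  define M where "M = mat r r (\<lambda>(a, b). A a b)"
  have M: "M \<in> carrier_mat r r" by (simp add: M_def)
  obtain e where "eigenvalue M e"
    using spectrum_non_empty[OF M assms] by (auto simp: spectrum_def)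
  then obtain w where w: "w \<in> carrier_vec r" "w \<noteq> 0\<^sub>v r" "M *\<^sub>v w = e \<cdot>\<^sub>v w"
    using M by (auto simp: eigenvalue_def eigenvector_def)
  define c where "c = nrm2 r (($) w)"
  have "c \<noteq> 0"
  proof
    assume "c = 0"
    then have "w = 0\<^sub>v r" using w(1) by (intro eq_vecI) (auto simp: c_def nrm2_eq_0)
    with w show False by simp
  qed
  with nrm2_nonneg[of r "($) w"] have c: "c > 0" by (simp add: c_def)
  define v where "v = (\<lambda>a. w $ a / sqrt c)"
  have "nrm2 r v = nrm2 r (($) w) / c"
    using c by (simp add: v_def nrm2_def norm_divide power_divide sum_divide_distrib)
  then have 1: "nrm2 r v = 1" using c by (simp add: c_def)
  have 2: "mv r A v a = e * v a" if "a < r" for a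
  proof -
    have "(M *\<^sub>v w) $ a = (\<Sum>b<r. A a b * w $ b)"
      using that w(1) by (simp add: M_def scalar_prod_def lessThan_atLeast0)
    with w(3) have "(\<Sum>b<r. A a b * w $ b) = e * w $ a" using that w(1) by simp
    then show ?thesis by (simp add: mv_def v_def flip: sum_divide_distrib)
  qed
  show thesis by (rule that[OF 1 2])
qed

section \<open>The spectral theorem for Hermitian matrices\<close>

text \<open>The reflection that exchanges the lines of \<open>v\<close> and of the first unit vector is unitary
  and given by a closed formula, so a unit vector extends to a basis without any
  orthogonalisation process. Being Hermitian as well, the reflection satisfies the orthonormality
  and the completeness relation for the same reason.\<close>

lemma householder_basis:
  assumes "0 < r" "nrm2 r v = 1"
  obtains w c where "orthonormal_basis r w" "\<And>a. a < r \<Longrightarrow> w 0 a = c * v a"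
proof -
  define p where "p = (if v 0 = 0 then 1 else sgn (v 0))"
  have p1: "cmod p = 1" and p2: "v 0 = of_real (cmod (v 0)) * p"
    by (auto simp: p_def norm_sgn sgn_eq norm_divide)
  have p3: "cnj p * p = 1"
    using p1 by (metis complex_norm_square mult.commute of_real_1 one_power2)
  note p = p1 p2 p3
  (* the phase p makes the two summands of z point in the same direction, so that z is nonzero *)
  define z where "z = (\<lambda>a. v a + (if a = 0 then p else 0))"
  define N where "N = 2 + 2 * cmod (v 0)"
  have N: "N > 0" by (simp add: N_def add_pos_nonneg)
  have z0: "z 0 = (1 + of_real (cmod (v 0))) * p"
  proof -
    have "z 0 = v 0 + p" by (simp add: z_def)
    also have "\<dots> = of_real (cmod (v 0)) * p + p" by (subst p2) (rule refl)
    finally show ?thesis by (simp add: algebra_simps)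
  qed
  have cz0: "cnj (z 0) = of_real (N / 2) * cnj p"
    by (simp add: z0 N_def)
  have zz: "ip r z z = of_real N"
  proof -
    have "ip r z z = (\<Sum>a<r. cnj (v a) * v a + (if a = 0 then cnj (v 0) * p + cnj p * v 0 + 1 else 0))"
      unfolding ip_def z_def using p(3) by (intro sum.cong) (auto simp: algebra_simps)
    also have "\<dots> = ip r v v + (cnj (v 0) * p + cnj p * v 0 + 1)"
      using assms(1) by (simp add: sum.distrib ip_def)
    also have "cnj (v 0) * p = of_real (cmod (v 0))"
      by (subst p2) (simp add: mult.assoc p3)
    also have "cnj p * v 0 = of_real (cmod (v 0))"
      by (subst p2) (simp add: mult.left_commute p3)
    finally show ?thesis by (simp add: ip_self assms(2) N_def)
  qed
  define w where "w = (\<lambda>j i. of_bool (i = j) - 2 * z i * cnj (z j) / of_real N)"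
  have key: "(\<Sum>a<r. w a i * w j a) = of_bool (i = j)" if "i < r" "j < r" for i j
  proof -
    have "(\<Sum>a<r. w a i * w j a) = (\<Sum>a<r. of_bool (i = a) * of_bool (a = j)
        - of_bool (i = a) * (2 * z a * cnj (z j) / of_real N)
        - of_bool (a = j) * (2 * z i * cnj (z a) / of_real N)
        + 4 * z i * cnj (z j) / (of_real N)\<^sup>2 * (cnj (z a) * z a))"
      by (intro sum.cong) (auto simp: w_def algebra_simps power2_eq_square)
    also have "\<dots> = of_bool (i = j) - 2 * z i * cnj (z j) / of_real N - 2 * z i * cnj (z j) / of_real N
        + 4 * z i * cnj (z j) / (of_real N)\<^sup>2 * ip r z z"
      using that unfolding sum.distrib sum_subtractf ip_def sum_distrib_left[symmetric]
      by (simp only: sum_of_bool_mult(1)[OF that(1)] sum_of_bool_mult(2)[OF that(2)])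
    also have "\<dots> = of_bool (i = j)"
      using N by (simp add: zz power2_eq_square)
    finally show ?thesis .
  qed
  have sym: "cnj (w i a) = w a i" for i a by (simp add: w_def mult.commute)
  have 1: "orthonormal_basis r w"
    unfolding orthonormal_basis_def
  proof (intro conjI allI impI)
    fix i j assume "i < r" "j < r"
    then show "ip r (w i) (w j) = of_bool (i = j)"
      using key[of i j] by (simp add: ip_def sym)
  next
    fix a b assume "a < r" "b < r"
    then show "(\<Sum>i<r. w i a * cnj (w i b)) = of_bool (a = b)"
      using key[of a b] by (simp add: sym)
  qed
  have 2: "w 0 a = - cnj p * v a" if "a < r" for a
  proof -
    have "w 0 a = of_bool (a = 0) - z a * cnj p"
      using N by (simp add: w_def cz0)
    then show ?thesis using p(3) by (cases "a = 0") (auto simp: z_def algebra_simps eq_neg_iff_add_eq_0)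
  qed
  show thesis by (rule that[OF 1 2])
qed

lemma basis_compose:
  assumes Y: "orthonormal_basis r Y" and w: "orthonormal_basis r w"
  shows "orthonormal_basis r (\<lambda>k a. \<Sum>i<r. Y k i * w i a)"
  unfolding orthonormal_basis_def
proof (intro conjI allI impI)
  fix k j assume k: "k < r" and j: "j < r"
  have "ip r (\<lambda>a. \<Sum>i<r. Y k i * w i a) (\<lambda>a. \<Sum>i<r. Y j i * w i a)
      = (\<Sum>i<r. Y j i * (\<Sum>i'<r. cnj (Y k i') * ip r (w i') (w i)))"
    unfolding ip_sum_right ip_sum_left ..
  also have "\<dots> = (\<Sum>i<r. Y j i * (\<Sum>i'<r. of_bool (i' = i) * cnj (Y k i')))"
    by (simp add: orthonormal_basisD(1)[OF w] mult.commute)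
  also have "\<dots> = (\<Sum>i<r. Y j i * cnj (Y k i))"
    by (simp add: sum_of_bool_mult)
  also have "\<dots> = of_bool (k = j)"
    using orthonormal_basisD(1)[OF Y k j] by (simp add: ip_def mult.commute)
  finally show "ip r (\<lambda>a. \<Sum>i<r. Y k i * w i a) (\<lambda>a. \<Sum>i<r. Y j i * w i a) = of_bool (k = j)" .
next
  fix a b assume a: "a < r" and b: "b < r"
  have "(\<Sum>k<r. (\<Sum>i<r. Y k i * w i a) * cnj (\<Sum>i<r. Y k i * w i b))
      = (\<Sum>k<r. \<Sum>i<r. \<Sum>j<r. (Y k i * cnj (Y k j)) * (w i a * cnj (w j b)))"
    by (simp add: sum_product mult_ac)
  also have "\<dots> = (\<Sum>i<r. \<Sum>k<r. \<Sum>j<r. (Y k i * cnj (Y k j)) * (w i a * cnj (w j b)))"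
    by (rule sum.swap)
  also have "\<dots> = (\<Sum>i<r. \<Sum>j<r. \<Sum>k<r. (Y k i * cnj (Y k j)) * (w i a * cnj (w j b)))"
    by (intro sum.cong refl sum.swap)
  also have "\<dots> = (\<Sum>i<r. \<Sum>j<r. of_bool (i = j) * (w i a * cnj (w j b)))"
    unfolding sum_distrib_right[symmetric] by (simp add: orthonormal_basisD(2)[OF Y])
  also have "\<dots> = (\<Sum>i<r. w i a * cnj (w i b))"
    by (intro sum.cong refl) (simp add: sum_of_bool_mult)
  also have "\<dots> = of_bool (a = b)"
    using a b w by (simp add: orthonormal_basisD(2))
  finally show "(\<Sum>k<r. (\<Sum>i<r. Y k i * w i a) * cnj (\<Sum>i<r. Y k i * w i b)) = of_bool (a = b)" .
qed

lemma mv_sum: "mv r A (\<lambda>b. \<Sum>i\<in>I. c i * x i b) a = (\<Sum>i\<in>I. c i * mv r A (x i) a)"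
proof -
  have "mv r A (\<lambda>b. \<Sum>i\<in>I. c i * x i b) a = (\<Sum>b<r. \<Sum>i\<in>I. c i * (A a b * x i b))"
    by (simp add: mv_def sum_distrib_left mult_ac)
  also have "\<dots> = (\<Sum>i\<in>I. c i * mv r A (x i) a)"
    by (subst sum.swap) (simp add: mv_def sum_distrib_left)
  finally show ?thesis .
qed

lemma mv_scale: "mv r A (\<lambda>b. c * x b) a = c * mv r A x a"
  by (simp add: mv_def sum_distrib_left mult_ac)

lemma mv_cong: "(\<And>b. b < r \<Longrightarrow> x b = y b) \<Longrightarrow> mv r A x a = mv r A y a"
  by (simp add: mv_def)

text \<open>A basis of the orthogonal complement of the first unit vector, completed by that vector.\<close>

lemma basis_direct_sum:
  assumes y: "orthonormal_basis m y"
  defines "Y \<equiv> \<lambda>k i. case k of 0 \<Rightarrow> of_bool (i = 0) | Suc k' \<Rightarrow> (case i of 0 \<Rightarrow> 0 | Suc i' \<Rightarrow> y k' i')"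
  shows "orthonormal_basis (Suc m) Y"
  unfolding orthonormal_basis_def
proof (intro conjI allI impI)
  fix i j assume "i < Suc m" "j < Suc m"
  then show "ip (Suc m) (Y i) (Y j) = of_bool (i = j)"
    using orthonormal_basisD(1)[OF y]
    by (cases i; cases j) (auto simp: ip_def Y_def sum.lessThan_Suc_shift simp del: sum.lessThan_Suc)
next
  fix a b assume "a < Suc m" "b < Suc m"
  then show "(\<Sum>i<Suc m. Y i a * cnj (Y i b)) = of_bool (a = b)"
    using orthonormal_basisD(2)[OF y]
    by (cases a; cases b) (auto simp: Y_def sum.lessThan_Suc_shift simp del: sum.lessThan_Suc)
qed

text \<open>Deflation: an eigenvector is completed to an orthonormal basis; symmetry makes its
  orthogonal complement invariant, and the induction hypothesis diagonalises the matrix of the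
  restriction.\<close>

theorem hermitian_spectral:
  "hermitian_on r A \<Longrightarrow> \<exists>lam u. spectral_basis r A lam u"
proof (induction r arbitrary: A)
  case 0
  show ?case by (auto simp: spectral_basis_def orthonormal_basis_def)
next
  case (Suc m)
  let ?r = "Suc m"
  obtain e v where v: "nrm2 ?r v = 1" and ev: "\<And>a. a < ?r \<Longrightarrow> mv ?r A v a = e * v a"
    using exists_unit_eigenvector[of ?r A] by blast
  have "ip ?r v (mv ?r A v) = ip ?r v (\<lambda>a. e * v a)"
    by (intro ip_cong refl ev)
  then have e1: "ip ?r v (mv ?r A v) = e"
    by (simp add: ip_scale_right ip_self v)
  have "cnj e = ip ?r v (mv ?r A v)"
    unfolding e1[symmetric] cnj_ip by (rule ip_mv_hermitian[OF Suc.prems, symmetric])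
  then have e: "cnj e = e" by (simp add: e1)
  then have eR: "e = of_real (Re e)" by (simp add: complex_eq_iff)
  obtain w c where w: "orthonormal_basis ?r w" and w0: "\<And>a. a < ?r \<Longrightarrow> w 0 a = c * v a"
    using householder_basis[OF _ v] by blast
  have Aw0: "mv ?r A (w 0) a = e * w 0 a" if "a < ?r" for a
  proof -
    have "mv ?r A (w 0) a = mv ?r A (\<lambda>b. c * v b) a" by (intro mv_cong w0)
    also have "\<dots> = e * w 0 a" by (simp add: mv_scale ev[OF that] w0[OF that])
    finally show ?thesis .
  qed
  define A3 where "A3 = (\<lambda>i j. ip ?r (w (Suc i)) (mv ?r A (w (Suc j))))"
  have "hermitian_on m A3"
    unfolding hermitian_on_def A3_def cnj_ip using ip_mv_hermitian[OF Suc.prems] by auto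
  from Suc.IH[OF this] obtain lam y where y: "orthonormal_basis m y"
    and evy: "\<And>i a. i < m \<Longrightarrow> a < m \<Longrightarrow> mv m A3 (y i) a = of_real (lam i) * y i a"
    by (auto simp: spectral_basis_def)
  define Y where "Y = (\<lambda>k i. case k of 0 \<Rightarrow> of_bool (i = 0)
      | Suc k' \<Rightarrow> (case i of 0 \<Rightarrow> 0 | Suc i' \<Rightarrow> y k' i'))"
  have Y: "orthonormal_basis ?r Y"
    unfolding Y_def by (rule basis_direct_sum[OF y])
  define u where "u = (\<lambda>k a. \<Sum>i<?r. Y k i * w i a)"
  have u: "orthonormal_basis ?r u"
    unfolding u_def by (rule basis_compose[OF Y w])
  have u0: "u 0 = w 0" by (simp add: u_def Y_def sum.lessThan_Suc_shift fun_eq_iff del: sum.lessThan_Suc)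
  have uS: "u (Suc k) = (\<lambda>a. \<Sum>i<m. y k i * w (Suc i) a)" for k
    by (simp add: u_def Y_def sum.lessThan_Suc_shift fun_eq_iff del: sum.lessThan_Suc)
  have AwS: "mv ?r A (w (Suc i)) a = (\<Sum>j<m. A3 j i * w (Suc j) a)" if "a < ?r" "i < m" for i a
  proof -
    have "ip ?r (w 0) (mv ?r A (w (Suc i))) = ip ?r (mv ?r A (w 0)) (w (Suc i))"
      by (rule ip_mv_hermitian[OF Suc.prems])
    also have "\<dots> = ip ?r (\<lambda>a. e * w 0 a) (w (Suc i))"
      by (intro ip_cong Aw0 refl)
    also have "\<dots> = cnj (e * ip ?r (w (Suc i)) (w 0))"
      by (metis cnj_ip ip_scale_right)
    also have "\<dots> = 0"
      using orthonormal_basisD(1)[OF w, of "Suc i" 0] that by simp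
    finally have "ip ?r (w 0) (mv ?r A (w (Suc i))) = 0" .
    with basis_expansion[OF w that(1), of "mv ?r A (w (Suc i))"] show ?thesis
      by (simp add: sum.lessThan_Suc_shift A3_def del: sum.lessThan_Suc)
  qed
  have AuS: "mv ?r A (u (Suc k)) a = of_real (lam k) * u (Suc k) a" if "a < ?r" "k < m" for k a
  proof -
    have "mv ?r A (u (Suc k)) a = (\<Sum>i<m. y k i * mv ?r A (w (Suc i)) a)"
      unfolding uS by (rule mv_sum)
    also have "\<dots> = (\<Sum>i<m. \<Sum>j<m. A3 j i * y k i * w (Suc j) a)"
      using that(1) by (intro sum.cong refl) (simp add: AwS sum_distrib_left mult_ac)
    also have "\<dots> = (\<Sum>j<m. mv m A3 (y k) j * w (Suc j) a)"
      by (subst sum.swap) (simp add: mv_def sum_distrib_right)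
    also have "\<dots> = (\<Sum>j<m. of_real (lam k) * (y k j * w (Suc j) a))"
      using that(2) by (intro sum.cong refl) (simp add: evy)
    also have "\<dots> = of_real (lam k) * u (Suc k) a"
      unfolding uS by (rule sum_distrib_left[symmetric])
    finally show ?thesis .
  qed
  have "spectral_basis ?r A (\<lambda>k. case k of 0 \<Rightarrow> Re e | Suc k' \<Rightarrow> lam k') u"
    unfolding spectral_basis_def
  proof (intro conjI u allI impI)
    fix i a assume "i < ?r" "a < ?r"
    then show "mv ?r A (u i) a = of_real (case i of 0 \<Rightarrow> Re e | Suc k' \<Rightarrow> lam k') * u i a"
      using Aw0 AuS eR by (cases i) (auto simp: u0)
  qed
  then show ?case by blast
qed

section \<open>Singular values through a quadratic form\<close>

text \<open>Both sides are the determinant of the block matrix with rows \<open>(X I, A)\<close> and \<open>(B, I)\<close>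
  times a power of \<open>X\<close>: it is block triangularised once by a column and once by a row operation.\<close>

lemma char_poly_mult_commute:
  fixes A B :: "'a :: idom mat"
  assumes A: "A \<in> carrier_mat r l" and B: "B \<in> carrier_mat l r"
  shows "[:0, 1:] ^ l * char_poly (A * B) = [:0, 1:] ^ r * char_poly (B * A)"
proof -
  define X :: "'a poly" where "X = [:0, 1:]"
  define A' where "A' = map_mat (\<lambda>a. [:a:]) A"
  define B' where "B' = map_mat (\<lambda>a. [:a:]) B"
  have A': "A' \<in> carrier_mat r l" and B': "B' \<in> carrier_mat l r"
    using A B by (auto simp: A'_def B'_def)
  have cp: "char_poly_matrix (A * B) = X \<cdot>\<^sub>m 1\<^sub>m r + - (A' * B')"
    "char_poly_matrix (B * A) = X \<cdot>\<^sub>m 1\<^sub>m l + - (B' * A')"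
    unfolding A'_def B'_def map_poly_mult(1)[OF A B, symmetric] map_poly_mult(1)[OF B A, symmetric]
    using A B by (auto simp: char_poly_matrix_def X_def intro!: eq_matI)
  define P where "P = four_block_mat (X \<cdot>\<^sub>m 1\<^sub>m r) A' B' (1\<^sub>m l)"
  define L where "L = four_block_mat (1\<^sub>m r) (0\<^sub>m r l) (- B') (X \<cdot>\<^sub>m 1\<^sub>m l)"
  define R where "R = four_block_mat (1\<^sub>m r) (0\<^sub>m r l) (- B') (1\<^sub>m l)"
  have P: "P \<in> carrier_mat (r + l) (r + l)" and L: "L \<in> carrier_mat (r + l) (r + l)"
    and R: "R \<in> carrier_mat (r + l) (r + l)"
    using A' B' by (auto simp: P_def L_def R_def)
  have "P * R = four_block_mat (X \<cdot>\<^sub>m 1\<^sub>m r * 1\<^sub>m r + A' * - B') (X \<cdot>\<^sub>m 1\<^sub>m r * 0\<^sub>m r l + A' * 1\<^sub>m l)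
      (B' * 1\<^sub>m r + 1\<^sub>m l * - B') (B' * 0\<^sub>m r l + 1\<^sub>m l * 1\<^sub>m l)"
    unfolding P_def R_def using A' B' by (intro mult_four_block_mat) auto
  also have "\<dots> = four_block_mat (char_poly_matrix (A * B)) A' (0\<^sub>m l r) (1\<^sub>m l)"
    unfolding cp using A' B'
    by (intro arg_cong4[where f=four_block_mat]) (auto intro!: eq_matI)
  finally have "det (P * R) = det (char_poly_matrix (A * B)) * det (1\<^sub>m l :: 'a poly mat)"
    using det_four_block_mat_lower_left_zero[OF _ A' refl, of "char_poly_matrix (A * B)" "1\<^sub>m l"] A B
    by simp
  moreover have "det (P * R) = det P * det R" by (rule det_mult[OF P R])
  moreover have "det R = 1"
    unfolding R_def using det_four_block_mat_upper_right_zero[OF _ refl, of "1\<^sub>m r" r "- B'" l "1\<^sub>m l"] B'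
    by simp
  ultimately have 1: "det P = char_poly (A * B)" by (simp add: char_poly_def)
  have "L * P = four_block_mat (1\<^sub>m r * (X \<cdot>\<^sub>m 1\<^sub>m r) + 0\<^sub>m r l * B') (1\<^sub>m r * A' + 0\<^sub>m r l * 1\<^sub>m l)
      (- B' * (X \<cdot>\<^sub>m 1\<^sub>m r) + X \<cdot>\<^sub>m 1\<^sub>m l * B') (- B' * A' + X \<cdot>\<^sub>m 1\<^sub>m l * 1\<^sub>m l)"
    unfolding P_def L_def using A' B' by (intro mult_four_block_mat) auto
  also have "\<dots> = four_block_mat (X \<cdot>\<^sub>m 1\<^sub>m r) A' (0\<^sub>m l r) (char_poly_matrix (B * A))"
    unfolding cp using A' B'
    by (intro arg_cong4[where f=four_block_mat]) (auto intro!: eq_matI)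
  finally have "det (L * P) = det (X \<cdot>\<^sub>m 1\<^sub>m r) * det (char_poly_matrix (B * A))"
    using det_four_block_mat_lower_left_zero[OF _ A' refl, of "X \<cdot>\<^sub>m 1\<^sub>m r" "char_poly_matrix (B * A)"] A B
    by simp
  moreover have "det (L * P) = det L * det P" by (rule det_mult[OF L P])
  moreover have "det L = X ^ l"
    unfolding L_def
    using det_four_block_mat_upper_right_zero[OF _ refl, of "1\<^sub>m r" r "- B'" l "X \<cdot>\<^sub>m 1\<^sub>m l"] B'
    by simp
  ultimately show ?thesis using 1 by (simp add: char_poly_def X_def)
qed

lemma proots_prod_linear_factors:
  fixes xs :: "'a :: field list"
  shows "proots (\<Prod>a\<leftarrow>xs. [:- a, 1:]) = mset xs"
proof (induction xs)
  case (Cons a xs)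
  have "(\<Prod>a\<leftarrow>xs. [:- a, 1:]) \<noteq> 0"
    by (auto simp: prod_list_zero_iff)
  then have "proots ([:- a, 1:] * (\<Prod>a\<leftarrow>xs. [:- a, 1:])) = {#a#} + mset xs"
    by (subst proots_mult) (auto simp: Cons.IH)
  then show ?case by simp
qed auto

lemma proots_char_poly_spectral:
  assumes M: "M \<in> carrier_mat r r"
    and sb: "spectral_basis r (\<lambda>i j. M $$ (i, j)) lam u"
  shows "proots (char_poly M) = image_mset (\<lambda>i. complex_of_real (lam i)) (mset_set {..<r})"
proof -
  define U where "U = mat r r (\<lambda>(a, i). u i a)"
  define V where "V = mat r r (\<lambda>(i, a). cnj (u i a))"
  define D where "D = mat r r (\<lambda>(i, j). if i = j then complex_of_real (lam i) else 0)"
  have carr: "U \<in> carrier_mat r r" "V \<in> carrier_mat r r" "D \<in> carrier_mat r r"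
    by (auto simp: U_def V_def D_def)
  have ob: "orthonormal_basis r u" using sb by (simp add: spectral_basis_def)
  have VU: "V * U = 1\<^sub>m r"
    using orthonormal_basisD(1)[OF ob]
    by (intro eq_matI) (auto simp: U_def V_def scalar_prod_def ip_def lessThan_atLeast0 one_mat_def)
  have UV: "U * V = 1\<^sub>m r"
    using orthonormal_basisD(2)[OF ob]
    by (intro eq_matI) (auto simp: U_def V_def scalar_prod_def ip_def lessThan_atLeast0 one_mat_def)
  have "M * U = U * D"
  proof (rule eq_matI)
    fix a i assume "a < dim_row (U * D)" "i < dim_col (U * D)"
    then have a: "a < r" and i: "i < r" using carr by auto
    have "(M * U) $$ (a, i) = mv r (\<lambda>i j. M $$ (i, j)) (u i) a"
      using a i M by (simp add: U_def scalar_prod_def mv_def lessThan_atLeast0)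
    also have "\<dots> = of_real (lam i) * u i a"
      using sb a i by (simp add: spectral_basis_def)
    also have "\<dots> = (\<Sum>b<r. if b = i then u b a * of_real (lam i) else 0)"
      using i by simp
    also have "\<dots> = (\<Sum>b<r. u b a * (if b = i then of_real (lam b) else 0))"
      by (intro sum.cong) auto
    also have "\<dots> = (U * D) $$ (a, i)"
      using a i by (simp add: U_def D_def scalar_prod_def lessThan_atLeast0)
    finally show "(M * U) $$ (a, i) = (U * D) $$ (a, i)" .
  qed (use carr M in auto)
  then have "U * D * V = M * U * V" by simp
  also have "\<dots> = M * (U * V)" using carr M by (intro assoc_mult_mat) auto
  also have "\<dots> = M" using M by (simp add: UV)
  finally have "M = U * D * V" by simp
  then have "similar_mat M D"
    using carr M VU UV by (intro similar_matI[of _ _ U V r]) auto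
  then have "char_poly M = char_poly D" by (rule char_poly_similar)
  also have "\<dots> = (\<Prod>a\<leftarrow>diag_mat D. [:- a, 1:])"
    by (rule char_poly_upper_triangular[OF carr(3)]) (auto simp: upper_triangular_def D_def)
  also have "diag_mat D = map (\<lambda>i. complex_of_real (lam i)) [0..<r]"
    by (auto simp: diag_mat_def D_def)
  finally have "proots (char_poly M) = mset (map (\<lambda>i. complex_of_real (lam i)) [0..<r])"
    by (simp only: proots_prod_linear_factors)
  then show ?thesis by (simp add: mset_upt lessThan_atLeast0)
qed

lemma mat_adjoint_carrier: "mat_adjoint A \<in> carrier_mat (dim_col A) (dim_row A)"
  by (auto simp: mat_adjoint_def)

lemma index_mat_adjoint:
  "i < dim_col A \<Longrightarrow> j < dim_row A \<Longrightarrow> mat_adjoint A $$ (i, j) = cnj (A $$ (j, i))"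
  by (simp add: mat_adjoint_def mat_of_rows_index)

text \<open>This is the squared norm of \<open>A\<^sup>* y\<close>.\<close>

definition adjoint_energy :: "complex mat \<Rightarrow> (nat \<Rightarrow> complex) \<Rightarrow> real" where
  "adjoint_energy A y = (\<Sum>k<dim_col A. (cmod (\<Sum>a<dim_row A. cnj (A $$ (a, k)) * y a))\<^sup>2)"

lemma spectral_quadratic_form:
  assumes "spectral_basis r A lam u"
  shows "ip r y (mv r A y) = of_real (\<Sum>i<r. lam i * (cmod (ip r (u i) y))\<^sup>2)"
proof -
  have ob: "orthonormal_basis r u" using assms by (simp add: spectral_basis_def)
  have "mv r A y a = (\<Sum>i<r. (ip r (u i) y * of_real (lam i)) * u i a)" if "a < r" for a
  proof -
    have "mv r A y a = mv r A (\<lambda>b. \<Sum>i<r. ip r (u i) y * u i b) a"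
      by (intro mv_cong basis_expansion[OF ob])
    also have "\<dots> = (\<Sum>i<r. ip r (u i) y * mv r A (u i) a)" by (rule mv_sum)
    also have "\<dots> = (\<Sum>i<r. (ip r (u i) y * of_real (lam i)) * u i a)"
      using assms that by (simp add: spectral_basis_def mult.assoc)
    finally show ?thesis .
  qed
  then have "ip r y (mv r A y) = ip r y (\<lambda>a. \<Sum>i<r. (ip r (u i) y * of_real (lam i)) * u i a)"
    by (intro ip_cong refl)
  also have "\<dots> = (\<Sum>i<r. of_real (lam i) * (ip r (u i) y * ip r y (u i)))"
    unfolding ip_sum_right by (simp add: mult_ac)
  also have "\<dots> = of_real (\<Sum>i<r. lam i * (cmod (ip r (u i) y))\<^sup>2)"
    by (simp add: ip_mult_swap)
  finally show ?thesis .
qed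

lemma gram_quadratic_form:
  "ip r y (mv r (\<lambda>a b. \<Sum>k\<in>K. x k a * cnj (x k b)) y) = of_real (\<Sum>k\<in>K. (cmod (ip r (x k) y))\<^sup>2)"
proof -
  have "mv r (\<lambda>a b. \<Sum>k\<in>K. x k a * cnj (x k b)) y a = (\<Sum>k\<in>K. ip r (x k) y * x k a)" for a
  proof -
    have "mv r (\<lambda>a b. \<Sum>k\<in>K. x k a * cnj (x k b)) y a = (\<Sum>b<r. \<Sum>k\<in>K. x k a * (cnj (x k b) * y b))"
      by (simp add: mv_def sum_distrib_left sum_distrib_right mult_ac)
    also have "\<dots> = (\<Sum>k\<in>K. ip r (x k) y * x k a)"
      by (subst sum.swap) (simp add: ip_def sum_distrib_left sum_distrib_right mult_ac)
    finally show ?thesis .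
  qed
  then have "ip r y (mv r (\<lambda>a b. \<Sum>k\<in>K. x k a * cnj (x k b)) y)
      = ip r y (\<lambda>a. \<Sum>k\<in>K. ip r (x k) y * x k a)"
    by (intro ip_cong) auto
  also have "\<dots> = (\<Sum>k\<in>K. ip r (x k) y * ip r y (x k))"
    by (rule ip_sum_right)
  also have "\<dots> = of_real (\<Sum>k\<in>K. (cmod (ip r (x k) y))\<^sup>2)"
    by (simp add: ip_mult_swap)
  finally show ?thesis .
qed

lemma hermitian_gram: "hermitian_on r (\<lambda>a b. \<Sum>k\<in>K. x k a * cnj (x k b))"
  by (simp add: hermitian_on_def mult.commute)

lemma spectral_gram_energy:
  assumes "spectral_basis r (\<lambda>a b. \<Sum>k\<in>K. x k a * cnj (x k b)) lam u"
  shows "(\<Sum>k\<in>K. (cmod (ip r (x k) y))\<^sup>2) = (\<Sum>i<r. lam i * (cmod (ip r (u i) y))\<^sup>2)"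
  using spectral_quadratic_form[OF assms, of y] unfolding gram_quadratic_form of_real_eq_iff .

lemma sum_basis_coefficients:
  assumes "orthonormal_basis r u" "j < r"
  shows "(\<Sum>i<r. c i * (cmod (ip r (u i) (u j)))\<^sup>2) = c j"
proof -
  have "(\<Sum>i<r. c i * (cmod (ip r (u i) (u j)))\<^sup>2) = (\<Sum>i<r. if i = j then c i else 0)"
    using assms by (intro sum.cong) (auto simp: orthonormal_basisD(1))
  with assms(2) show ?thesis by simp
qed

lemma spectral_gram_nonneg:
  assumes "spectral_basis r (\<lambda>a b. \<Sum>k\<in>K. x k a * cnj (x k b)) lam u" "j < r"
  shows "lam j = (\<Sum>k\<in>K. (cmod (ip r (x k) (u j)))\<^sup>2)" and "lam j \<ge> 0"
proof -
  have "orthonormal_basis r u" using assms by (simp add: spectral_basis_def)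
  with spectral_gram_energy[OF assms(1), of "u j"] assms(2)
  show *: "lam j = (\<Sum>k\<in>K. (cmod (ip r (x k) (u j)))\<^sup>2)"
    by (simp add: sum_basis_coefficients)
  show "lam j \<ge> 0" unfolding * by (intro sum_nonneg) auto
qed

lemma sorted_list_of_multiset_replicate_0:
  assumes "\<And>x. x \<in># S \<Longrightarrow> (0::real) \<le> x"
  shows "sorted_list_of_multiset (S + replicate_mset k 0) = replicate k 0 @ sorted_list_of_multiset S"
proof -
  have "sorted (replicate k 0 @ sorted_list_of_multiset S)"
    using assms by (auto simp: sorted_append)
  then have "sort (replicate k 0 @ sorted_list_of_multiset S) = replicate k 0 @ sorted_list_of_multiset S"
    by (rule sorted_sort_id)
  moreover have "sort (replicate k 0 @ sorted_list_of_multiset S)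
      = sorted_list_of_multiset (mset (replicate k 0 @ sorted_list_of_multiset S))"
    by (simp only: sorted_list_of_multiset_mset)
  ultimately show ?thesis by (simp add: add.commute)
qed

text \<open>The singular values are defined through the \<open>l\<close> by \<open>l\<close> matrix \<open>A\<^sup>* A\<close>, whereas the
  smaller matrix \<open>A A\<^sup>*\<close> is the one that is concentrated. Their spectra differ by \<open>l - r\<close> zeros,
  which come last in nonincreasing order and are exactly the entries that are cut off.\<close>

lemma singular_values_spectral:
  assumes A: "A \<in> carrier_mat r l" and "r \<le> l"
    and sb: "spectral_basis r (\<lambda>a b. \<Sum>k<l. A $$ (a, k) * cnj (A $$ (b, k))) lam u"
  shows "singular_values A
      = rev (sorted_list_of_multiset (image_mset (\<lambda>i. sqrt (lam i)) (mset_set {..<r})))"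
proof -
  let ?B = "mat_adjoint A"
  let ?S = "image_mset (\<lambda>i. sqrt (lam i)) (mset_set {..<r})"
  have B: "?B \<in> carrier_mat l r" using mat_adjoint_carrier[of A] A by auto
  have AB: "A * ?B \<in> carrier_mat r r" and BA: "?B * A \<in> carrier_mat l l" using A B by auto
  have "(A * ?B) $$ (a, b) = (\<Sum>k<l. A $$ (a, k) * cnj (A $$ (b, k)))" if "a < r" "b < r" for a b
    using that A B by (simp add: scalar_prod_def index_mat_adjoint lessThan_atLeast0)
  then have "spectral_basis r (\<lambda>i j. (A * ?B) $$ (i, j)) lam u"
    using sb by (simp add: spectral_basis_def mv_def)
  from proots_char_poly_spectral[OF AB this]
  have pAB: "proots (char_poly (A * ?B)) = image_mset (\<lambda>i. complex_of_real (lam i)) (mset_set {..<r})" .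
  have nz: "char_poly (A * ?B) \<noteq> 0" "char_poly (?B * A) \<noteq> 0"
    using degree_monic_char_poly[OF AB] degree_monic_char_poly[OF BA] by auto
  have X: "proots ([:0, 1:] ^ m) = replicate_mset m (0::complex)" for m
    unfolding proots_power by (induction m) auto
  (* cancelling the roots at zero on both sides leaves l - r of them for the larger matrix *)
  have "proots ([:0, 1:] ^ l * char_poly (A * ?B)) = proots ([:0, 1:] ^ r * char_poly (?B * A))"
    by (simp only: char_poly_mult_commute[OF A B])
  then have "replicate_mset l 0 + proots (char_poly (A * ?B))
      = replicate_mset r 0 + proots (char_poly (?B * A))"
    using nz by (simp add: proots_mult X)
  moreover have "replicate_mset l (0::complex) = replicate_mset r 0 + replicate_mset (l - r) 0"
    using assms(2) by (intro multiset_eqI) (auto simp: count_replicate_mset)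
  ultimately have "proots (char_poly (?B * A)) = proots (char_poly (A * ?B)) + replicate_mset (l - r) 0"
    by (simp add: add.assoc add.commute)
  then have "image_mset (\<lambda>z. sqrt (Re z)) (proots (char_poly (?B * A))) = ?S + replicate_mset (l - r) 0"
    by (simp add: pAB multiset.map_comp o_def)
  moreover have nonneg: "0 \<le> x" if "x \<in># ?S" for x
  proof -
    have "0 \<le> lam i" if "i < r" for i
      using spectral_gram_nonneg(2)[where K = "{..<l}" and x = "\<lambda>k a. A $$ (a, k)", OF sb that] .
    with that show ?thesis by auto
  qed
  ultimately have "rev (sorted_list_of_multiset (image_mset (\<lambda>z. sqrt (Re z)) (proots (char_poly (?B * A)))))
      = rev (sorted_list_of_multiset ?S) @ replicate (l - r) 0"
    using sorted_list_of_multiset_replicate_0[of ?S "l - r", OF nonneg] by simp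
  moreover have "length (sorted_list_of_multiset ?S) = r"
    by (metis card_lessThan mset_sorted_list_of_multiset size_image_mset size_mset size_mset_set)
  ultimately show ?thesis
    using A assms(2) by (simp add: singular_values_def)
qed

lemma singular_value_extremes:
  assumes A: "A \<in> carrier_mat r l" and "1 \<le> r" "r \<le> l"
    and sb: "spectral_basis r (\<lambda>a b. \<Sum>k<l. A $$ (a, k) * cnj (A $$ (b, k))) lam u"
  shows "\<exists>i<r. singular_value 1 A = sqrt (lam i)" "i < r \<Longrightarrow> sqrt (lam i) \<le> singular_value 1 A"
    and "\<exists>i<r. singular_value r A = sqrt (lam i)" "i < r \<Longrightarrow> singular_value r A \<le> sqrt (lam i)"
proof -
  define xs where "xs = sorted_list_of_multiset (image_mset (\<lambda>i. sqrt (lam i)) (mset_set {..<r}))"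
  have len: "length xs = r" unfolding xs_def
    by (metis card_lessThan mset_sorted_list_of_multiset size_image_mset size_mset size_mset_set)
  have set: "set xs = (\<lambda>i. sqrt (lam i)) ` {..<r}" by (simp add: xs_def)
  have sorted: "sorted xs" by (simp add: xs_def)
  have s1: "singular_value 1 A = xs ! (r - 1)" and sr: "singular_value r A = xs ! 0"
    using singular_values_spectral[OF A assms(3) sb, folded xs_def] len assms(2)
    by (auto simp: singular_value_def rev_nth)
  have "xs ! (r - 1) \<in> set xs" "xs ! 0 \<in> set xs" using len assms(2) by auto
  then show "\<exists>i<r. singular_value 1 A = sqrt (lam i)" "\<exists>i<r. singular_value r A = sqrt (lam i)"
    unfolding s1 sr set by auto
  have *: "\<exists>k<r. sqrt (lam i) = xs ! k" if "i < r"
  proof -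
    have "sqrt (lam i) \<in> set xs" using that by (simp add: set)
    then show ?thesis using len by (metis in_set_conv_nth)
  qed
  show "sqrt (lam i) \<le> singular_value 1 A" if "i < r"
    using *[OF that] sorted len unfolding s1 by (auto intro!: sorted_nth_mono)
  show "singular_value r A \<le> sqrt (lam i)" if "i < r"
    using *[OF that] sorted len unfolding sr by (auto intro!: sorted_nth_mono)
qed

text \<open>From here on singular values occur only through these inequalities between quadratic
  forms, which are stable under restriction to a dense set and under changes of variables.\<close>

lemma singular_value_bounds_iff:
  assumes A: "A \<in> carrier_mat r l" and "1 \<le> r" "r \<le> l" and c: "0 \<le> c"
  shows "singular_value 1 A \<le> c \<longleftrightarrow> (\<forall>y. adjoint_energy A y \<le> c\<^sup>2 * nrm2 r y)"
    and "c \<le> singular_value r A \<longleftrightarrow> (\<forall>y. c\<^sup>2 * nrm2 r y \<le> adjoint_energy A y)"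
proof -
  obtain lam u where sb: "spectral_basis r (\<lambda>a b. \<Sum>k<l. A $$ (a, k) * cnj (A $$ (b, k))) lam u"
    using hermitian_spectral[OF hermitian_gram[of r "\<lambda>k a. A $$ (a, k)" "{..<l}"]] by blast
  then have ob: "orthonormal_basis r u" by (simp add: spectral_basis_def)
  have E: "adjoint_energy A y = (\<Sum>i<r. lam i * (cmod (ip r (u i) y))\<^sup>2)" for y
    using spectral_gram_energy[where K = "{..<l}" and x = "\<lambda>k a. A $$ (a, k)", OF sb, of y] A
    by (simp add: adjoint_energy_def ip_def)
  have Eu: "adjoint_energy A (u j) = lam j" "nrm2 r (u j) = 1" if "j < r" for j
    using that sum_basis_coefficients[OF ob that, of lam] sum_basis_coefficients[OF ob that, of "\<lambda>_. 1"]
    by (auto simp: E parseval_nrm2[OF ob])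
  note ext = singular_value_extremes[OF A assms(2,3) sb]
  show "singular_value 1 A \<le> c \<longleftrightarrow> (\<forall>y. adjoint_energy A y \<le> c\<^sup>2 * nrm2 r y)"
  proof
    assume le: "singular_value 1 A \<le> c"
    have "lam i \<le> c\<^sup>2" if "i < r" for i
      using ext(2)[OF that] le by (intro sqrt_le_D) linarith
    then show "\<forall>y. adjoint_energy A y \<le> c\<^sup>2 * nrm2 r y"
      unfolding E parseval_nrm2[OF ob] sum_distrib_left by (auto intro!: sum_mono mult_right_mono)
  next
    assume R: "\<forall>y. adjoint_energy A y \<le> c\<^sup>2 * nrm2 r y"
    obtain i where i: "i < r" "singular_value 1 A = sqrt (lam i)" using ext(1) by blast
    with R[rule_format, of "u i"] c show "singular_value 1 A \<le> c"
      by (simp add: Eu real_le_lsqrt)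
  qed
  show "c \<le> singular_value r A \<longleftrightarrow> (\<forall>y. c\<^sup>2 * nrm2 r y \<le> adjoint_energy A y)"
  proof
    assume le: "c \<le> singular_value r A"
    have "c\<^sup>2 \<le> lam i" if "i < r" for i
    proof -
      have "c \<le> sqrt (lam i)" using ext(4)[OF that] le by linarith
      then have "c\<^sup>2 \<le> (sqrt (lam i))\<^sup>2" using c by (intro power_mono)
      moreover have "0 \<le> lam i"
        using spectral_gram_nonneg(2)[where K = "{..<l}" and x = "\<lambda>k a. A $$ (a, k)", OF sb that] .
      ultimately show ?thesis by simp
    qed
    then show "\<forall>y. c\<^sup>2 * nrm2 r y \<le> adjoint_energy A y"
      unfolding E parseval_nrm2[OF ob] sum_distrib_left by (auto intro!: sum_mono mult_right_mono)
  next
    assume R: "\<forall>y. c\<^sup>2 * nrm2 r y \<le> adjoint_energy A y"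
    obtain i where i: "i < r" "singular_value r A = sqrt (lam i)" using ext(3) by blast
    with R[rule_format, of "u i"] show "c \<le> singular_value r A"
      by (simp add: Eu real_le_rsqrt)
  qed
qed

section \<open>The trace exponential under rank-one updates\<close>

text \<open>Everything proved below holds for each spectral basis of a matrix; fixing one arbitrarily
  makes the trace exponential a function of the matrix.\<close>

definition spectral_choice :: "nat \<Rightarrow> (nat \<Rightarrow> nat \<Rightarrow> complex) \<Rightarrow> (nat \<Rightarrow> real) \<times> (nat \<Rightarrow> nat \<Rightarrow> complex)" where
  "spectral_choice r A = (SOME p. spectral_basis r A (fst p) (snd p))"

text \<open>The trace of \<open>e\<^sup>A\<close>.\<close>

definition trace_exp :: "nat \<Rightarrow> (nat \<Rightarrow> nat \<Rightarrow> complex) \<Rightarrow> real" where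
  "trace_exp r A = (\<Sum>i<r. exp (fst (spectral_choice r A) i))"

text \<open>The quadratic form \<open>x\<^sup>* e\<^sup>A x\<close>.\<close>

definition exp_form :: "nat \<Rightarrow> (nat \<Rightarrow> nat \<Rightarrow> complex) \<Rightarrow> (nat \<Rightarrow> complex) \<Rightarrow> real" where
  "exp_form r A x =
     (\<Sum>i<r. exp (fst (spectral_choice r A) i) * (cmod (ip r (snd (spectral_choice r A) i) x))\<^sup>2)"

definition rank_one_update ::
  "(nat \<Rightarrow> nat \<Rightarrow> complex) \<Rightarrow> real \<Rightarrow> (nat \<Rightarrow> complex) \<Rightarrow> nat \<Rightarrow> nat \<Rightarrow> complex" where
  "rank_one_update A s x = (\<lambda>a b. A a b + of_real s * (x a * cnj (x b)))"

lemma spectral_choice: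
  assumes "hermitian_on r A"
  obtains lam u where "spectral_basis r A lam u"
    "trace_exp r A = (\<Sum>i<r. exp (lam i))"
    "\<And>x. exp_form r A x = (\<Sum>i<r. exp (lam i) * (cmod (ip r (u i) x))\<^sup>2)"
proof -
  obtain lam u where "spectral_basis r A lam u" using hermitian_spectral[OF assms] by blast
  then have "spectral_basis r A (fst (lam, u)) (snd (lam, u))" by simp
  then have "spectral_basis r A (fst (spectral_choice r A)) (snd (spectral_choice r A))"
    unfolding spectral_choice_def by (rule someI)
  then show thesis by (rule that) (simp_all add: trace_exp_def exp_form_def)
qed

lemma trace_exp_nonneg: "0 \<le> trace_exp r A"
  by (simp add: trace_exp_def sum_nonneg)

lemma exp_form_nonneg: "0 \<le> exp_form r A x"
  by (simp add: exp_form_def sum_nonneg)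

lemma hermitian_rank_one_update:
  assumes "hermitian_on r A"
  shows "hermitian_on r (rank_one_update A s x)"
  unfolding hermitian_on_def
proof (intro allI impI)
  fix a b assume "a < r" "b < r"
  then have "A b a = cnj (A a b)" using assms unfolding hermitian_on_def by blast
  then show "rank_one_update A s x b a = cnj (rank_one_update A s x a b)"
    by (simp add: rank_one_update_def mult.commute)
qed

lemma mv_rank_one_update: "mv r (rank_one_update A s x) y a = mv r A y a + of_real s * ip r x y * x a"
  by (simp add: mv_def rank_one_update_def ip_def sum.distrib sum_distrib_left sum_distrib_right algebra_simps)

lemma ip_add_right: "ip r x (\<lambda>a. y a + z a) = ip r x y + ip r x z"
  by (simp add: ip_def sum.distrib algebra_simps)

lemma quadratic_form_rank_one_update:
  "ip r y (mv r (rank_one_update A s x) y) = ip r y (mv r A y) + of_real (s * (cmod (ip r x y))\<^sup>2)"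
proof -
  have "ip r y (mv r (rank_one_update A s x) y) = ip r y (\<lambda>a. mv r A y a + of_real s * ip r x y * x a)"
    by (intro ip_cong refl mv_rank_one_update)
  also have "\<dots> = ip r y (mv r A y) + of_real s * (ip r x y * ip r y x)"
    by (simp add: ip_add_right ip_scale_right)
  finally show ?thesis by (simp add: ip_mult_swap)
qed

lemma spectral_basis_quadratic_form_self:
  assumes "spectral_basis r A lam u" "i < r"
  shows "ip r (u i) (mv r A (u i)) = of_real (lam i)"
proof -
  have "orthonormal_basis r u" using assms by (simp add: spectral_basis_def)
  with spectral_quadratic_form[OF assms(1), of "u i"] assms(2) show ?thesis
    by (simp add: sum_basis_coefficients)
qed

text \<open>The squared overlaps of two orthonormal bases form a doubly stochastic matrix. It serves to
  write differences of traces of functions of \<open>A\<close> and \<open>B\<close> as double sums over pairs of eigenvalues.\<close>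

lemma overlap_sums:
  assumes "orthonormal_basis r u" "orthonormal_basis r v"
  shows "j < r \<Longrightarrow> (\<Sum>i<r. (cmod (ip r (u i) (v j)))\<^sup>2) = 1"
    and "i < r \<Longrightarrow> (\<Sum>j<r. (cmod (ip r (u i) (v j)))\<^sup>2) = 1"
proof -
  have 1: "nrm2 r (w k) = 1" if "orthonormal_basis r w" "k < r" for w k
    using sum_basis_coefficients[OF that, of "\<lambda>_. 1"] by (simp add: parseval_nrm2[OF that(1)])
  show "(\<Sum>i<r. (cmod (ip r (u i) (v j)))\<^sup>2) = 1" if "j < r"
    using parseval_nrm2[OF assms(1), of "v j"] 1[OF assms(2) that] by simp
  show "(\<Sum>j<r. (cmod (ip r (u i) (v j)))\<^sup>2) = 1" if "i < r"
    using parseval_nrm2[OF assms(2), of "u i"] 1[OF assms(1) that]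
    by (simp add: cmod_ip_commute[of r "u i"])
qed

text \<open>These are the traces of \<open>f(B) (B - A)\<close> and of \<open>g(A) (B - A)\<close>, for functions of the eigenvalues,
  expressed by pairs of eigenvalues weighted with the overlaps. Scalar inequalities between
  eigenvalues thereby become trace inequalities for noncommuting matrices.\<close>

lemma spectral_difference_sum:
  assumes A: "spectral_basis r A lam u" and B: "spectral_basis r B mu v"
    and d: "\<And>y. ip r y (mv r B y) = ip r y (mv r A y) + of_real (d y)"
  shows "(\<Sum>i<r. \<Sum>j<r. (mu j - lam i) * f j * (cmod (ip r (u i) (v j)))\<^sup>2) = (\<Sum>j<r. f j * d (v j))"
    and "(\<Sum>i<r. \<Sum>j<r. (mu j - lam i) * g i * (cmod (ip r (u i) (v j)))\<^sup>2) = (\<Sum>i<r. g i * d (u i))"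
proof -
  have ob: "orthonormal_basis r u" "orthonormal_basis r v" using A B by (auto simp: spectral_basis_def)
  have dv: "(\<Sum>i<r. (mu j - lam i) * (cmod (ip r (u i) (v j)))\<^sup>2) = d (v j)" if j: "j < r" for j
  proof -
    have "complex_of_real (mu j) = of_real ((\<Sum>i<r. lam i * (cmod (ip r (u i) (v j)))\<^sup>2) + d (v j))"
      using d[of "v j"] spectral_basis_quadratic_form_self[OF B j] spectral_quadratic_form[OF A, of "v j"]
      by simp
    then have "mu j = (\<Sum>i<r. lam i * (cmod (ip r (u i) (v j)))\<^sup>2) + d (v j)"
      by (simp only: of_real_eq_iff)
    moreover have "(\<Sum>i<r. mu j * (cmod (ip r (u i) (v j)))\<^sup>2) = mu j"
      using overlap_sums(1)[OF ob j] by (simp flip: sum_distrib_left)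
    ultimately show ?thesis by (simp add: left_diff_distrib sum_subtractf)
  qed
  have du: "(\<Sum>j<r. (mu j - lam i) * (cmod (ip r (u i) (v j)))\<^sup>2) = d (u i)" if i: "i < r" for i
  proof -
    have "complex_of_real (\<Sum>j<r. mu j * (cmod (ip r (v j) (u i)))\<^sup>2) = of_real (lam i + d (u i))"
      using d[of "u i"] spectral_basis_quadratic_form_self[OF A i] spectral_quadratic_form[OF B, of "u i"]
      by simp
    then have "(\<Sum>j<r. mu j * (cmod (ip r (v j) (u i)))\<^sup>2) = lam i + d (u i)"
      by (simp only: of_real_eq_iff)
    moreover have "(\<Sum>j<r. lam i * (cmod (ip r (u i) (v j)))\<^sup>2) = lam i"
      using overlap_sums(2)[OF ob i] by (simp flip: sum_distrib_left)
    ultimately show ?thesis by (simp add: left_diff_distrib sum_subtractf cmod_ip_commute[of r "u i"])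
  qed
  show "(\<Sum>i<r. \<Sum>j<r. (mu j - lam i) * f j * (cmod (ip r (u i) (v j)))\<^sup>2) = (\<Sum>j<r. f j * d (v j))"
    by (subst sum.swap) (simp add: mult_ac sum_distrib_left flip: dv)
  show "(\<Sum>i<r. \<Sum>j<r. (mu j - lam i) * g i * (cmod (ip r (u i) (v j)))\<^sup>2) = (\<Sum>i<r. g i * d (u i))"
    by (simp add: mult_ac sum_distrib_left flip: du)
qed

text \<open>The trace of \<open>(B - A) (e\<^sup>B - e\<^sup>A)\<close> is nonnegative because \<open>exp\<close> is increasing.\<close>

lemma exp_form_monotone:
  assumes hA: "hermitian_on r A" and hB: "hermitian_on r B"
    and d: "\<And>y. ip r y (mv r B y) = ip r y (mv r A y)
              + of_real (s * ((cmod (ip r x y))\<^sup>2 - (cmod (ip r z y))\<^sup>2))"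
  shows "0 \<le> s * (exp_form r B x - exp_form r B z - exp_form r A x + exp_form r A z)"
proof -
  obtain lam u where A: "spectral_basis r A lam u"
    "\<And>x. exp_form r A x = (\<Sum>i<r. exp (lam i) * (cmod (ip r (u i) x))\<^sup>2)"
    using spectral_choice[OF hA] by metis
  obtain mu v where B: "spectral_basis r B mu v"
    "\<And>x. exp_form r B x = (\<Sum>i<r. exp (mu i) * (cmod (ip r (v i) x))\<^sup>2)"
    using spectral_choice[OF hB] by metis
  note S = spectral_difference_sum[OF A(1) B(1) d]
  have "0 \<le> (\<Sum>i<r. \<Sum>j<r. (mu j - lam i) * (exp (mu j) - exp (lam i)) * (cmod (ip r (u i) (v j)))\<^sup>2)"
  proof (intro sum_nonneg)
    fix i j
    have "0 \<le> (mu j - lam i) * (exp (mu j) - exp (lam i))"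
      by (cases "mu j \<le> lam i") (auto intro: mult_nonpos_nonpos)
    then show "0 \<le> (mu j - lam i) * (exp (mu j) - exp (lam i)) * (cmod (ip r (u i) (v j)))\<^sup>2"
      by (rule mult_nonneg_nonneg) simp
  qed
  also have "\<dots> = (\<Sum>j<r. exp (mu j) * (s * ((cmod (ip r x (v j)))\<^sup>2 - (cmod (ip r z (v j)))\<^sup>2)))
      - (\<Sum>i<r. exp (lam i) * (s * ((cmod (ip r x (u i)))\<^sup>2 - (cmod (ip r z (u i)))\<^sup>2)))"
    unfolding S(1)[of "\<lambda>j. exp (mu j)", symmetric] S(2)[of "\<lambda>i. exp (lam i)", symmetric]
    unfolding sum_subtractf[symmetric] by (intro sum.cong refl) (simp add: algebra_simps)
  also have "\<dots> = s * (exp_form r B x - exp_form r B z - exp_form r A x + exp_form r A z)"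
    unfolding A(2) B(2) cmod_ip_commute[of r x] cmod_ip_commute[of r z]
    by (simp add: algebra_simps sum_subtractf sum_distrib_left)
  finally show ?thesis .
qed

text \<open>Convexity of the trace exponential: the tangent at the updated matrix lies below its value
  at \<open>A\<close>.\<close>

lemma trace_exp_tangent:
  assumes hA: "hermitian_on r A"
  shows "trace_exp r (rank_one_update A s x) - trace_exp r A \<le> s * exp_form r (rank_one_update A s x) x"
proof -
  define B where "B = rank_one_update A s x"
  have hB: "hermitian_on r B" unfolding B_def by (rule hermitian_rank_one_update[OF hA])
  obtain lam u where A: "spectral_basis r A lam u" "trace_exp r A = (\<Sum>i<r. exp (lam i))"
    using spectral_choice[OF hA] by metis
  obtain mu v where B: "spectral_basis r B mu v" "trace_exp r B = (\<Sum>i<r. exp (mu i))"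
    "\<And>x. exp_form r B x = (\<Sum>i<r. exp (mu i) * (cmod (ip r (v i) x))\<^sup>2)"
    using spectral_choice[OF hB] by metis
  have ob: "orthonormal_basis r u" "orthonormal_basis r v" using A B by (auto simp: spectral_basis_def)
  let ?w = "\<lambda>i j. (cmod (ip r (u i) (v j)))\<^sup>2"
  have "trace_exp r B - trace_exp r A = (\<Sum>j<r. exp (mu j) * (\<Sum>i<r. ?w i j)) - (\<Sum>i<r. exp (lam i) * (\<Sum>j<r. ?w i j))"
    using overlap_sums[OF ob] by (simp add: A B)
  also have "\<dots> = (\<Sum>i<r. \<Sum>j<r. (exp (mu j) - exp (lam i)) * ?w i j)"
    unfolding sum_distrib_left by (subst sum.swap) (simp add: left_diff_distrib sum_subtractf)
  also have "\<dots> \<le> (\<Sum>i<r. \<Sum>j<r. (mu j - lam i) * exp (mu j) * ?w i j)"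
  proof (intro sum_mono mult_right_mono)
    fix i j
    have "1 + (lam i - mu j) \<le> exp (lam i - mu j)" by simp
    then have "exp (mu j) * (1 + (lam i - mu j)) \<le> exp (mu j) * exp (lam i - mu j)"
      by (intro mult_left_mono) auto
    also have "\<dots> = exp (lam i)" by (simp flip: exp_add)
    finally show "exp (mu j) - exp (lam i) \<le> (mu j - lam i) * exp (mu j)" by (simp add: algebra_simps)
  qed auto
  also have "\<dots> = (\<Sum>j<r. exp (mu j) * (s * (cmod (ip r x (v j)))\<^sup>2))"
    by (rule spectral_difference_sum(1)[OF A(1) B(1)]) (simp only: B_def quadratic_form_rank_one_update)
  also have "\<dots> = s * exp_form r B x"
    unfolding B(3) cmod_ip_commute[of r x] by (simp add: sum_distrib_left mult_ac)
  finally show ?thesis unfolding B_def .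
qed

text \<open>The divided difference of \<open>exp\<close> is the mean of \<open>exp\<close> over the interval, which for a convex
  function is at most the mean of the boundary values.\<close>

lemma exp_trapezoid:
  fixes a b :: real
  assumes "a \<noteq> b"
  shows "(exp b - exp a) / (b - a) \<le> (exp a + exp b) / 2"
proof -
  have *: "exp t - 1 \<le> t * (exp t + 1) / 2" if "t \<ge> 0" for t :: real
  proof -
    define f where "f = (\<lambda>t :: real. t * (exp t + 1) / 2 - (exp t - 1))"
    have "f 0 \<le> f t"
    proof (rule DERIV_nonneg_imp_nondecreasing[OF that])
      fix x :: real assume "0 \<le> x" "x \<le> t"
      have "exp x * (1 - x) \<le> exp x * exp (- x)"
        using exp_ge_add_one_self[of "- x"] by (intro mult_left_mono) auto
      then have "0 \<le> (1 + x * exp x - exp x) / 2" by (simp add: algebra_simps flip: exp_add)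
      moreover have "(f has_real_derivative (1 + x * exp x - exp x) / 2) (at x)"
        unfolding f_def by (auto intro!: derivative_eq_intros simp: field_simps)
      ultimately show "\<exists>y. (f has_real_derivative y) (at x) \<and> 0 \<le> y" by blast
    qed
    then show ?thesis by (simp add: f_def)
  qed
  have **: "(exp b - exp a) / (b - a) \<le> (exp a + exp b) / 2" if "a < b" for a b :: real
  proof -
    have "exp a * (exp (b - a) - 1) \<le> exp a * ((b - a) * (exp (b - a) + 1) / 2)"
      using *[of "b - a"] that by (intro mult_left_mono) auto
    moreover have "exp a * exp (b - a) = exp b" by (simp flip: exp_add)
    ultimately have "exp b - exp a \<le> (b - a) * (exp a + exp b) / 2" by (simp add: algebra_simps)
    with that show ?thesis by (simp add: divide_le_eq mult.commute)
  qed
  show ?thesis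
  proof (cases "a < b")
    case False
    with assms have "b < a" by simp
    from **[OF this] show ?thesis by (simp add: minus_divide_left[symmetric] add.commute)
       (metis add.commute minus_diff_eq minus_divide_divide)
  qed (rule **)
qed

text \<open>Evaluate the rank-one term between an eigenvector of \<open>A\<close> and one of the update.\<close>

lemma eigenvector_overlap_rank_one:
  assumes hA: "hermitian_on r A"
    and A: "spectral_basis r A lam u" and B: "spectral_basis r (rank_one_update A s x) mu v"
    and "i < r" "j < r"
  shows "of_real (mu j - lam i) * ip r (u i) (v j) = of_real s * (ip r (u i) x * ip r x (v j))"
proof -
  have "of_real (mu j) * ip r (u i) (v j) = ip r (u i) (\<lambda>a. of_real (mu j) * v j a)"
    by (simp add: ip_scale_right)
  also have "\<dots> = ip r (u i) (\<lambda>a. mv r A (v j) a + of_real s * ip r x (v j) * x a)"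
    using B assms(5) by (intro ip_cong refl) (simp add: spectral_basis_def mv_rank_one_update)
  also have "\<dots> = ip r (mv r A (u i)) (v j) + of_real s * (ip r (u i) x * ip r x (v j))"
    by (simp add: ip_add_right ip_scale_right ip_mv_hermitian[OF hA])
  also have "ip r (mv r A (u i)) (v j) = ip r (\<lambda>a. of_real (lam i) * u i a) (v j)"
    using A assms(4) by (intro ip_cong refl) (simp add: spectral_basis_def)
  also have "\<dots> = of_real (lam i) * ip r (u i) (v j)"
    by (simp add: ip_def sum_distrib_left mult_ac)
  finally show ?thesis by (simp add: algebra_simps)
qed

text \<open>By the overlap identity the change of \<open>x\<^sup>* e\<^sup>A x\<close> is a sum of divided differences of \<open>exp\<close>
  with nonnegative weights, and the trapezoid inequality bounds these by boundary values. The
  factor \<open>s\<close> on both sides lets one statement cover positive and negative updates.\<close>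

lemma exp_form_rank_one_step:
  assumes hA: "hermitian_on r A"
  shows "s * (exp_form r (rank_one_update A s x) x - exp_form r A x)
    \<le> s * (s * nrm2 r x / 2 * (exp_form r (rank_one_update A s x) x + exp_form r A x))"
proof -
  define B where "B = rank_one_update A s x"
  have hB: "hermitian_on r B" unfolding B_def by (rule hermitian_rank_one_update[OF hA])
  obtain lam u where A: "spectral_basis r A lam u"
    "\<And>x. exp_form r A x = (\<Sum>i<r. exp (lam i) * (cmod (ip r (u i) x))\<^sup>2)"
    using spectral_choice[OF hA] by metis
  obtain mu v where B: "spectral_basis r B mu v"
    "\<And>x. exp_form r B x = (\<Sum>i<r. exp (mu i) * (cmod (ip r (v i) x))\<^sup>2)"
    using spectral_choice[OF hB] by metis
  have ob: "orthonormal_basis r u" "orthonormal_basis r v" using A B by (auto simp: spectral_basis_def)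
  define p where "p = (\<lambda>i. (cmod (ip r (u i) x))\<^sup>2)"
  define q where "q = (\<lambda>j. (cmod (ip r (v j) x))\<^sup>2)"
  (* coinciding eigenvalues contribute nothing to the sum, so the default value 0 is harmless *)
  define g where "g = (\<lambda>i j. if mu j = lam i then 0 else (exp (mu j) - exp (lam i)) / (mu j - lam i))"
  have sp: "(\<Sum>i<r. p i) = nrm2 r x" and sq: "(\<Sum>j<r. q j) = nrm2 r x"
    using parseval_nrm2[OF ob(1)] parseval_nrm2[OF ob(2)] by (simp_all add: p_def q_def)
  have g: "g i j \<le> (exp (lam i) + exp (mu j)) / 2" for i j
    using exp_trapezoid[of "lam i" "mu j"] by (auto simp: g_def)
  have q': "complex_of_real (q j) = (\<Sum>i<r. ip r x (u i) * ip r (u i) (v j) * ip r (v j) x)" if "j < r" for j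
    unfolding sum_distrib_right[symmetric] parseval[OF ob(1), symmetric] ip_mult_swap
    by (simp add: q_def cmod_ip_commute)
  have p': "complex_of_real (p i) = (\<Sum>j<r. ip r x (u i) * ip r (u i) (v j) * ip r (v j) x)" if "i < r" for i
    unfolding mult.assoc sum_distrib_left[symmetric] parseval[OF ob(2), symmetric] ip_mult_swap
    by (simp add: p_def cmod_ip_commute)
  have trm: "of_real (exp (mu j) - exp (lam i)) * (ip r x (u i) * ip r (u i) (v j) * ip r (v j) x)
      = of_real (s * (g i j * p i * q j))" if "i < r" "j < r" for i j
  proof (cases "mu j = lam i")
    case False
    have "of_real (mu j - lam i) * (ip r x (u i) * ip r (u i) (v j) * ip r (v j) x)
        = ip r x (u i) * ip r (v j) x * (of_real (mu j - lam i) * ip r (u i) (v j))"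
      by (simp add: mult_ac)
    also have "\<dots> = of_real s * ((ip r x (u i) * ip r (u i) x) * (ip r x (v j) * ip r (v j) x))"
      unfolding eigenvector_overlap_rank_one[OF hA A(1) B(1)[unfolded B_def] that] by (simp add: mult_ac)
    also have "\<dots> = of_real (s * (p i * q j))"
      unfolding ip_mult_swap by (simp add: p_def q_def cmod_ip_commute)
    finally have *: "of_real (mu j - lam i) * (ip r x (u i) * ip r (u i) (v j) * ip r (v j) x)
        = of_real (s * (p i * q j))" .
    have "exp (mu j) - exp (lam i) = g i j * (mu j - lam i)" using False by (simp add: g_def)
    then have "of_real (exp (mu j) - exp (lam i)) * (ip r x (u i) * ip r (u i) (v j) * ip r (v j) x)
        = of_real (g i j) * (of_real (mu j - lam i) * (ip r x (u i) * ip r (u i) (v j) * ip r (v j) x))"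
      by (simp only: of_real_mult mult.assoc)
    also have "\<dots> = of_real (g i j) * of_real (s * (p i * q j))" by (simp only: *)
    also have "\<dots> = of_real (s * (g i j * p i * q j))" by (simp add: mult_ac)
    finally show ?thesis .
  qed (simp add: g_def)
  have "complex_of_real (exp_form r B x - exp_form r A x)
      = (\<Sum>j<r. of_real (exp (mu j)) * of_real (q j)) - (\<Sum>i<r. of_real (exp (lam i)) * of_real (p i))"
    by (simp add: A(2) B(2) p_def q_def)
  also have "(\<Sum>j<r. complex_of_real (exp (mu j)) * of_real (q j))
      = (\<Sum>i<r. \<Sum>j<r. of_real (exp (mu j)) * (ip r x (u i) * ip r (u i) (v j) * ip r (v j) x))"
    by (subst sum.swap, intro sum.cong refl) (simp only: q' lessThan_iff sum_distrib_left)
  also have "(\<Sum>i<r. complex_of_real (exp (lam i)) * of_real (p i))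
      = (\<Sum>i<r. \<Sum>j<r. of_real (exp (lam i)) * (ip r x (u i) * ip r (u i) (v j) * ip r (v j) x))"
    by (intro sum.cong refl) (simp only: p' lessThan_iff sum_distrib_left)
  also have "(\<Sum>i<r. \<Sum>j<r. of_real (exp (mu j)) * (ip r x (u i) * ip r (u i) (v j) * ip r (v j) x))
      - (\<Sum>i<r. \<Sum>j<r. of_real (exp (lam i)) * (ip r x (u i) * ip r (u i) (v j) * ip r (v j) x))
      = (\<Sum>i<r. \<Sum>j<r. of_real (exp (mu j) - exp (lam i)) * (ip r x (u i) * ip r (u i) (v j) * ip r (v j) x))"
    unfolding sum_subtractf[symmetric] of_real_diff left_diff_distrib ..
  also have "\<dots> = (\<Sum>i<r. \<Sum>j<r. of_real (s * (g i j * p i * q j)))"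
    by (intro sum.cong refl) (simp only: trm lessThan_iff)
  also have "\<dots> = of_real (s * (\<Sum>i<r. \<Sum>j<r. g i j * p i * q j))"
    by (simp add: sum_distrib_left)
  finally have "exp_form r B x - exp_form r A x = s * (\<Sum>i<r. \<Sum>j<r. g i j * p i * q j)"
    by (simp only: of_real_eq_iff)
  then have "s * (exp_form r B x - exp_form r A x) = s * s * (\<Sum>i<r. \<Sum>j<r. g i j * p i * q j)"
    by simp
  also have "\<dots> \<le> s * s * (\<Sum>i<r. \<Sum>j<r. (exp (lam i) + exp (mu j)) / 2 * p i * q j)"
    by (intro mult_left_mono sum_mono mult_right_mono g) (auto simp: p_def q_def)
  also have "(\<Sum>i<r. \<Sum>j<r. (exp (lam i) + exp (mu j)) / 2 * p i * q j)
      = (\<Sum>i<r. \<Sum>j<r. (exp (lam i) * p i) * q j / 2) + (\<Sum>i<r. \<Sum>j<r. p i * (exp (mu j) * q j) / 2)"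
    unfolding sum.distrib[symmetric] by (intro sum.cong refl) (simp add: field_simps)
  also have "\<dots> = nrm2 r x / 2 * (exp_form r B x + exp_form r A x)"
    unfolding sum_divide_distrib[symmetric] sum_product[symmetric] sp sq
    by (simp add: A(2) B(2) p_def q_def algebra_simps)
  finally show ?thesis unfolding B_def by (simp add: mult_ac)
qed

lemma rank_one_update_0: "rank_one_update A 0 x = A"
  by (simp add: rank_one_update_def)

lemma rank_one_update_add:
  "rank_one_update (rank_one_update A s x) t x = rank_one_update A (s + t) x"
  by (simp add: rank_one_update_def algebra_simps)

text \<open>An update of size \<open>N d\<close> is split into \<open>N\<close> steps. Each step multiplies \<open>x\<^sup>* e\<^sup>A x\<close> by at most
  \<open>q = (1 + a / 2) / (1 - a / 2)\<close> (at least, if \<open>d\<close> is negative), and the tangent inequality adds up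
  a geometric series.\<close>

lemma trace_exp_rank_one_discrete:
  assumes hA: "hermitian_on r A" and n: "0 < nrm2 r x" and small: "\<bar>d * nrm2 r x\<bar> < 2"
  defines "a \<equiv> d * nrm2 r x"
  shows "trace_exp r (rank_one_update A (real N * d) x) - trace_exp r A
    \<le> (1 + a / 2) * (((1 + a / 2) / (1 - a / 2)) ^ N - 1) / nrm2 r x * exp_form r A x"
proof -
  define q where "q = (1 + a / 2) / (1 - a / 2)"
  define M where "M = (\<lambda>k. rank_one_update A (real k * d) x)"
  have a: "0 < 1 - a / 2" "0 < 1 + a / 2" using small by (auto simp: a_def abs_less_iff)
  then have q: "q > 0" by (simp add: q_def)
  have hM: "hermitian_on r (M k)" for k unfolding M_def by (rule hermitian_rank_one_update[OF hA])
  have M0: "M 0 = A" by (simp add: M_def rank_one_update_0)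
  have MS: "M (Suc k) = rank_one_update (M k) d x" for k
    by (simp add: M_def rank_one_update_add algebra_simps)
  have step: "d * exp_form r (M (Suc k)) x \<le> q * (d * exp_form r (M k) x)" for k
  proof -
    have "d * (exp_form r (M (Suc k)) x - exp_form r (M k) x)
        \<le> d * (a / 2 * (exp_form r (M (Suc k)) x + exp_form r (M k) x))"
      using exp_form_rank_one_step[OF hM[of k], of d x] by (simp add: MS a_def)
    then have "d * exp_form r (M (Suc k)) x * (1 - a / 2) \<le> (d * exp_form r (M k) x) * (1 + a / 2)"
      by (simp add: algebra_simps)
    then have "d * exp_form r (M (Suc k)) x \<le> (d * exp_form r (M k) x) * (1 + a / 2) / (1 - a / 2)"
      using a by (simp add: pos_le_divide_eq)
    then show ?thesis by (simp add: q_def mult_ac)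
  qed
  have pow: "d * exp_form r (M k) x \<le> q ^ k * (d * exp_form r A x)" for k
  proof (induction k)
    case (Suc k)
    have "d * exp_form r (M (Suc k)) x \<le> q * (d * exp_form r (M k) x)" by (rule step)
    also have "\<dots> \<le> q * (q ^ k * (d * exp_form r A x))" using Suc q by (intro mult_left_mono) auto
    finally show ?case by (simp add: mult.assoc)
  qed (simp add: M0)
  have "trace_exp r (M N) - trace_exp r A
      \<le> (1 + a / 2) * (q ^ N - 1) / nrm2 r x * exp_form r A x"
  proof (induction N)
    case (Suc k)
    have "trace_exp r (M (Suc k)) - trace_exp r (M k) \<le> d * exp_form r (M (Suc k)) x"
      unfolding MS by (rule trace_exp_tangent[OF hM])
    also have "\<dots> \<le> q ^ Suc k * (d * exp_form r A x)" by (rule pow)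
    also have "\<dots> = (1 + a / 2) * (q ^ Suc k - q ^ k) / nrm2 r x * exp_form r A x"
    proof -
      have "q * (1 - a / 2) = 1 + a / 2" using a by (simp add: q_def)
      then have "q = 1 + a / 2 + a * q / 2" by (simp add: algebra_simps)
      moreover have "(1 + a / 2) * (q - 1) = q + a * q / 2 - 1 - a / 2"
        by (simp add: algebra_simps diff_divide_distrib)
      ultimately have "(1 + a / 2) * (q - 1) = a * q" by linarith
      then have "(1 + a / 2) * (q - 1) * q ^ k = q ^ Suc k * a" by simp
      moreover have "e * (q ^ Suc k - q ^ k) = e * (q - 1) * q ^ k" for e
        by (simp add: algebra_simps)
      ultimately have "(1 + a / 2) * (q ^ Suc k - q ^ k) = q ^ Suc k * a"
        by (simp only:)
      then show ?thesis using n by (simp add: a_def)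
    qed
    finally show ?case using Suc
      by (simp add: diff_divide_distrib add_divide_distrib algebra_simps)
  qed (simp add: M0)
  then show ?thesis by (simp add: M_def q_def)
qed

text \<open>The step factor is the Pade approximant of \<open>exp (c / N)\<close>.\<close>

lemma pade_power_tendsto_exp:
  fixes c :: real
  shows "(\<lambda>N. (1 + c / real N / 2) * (((1 + c / real N / 2) / (1 - c / real N / 2)) ^ N - 1))
    \<longlonglongrightarrow> exp c - 1"
proof -
  have "(\<lambda>N. (1 + (c / 2) / real N) ^ N / (1 + (- (c / 2)) / real N) ^ N) \<longlonglongrightarrow> exp (c / 2) / exp (- (c / 2))"
    by (intro tendsto_divide tendsto_exp_limit_sequentially) auto
  also have "exp (c / 2) / exp (- (c / 2)) = exp c" by (simp flip: exp_diff)
  finally have 1: "(\<lambda>N. ((1 + c / real N / 2) / (1 - c / real N / 2)) ^ N) \<longlonglongrightarrow> exp c"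
    by (simp add: power_divide mult.commute)
  have 2: "(\<lambda>N. 1 + c / real N / 2) \<longlonglongrightarrow> 1 + 0 / 2"
    by (intro tendsto_intros lim_const_over_n) auto
  have "(\<lambda>N. (1 + c / real N / 2) * (((1 + c / real N / 2) / (1 - c / real N / 2)) ^ N - 1))
    \<longlonglongrightarrow> (1 + 0 / 2) * (exp c - 1)"
    by (intro tendsto_mult tendsto_diff 1 2 tendsto_const)
  then show ?thesis by simp
qed

text \<open>Slopes of chords of a convex function through a fixed point increase.\<close>

lemma exp_chord:
  fixes s b n :: real
  assumes "0 < n" "n \<le> b"
  shows "(exp (s * n) - 1) / n \<le> (exp (s * b) - 1) / b"
proof -
  have "exp ((1 - n / b) *\<^sub>R 0 + (n / b) *\<^sub>R (s * b)) \<le> (1 - n / b) * exp 0 + (n / b) * exp (s * b)"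
    using assms by (intro convex_onD[OF exp_convex]) auto
  then have "exp (s * n) - 1 \<le> n / b * (exp (s * b) - 1)"
    using assms by (simp add: algebra_simps)
  then show ?thesis using assms by (simp add: divide_le_eq mult.commute)
qed

text \<open>The Golden--Thompson inequality \<open>tr (exp (A + X)) \<le> tr (exp A exp X)\<close> for \<open>X = s x x\<^sup>*\<close>, where it follows by
  letting the number of steps tend to infinity. The bound \<open>b\<close> on the squared length makes the
  constant uniform over all vectors of a frame.\<close>

theorem trace_exp_rank_one_update:
  assumes hA: "hermitian_on r A" and b: "0 < b" "nrm2 r x \<le> b"
  shows "trace_exp r (rank_one_update A s x) \<le> trace_exp r A + (exp (s * b) - 1) / b * exp_form r A x"
proof (cases "nrm2 r x = 0")
  case True
  then have z: "\<forall>a<r. x a = 0" by (simp add: nrm2_eq_0)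
  then have "ip r y x = 0" for y by (simp add: ip_def)
  then have "exp_form r B x = 0" for B by (simp add: exp_form_def)
  with trace_exp_tangent[OF hA, of s x] show ?thesis by simp
next
  case False
  with nrm2_nonneg[of r x] have n: "0 < nrm2 r x" by simp
  define c where "c = s * nrm2 r x"
  have "trace_exp r (rank_one_update A s x) - trace_exp r A \<le> (exp c - 1) / nrm2 r x * exp_form r A x"
  proof (rule tendsto_lowerbound)
    show "(\<lambda>N. (1 + c / real N / 2) * (((1 + c / real N / 2) / (1 - c / real N / 2)) ^ N - 1)
        / nrm2 r x * exp_form r A x) \<longlonglongrightarrow> (exp c - 1) / nrm2 r x * exp_form r A x"
      using n by (intro tendsto_mult tendsto_divide pade_power_tendsto_exp tendsto_const) auto
    have "\<forall>\<^sub>F N in sequentially. \<bar>c\<bar> / 2 < real N"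
      by (rule eventually_compose_filterlim[OF _ filterlim_real_sequentially]) (rule eventually_gt_at_top)
    then show "\<forall>\<^sub>F N in sequentially. trace_exp r (rank_one_update A s x) - trace_exp r A
        \<le> (1 + c / real N / 2) * (((1 + c / real N / 2) / (1 - c / real N / 2)) ^ N - 1)
          / nrm2 r x * exp_form r A x"
    proof eventually_elim
      case (elim N)
      then have N: "real N > 0" by (rule le_less_trans[rotated]) simp
      have c': "s / real N * nrm2 r x = c / real N" by (simp add: c_def)
      have "\<bar>s / real N * nrm2 r x\<bar> < 2"
        unfolding c' using elim N by (simp add: abs_divide divide_less_eq)
      from trace_exp_rank_one_discrete[OF hA n this, of N] show ?case
        using N unfolding c' by simp
    qed
  qed simp
  also have "\<dots> \<le> (exp (s * b) - 1) / b * exp_form r A x"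
    unfolding c_def using n b by (intro mult_right_mono exp_chord exp_form_nonneg) auto
  finally show ?thesis by simp
qed

section \<open>Sampling a tight frame without replacement\<close>

text \<open>The factor \<open>s\<close> sits inside the matrix, so that the upper tail (positive \<open>s\<close>) and the lower
  tail (negative \<open>s\<close>) are one computation.\<close>

definition weighted_gram :: "real \<Rightarrow> (nat \<Rightarrow> nat \<Rightarrow> complex) \<Rightarrow> nat set \<Rightarrow> nat \<Rightarrow> nat \<Rightarrow> complex" where
  "weighted_gram s x K = (\<lambda>a b. \<Sum>k\<in>K. of_real s * (x k a * cnj (x k b)))"

text \<open>Equivalently, the matrix with columns \<open>x k\<close> has orthonormal rows.\<close>

definition tight_frame :: "nat \<Rightarrow> nat \<Rightarrow> (nat \<Rightarrow> nat \<Rightarrow> complex) \<Rightarrow> bool" where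
  "tight_frame r n x \<longleftrightarrow> (\<forall>y. (\<Sum>k<n. (cmod (ip r (x k) y))\<^sup>2) = nrm2 r y)"

lemma hermitian_weighted_gram: "hermitian_on r (weighted_gram s x K)"
  by (simp add: hermitian_on_def weighted_gram_def mult_ac)

lemma weighted_gram_insert:
  "finite K \<Longrightarrow> k \<notin> K \<Longrightarrow> weighted_gram s x (insert k K) = rank_one_update (weighted_gram s x K) s (x k)"
  by (simp add: weighted_gram_def rank_one_update_def add.commute)

lemma weighted_gram_quadratic_form:
  "finite K \<Longrightarrow> ip r y (mv r (weighted_gram s x K) y) = of_real (s * (\<Sum>k\<in>K. (cmod (ip r (x k) y))\<^sup>2))"
proof (induction K rule: finite_induct)
  case empty
  show ?case by (simp add: weighted_gram_def mv_def ip_def)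
next
  case (insert k K)
  then show ?case
    by (simp add: weighted_gram_insert quadratic_form_rank_one_update algebra_simps)
qed

lemma sum_exp_form_tight_frame:
  assumes "tight_frame r n x" "hermitian_on r A"
  shows "(\<Sum>k<n. exp_form r A (x k)) = trace_exp r A"
proof -
  obtain lam u where A: "spectral_basis r A lam u" "trace_exp r A = (\<Sum>i<r. exp (lam i))"
    "\<And>x. exp_form r A x = (\<Sum>i<r. exp (lam i) * (cmod (ip r (u i) x))\<^sup>2)"
    using spectral_choice[OF assms(2)] by metis
  have ob: "orthonormal_basis r u" using A by (simp add: spectral_basis_def)
  have *: "(\<Sum>k<n. (cmod (ip r (u i) (x k)))\<^sup>2) = 1" if "i < r" for i
  proof -
    have "(\<Sum>k<n. (cmod (ip r (u i) (x k)))\<^sup>2) = nrm2 r (u i)"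
      using assms(1) by (simp add: tight_frame_def cmod_ip_commute[of r "u i"])
    also have "\<dots> = 1"
      using overlap_sums(1)[OF ob ob that] by (simp add: parseval_nrm2[OF ob])
    finally show ?thesis .
  qed
  have "(\<Sum>k<n. exp_form r A (x k)) = (\<Sum>i<r. exp (lam i) * (\<Sum>k<n. (cmod (ip r (u i) (x k)))\<^sup>2))"
    unfolding A(3) sum_distrib_left by (rule sum.swap)
  also have "\<dots> = trace_exp r A" by (simp add: * A(2))
  finally show ?thesis .
qed

abbreviation subsets_of_size :: "nat \<Rightarrow> nat \<Rightarrow> nat set set" where
  "subsets_of_size n l \<equiv> {K. K \<subseteq> {..<n} \<and> card K = l}"

lemma finite_subsets_of_size: "finite (subsets_of_size n l)"
  by (rule finite_subset[of _ "Pow {..<n}"]) auto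

text \<open>A set of size \<open>l + 1\<close> with a marked element is a set of size \<open>l\<close> with an added one.\<close>

lemma sum_subsets_insert:
  fixes f :: "nat set \<Rightarrow> real"
  shows "real (Suc l) * (\<Sum>K\<in>subsets_of_size n (Suc l). f K)
    = (\<Sum>K\<in>subsets_of_size n l. \<Sum>k\<in>{..<n} - K. f (insert k K))"
proof -
  have fin: "finite K" if "K \<subseteq> {..<n}" for K using that finite_subset by blast
  have "real (Suc l) * (\<Sum>K\<in>subsets_of_size n (Suc l). f K) = (\<Sum>K\<in>subsets_of_size n (Suc l). \<Sum>k\<in>K. f K)"
    unfolding sum_distrib_left by (intro sum.cong refl) simp
  also have "\<dots> = (\<Sum>(K, k)\<in>Sigma (subsets_of_size n (Suc l)) (\<lambda>K. K). f K)"
    by (rule sum.Sigma) (auto simp: finite_subsets_of_size fin)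
  also have "\<dots> = (\<Sum>(K, k)\<in>Sigma (subsets_of_size n l) (\<lambda>K. {..<n} - K). f (insert k K))"
    by (rule sum.reindex_bij_witness[where i = "\<lambda>(K, k). (insert k K, k)" and j = "\<lambda>(K, k). (K - {k}, k)"])
       (auto simp: fin insert_absorb card_insert_if card_Diff_singleton_if dest: fin)
  also have "\<dots> = (\<Sum>K\<in>subsets_of_size n l. \<Sum>k\<in>{..<n} - K. f (insert k K))"
    by (rule sum.Sigma[symmetric]) (auto simp: finite_subsets_of_size)
  finally show ?thesis .
qed

text \<open>A member of the sample is, on average, at least as strongly represented in the trace
  exponential of the sample as an outsider. Pair each sample \<open>K\<close>, member \<open>i\<close> and outsider \<open>j\<close> with the
  sample in which \<open>i\<close> and \<open>j\<close> are exchanged: the two Gram matrices differ by the two rank-one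
  terms, so monotonicity of the matrix exponential signs the sum of both contributions. This is
  what makes sampling without replacement no worse than sampling with replacement.\<close>

lemma exchange_inequality:
  fixes x :: "nat \<Rightarrow> nat \<Rightarrow> complex" and r :: nat and s :: real
  defines "h \<equiv> \<lambda>K k. exp_form r (weighted_gram s x K) (x k)"
  shows "s * real l * (\<Sum>K\<in>subsets_of_size n l. \<Sum>k\<in>{..<n} - K. h K k)
    \<le> s * real (n - l) * (\<Sum>K\<in>subsets_of_size n l. \<Sum>k\<in>K. h K k)"
proof -
  let ?S = "subsets_of_size n l"
  have fin: "finite K" if "K \<subseteq> {..<n}" for K using that finite_subset by blast
  define T where "T = Sigma ?S (\<lambda>K. K \<times> ({..<n} - K))"
  define G where "G = (\<lambda>K i j. s * (h K i - h K j))"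
  (* phi is an involution of the index set T *)
  define phi where "phi = (\<lambda>(K, i, j). (insert j (K - {i}), j, i) :: nat set \<times> nat \<times> nat)"
  have card: "card (insert j (K - {i})) = l" if "K \<in> ?S" "i \<in> K" "j \<notin> K" for K i j
  proof -
    have "finite K" "card K > 0" using that fin[of K] card_gt_0_iff[of K] by auto
    then show ?thesis using that by (simp add: card_Diff_singleton)
  qed
  have "(\<Sum>(K, i, j)\<in>T. G K i j) = (\<Sum>(K, i, j)\<in>T. G (insert j (K - {i})) j i)"
    by (rule sum.reindex_bij_witness[where i = phi and j = phi])
       (auto simp: T_def phi_def card insert_absorb intro: card)
  then have "2 * (\<Sum>(K, i, j)\<in>T. G K i j) = (\<Sum>(K, i, j)\<in>T. G K i j + G (insert j (K - {i})) j i)"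
    by (simp add: case_prod_beta sum.distrib)
  also have "\<dots> \<ge> 0"
  proof (intro sum_nonneg, clarify)
    fix K i j assume "(K, i, j) \<in> T"
    then have K: "K \<in> ?S" and i: "i \<in> K" and j: "j \<notin> K" by (auto simp: T_def)
    let ?K' = "insert j (K - {i})"
    have fK: "finite K" using K fin by auto
    define c where "c = (\<lambda>y k. (cmod (ip r (x k) y))\<^sup>2)"
    have "sum (c y) K = sum (c y) ?K' + (c y i - c y j)" for y
      using fK i j by (simp add: sum.remove[OF fK i])
    then have "ip r y (mv r (weighted_gram s x K) y)
        = ip r y (mv r (weighted_gram s x ?K') y)
          + of_real (s * ((cmod (ip r (x i) y))\<^sup>2 - (cmod (ip r (x j) y))\<^sup>2))" for y
      using fK by (simp only: weighted_gram_quadratic_form finite_insert finite_Diff c_def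
          distrib_left of_real_add)
    from exp_form_monotone[OF hermitian_weighted_gram hermitian_weighted_gram this]
    show "0 \<le> G K i j + G ?K' j i" by (simp add: G_def h_def algebra_simps)
  qed
  finally have "0 \<le> (\<Sum>(K, i, j)\<in>T. G K i j)" by simp
  also have "(\<Sum>(K, i, j)\<in>T. G K i j) = (\<Sum>K\<in>?S. \<Sum>(i, j)\<in>K \<times> ({..<n} - K). G K i j)"
    unfolding T_def by (subst sum.Sigma) (auto simp: finite_subsets_of_size fin case_prod_beta)
  also have "\<dots> = (\<Sum>K\<in>?S. \<Sum>i\<in>K. \<Sum>j\<in>{..<n} - K. G K i j)"
    by (simp add: sum.cartesian_product)
  also have "\<dots> = (\<Sum>K\<in>?S. s * (real (n - l) * (\<Sum>k\<in>K. h K k) - real l * (\<Sum>k\<in>{..<n} - K. h K k)))"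
  proof (intro sum.cong refl)
    fix K assume K: "K \<in> ?S"
    then have "card ({..<n} - K) = n - l" using fin by (auto simp: card_Diff_subset)
    with K show "(\<Sum>i\<in>K. \<Sum>j\<in>{..<n} - K. G K i j)
        = s * (real (n - l) * (\<Sum>k\<in>K. h K k) - real l * (\<Sum>k\<in>{..<n} - K. h K k))"
      by (simp add: G_def sum_subtractf flip: sum_distrib_left)
  qed
  finally show ?thesis
    by (simp add: sum_subtractf sum_distrib_left right_diff_distrib mult_ac)
qed

text \<open>Enlarging the sample by one vector changes the average of the trace exponential by at most
  the factor \<open>exp (c / n)\<close>: the rank-one bound leaves the sum of \<open>x\<^sup>* e\<^sup>A x\<close> over the vectors
  outside the sample, which by the exchange inequality is at most its proportional share of the
  sum over the whole frame, and that sum is the trace exponential itself.\<close>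

theorem expected_trace_exp_sampling:
  assumes frame: "tight_frame r n x" and b: "0 < b" "\<And>k. k < n \<Longrightarrow> nrm2 r (x k) \<le> b" and "l \<le> n"
  shows "(\<Sum>K\<in>subsets_of_size n l. trace_exp r (weighted_gram s x K))
    \<le> real (n choose l) * real r * exp ((exp (s * b) - 1) / b * real l / real n)"
  using \<open>l \<le> n\<close>
proof (induction l)
  case 0
  have "subsets_of_size n 0 = {{}}"
    by (auto dest: finite_subset[OF _ finite_lessThan])
  moreover have "trace_exp r (weighted_gram s x {}) = real r"
  proof -
    obtain lam u where A: "spectral_basis r (weighted_gram s x {}) lam u"
      "trace_exp r (weighted_gram s x {}) = (\<Sum>i<r. exp (lam i))"
      using spectral_choice[OF hermitian_weighted_gram] by metis
    have "lam i = 0" if "i < r" for i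
      using spectral_basis_quadratic_form_self[OF A(1) that]
      by (simp add: weighted_gram_def mv_def ip_def)
    then show ?thesis by (simp add: A(2))
  qed
  ultimately show ?case by simp
next
  case (Suc l)
  let ?S = "subsets_of_size n l"
  define c where "c = (exp (s * b) - 1) / b"
  define E where "E = (\<Sum>K\<in>?S. trace_exp r (weighted_gram s x K))"
  define Out where "Out = (\<Sum>K\<in>?S. \<Sum>k\<in>{..<n} - K. exp_form r (weighted_gram s x K) (x k))"
  define In where "In = (\<Sum>K\<in>?S. \<Sum>k\<in>K. exp_form r (weighted_gram s x K) (x k))"
  have fin: "finite K" if "K \<subseteq> {..<n}" for K using that finite_subset by blast
  have n: "0 < n" "l < n" using Suc.prems by auto
  have E0: "0 \<le> E" unfolding E_def by (intro sum_nonneg trace_exp_nonneg)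
  have "In + Out = (\<Sum>K\<in>?S. \<Sum>k<n. exp_form r (weighted_gram s x K) (x k))"
    unfolding In_def Out_def sum.distrib[symmetric]
  proof (intro sum.cong refl)
    fix K assume "K \<in> ?S"
    then show "(\<Sum>k\<in>K. exp_form r (weighted_gram s x K) (x k))
        + (\<Sum>k\<in>{..<n} - K. exp_form r (weighted_gram s x K) (x k))
        = (\<Sum>k<n. exp_form r (weighted_gram s x K) (x k))"
      using sum.subset_diff[of K "{..<n}" "\<lambda>k. exp_form r (weighted_gram s x K) (x k)"] by simp
  qed
  also have "\<dots> = E"
    unfolding E_def by (intro sum.cong refl sum_exp_form_tight_frame[OF frame hermitian_weighted_gram])
  finally have InOut: "In + Out = E" .
  have "s * real l * Out \<le> s * real (n - l) * In"
    unfolding In_def Out_def by (rule exchange_inequality)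
  then have "s * (real l * Out + real (n - l) * Out) \<le> s * (real (n - l) * (In + Out))"
    by (simp add: algebra_simps)
  then have sO: "s * (real n * Out) \<le> s * (real (n - l) * E)"
    using n by (simp add: InOut flip: distrib_right)
  have "c * (real n * Out) \<le> c * (real (n - l) * E)"
  proof (cases s "0 :: real" rule: linorder_cases)
    case less
    then have "c \<le> 0" using b by (simp add: c_def divide_nonpos_pos mult_nonpos_nonneg)
    with less sO show ?thesis by (intro mult_left_mono_neg) auto
  next
    case greater
    then have "0 \<le> c" using b by (simp add: c_def)
    with greater sO show ?thesis by (intro mult_left_mono) auto
  qed (simp add: c_def)
  then have cO: "c * Out \<le> c * (real (n - l) * E) / real n"
    using n by (simp add: pos_le_divide_eq mult_ac)
  have "real (Suc l) * (\<Sum>K\<in>subsets_of_size n (Suc l). trace_exp r (weighted_gram s x K))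
      = (\<Sum>K\<in>?S. \<Sum>k\<in>{..<n} - K. trace_exp r (weighted_gram s x (insert k K)))"
    by (rule sum_subsets_insert)
  also have "\<dots> \<le> (\<Sum>K\<in>?S. \<Sum>k\<in>{..<n} - K. trace_exp r (weighted_gram s x K)
      + c * exp_form r (weighted_gram s x K) (x k))"
  proof (intro sum_mono)
    fix K k assume "K \<in> ?S" "k \<in> {..<n} - K"
    then show "trace_exp r (weighted_gram s x (insert k K)) \<le> trace_exp r (weighted_gram s x K)
        + c * exp_form r (weighted_gram s x K) (x k)"
      using trace_exp_rank_one_update[OF hermitian_weighted_gram b(1) b(2), of k s x K s] fin[of K]
      by (simp add: weighted_gram_insert c_def)
  qed
  also have "\<dots> = real (n - l) * E + c * Out"
  proof -
    have "card ({..<n} - K) = n - l" if "K \<in> ?S" for K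
      using that fin by (auto simp: card_Diff_subset)
    then show ?thesis by (simp add: sum.distrib E_def Out_def sum_distrib_left)
  qed
  also have "\<dots> \<le> real (n - l) * E * (1 + c / real n)"
    using cO by (simp add: algebra_simps)
  also have "\<dots> \<le> real (n - l) * E * exp (c / real n)"
    using E0 by (intro mult_left_mono exp_ge_add_one_self) auto
  also have "\<dots> \<le> real (n - l) * (real (n choose l) * real r * exp (c * real l / real n)) * exp (c / real n)"
    using Suc.IH Suc.prems unfolding E_def c_def
    by (intro mult_right_mono mult_left_mono) auto
  also have "\<dots> = real ((n - l) * (n choose l)) * real r * (exp (c * real l / real n) * exp (c / real n))"
    by (simp add: mult_ac)
  also have "(n - l) * (n choose l) = Suc l * (n choose Suc l)"
    by (simp only: binomial_absorb_comp binomial_absorption)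
  also have "exp (c * real l / real n) * exp (c / real n) = exp (c * real (Suc l) / real n)"
    by (simp add: algebra_simps add_divide_distrib flip: exp_add)
  finally have "real (Suc l) * (\<Sum>K\<in>subsets_of_size n (Suc l). trace_exp r (weighted_gram s x K))
      \<le> real (Suc l) * (real (n choose Suc l) * real r * exp (c * real (Suc l) / real n))"
    by (simp only: of_nat_mult mult.assoc)
  then show ?case unfolding c_def by (subst (asm) mult_le_cancel_left_pos) auto
qed

lemma trace_exp_large:
  assumes hA: "hermitian_on r A" and q: "ip r y (mv r A y) = of_real q" and "a * nrm2 r y < q"
  shows "exp a \<le> trace_exp r A"
proof (rule ccontr)
  obtain lam u where A: "spectral_basis r A lam u" "trace_exp r A = (\<Sum>i<r. exp (lam i))"
    using spectral_choice[OF hA] by metis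
  have ob: "orthonormal_basis r u" using A by (simp add: spectral_basis_def)
  assume "\<not> exp a \<le> trace_exp r A"
  then have small: "(\<Sum>i<r. exp (lam i)) < exp a" by (simp add: A)
  have "lam i \<le> a" if "i < r" for i
  proof -
    have "exp (lam i) \<le> (\<Sum>i<r. exp (lam i))"
      using that by (intro member_le_sum) auto
    with small have "exp (lam i) < exp a" by linarith
    then show ?thesis by simp
  qed
  then have "(\<Sum>i<r. lam i * (cmod (ip r (u i) y))\<^sup>2) \<le> a * nrm2 r y"
    unfolding parseval_nrm2[OF ob] sum_distrib_left by (intro sum_mono mult_right_mono) auto
  moreover have "q = (\<Sum>i<r. lam i * (cmod (ip r (u i) y))\<^sup>2)"
    using q unfolding spectral_quadratic_form[OF A(1)] of_real_eq_iff by simp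
  ultimately show False using assms(3) by simp
qed

text \<open>For positive \<open>s\<close> the largest eigenvalue of the sampled Gram matrix lies above \<open>a\<close>, for negative
  \<open>s\<close> the smallest one lies below \<open>a\<close>.\<close>

definition exceeds :: "nat \<Rightarrow> (nat \<Rightarrow> nat \<Rightarrow> complex) \<Rightarrow> real \<Rightarrow> real \<Rightarrow> nat set \<Rightarrow> bool" where
  "exceeds r x s a K \<longleftrightarrow> (\<exists>y. s * a * nrm2 r y < s * (\<Sum>k\<in>K. (cmod (ip r (x k) y))\<^sup>2))"

text \<open>Markov's inequality for the trace exponential.\<close>

theorem subset_sampling_tail:
  assumes frame: "tight_frame r n x" and b: "0 < b" "\<And>k. k < n \<Longrightarrow> nrm2 r (x k) \<le> b" and "l \<le> n"
  shows "real (card {K \<in> subsets_of_size n l. exceeds r x s a K})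
    \<le> real (n choose l) * (real r * exp ((exp (s * b) - 1) / b * real l / real n - s * a))"
proof -
  let ?S = "subsets_of_size n l" and ?B = "{K \<in> subsets_of_size n l. exceeds r x s a K}"
  have "real (card ?B) * exp (s * a) = (\<Sum>K\<in>?B. exp (s * a))" by simp
  also have "\<dots> \<le> (\<Sum>K\<in>?B. trace_exp r (weighted_gram s x K))"
  proof (rule sum_mono)
    fix K assume "K \<in> ?B"
    then have "finite K" "exceeds r x s a K" using finite_subset[of K "{..<n}"] by auto
    then show "exp (s * a) \<le> trace_exp r (weighted_gram s x K)"
      using trace_exp_large[OF hermitian_weighted_gram weighted_gram_quadratic_form]
      by (auto simp: exceeds_def)
  qed
  also have "\<dots> \<le> (\<Sum>K\<in>?S. trace_exp r (weighted_gram s x K))"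
    by (intro sum_mono2 finite_subsets_of_size trace_exp_nonneg) auto
  also have "\<dots> \<le> real (n choose l) * real r * exp ((exp (s * b) - 1) / b * real l / real n)"
    by (rule expected_trace_exp_sampling[OF frame b assms(4)])
  finally have "real (card ?B) * exp (s * a)
      \<le> real (n choose l) * real r * exp ((exp (s * b) - 1) / b * real l / real n)" .
  then have "real (card ?B)
      \<le> real (n choose l) * real r * exp ((exp (s * b) - 1) / b * real l / real n) / exp (s * a)"
    by (subst pos_le_divide_eq) auto
  then show ?thesis by (simp add: exp_diff)
qed

text \<open>Each set of size \<open>l\<close> underlies \<open>l!\<close> ordered samples.\<close>

lemma card_samples_set:
  "card {ks \<in> samples n l. Q (set ks)} = fact l * card {K \<in> subsets_of_size n l. Q K}"
proof -
  let ?S = "{K \<in> subsets_of_size n l. Q K}"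
  have fin: "finite K" if "K \<in> ?S" for K using that finite_subset[of K "{..<n}"] by auto
  have "{ks \<in> samples n l. Q (set ks)} = (\<Union>K\<in>?S. permutations_of_set K)"
    by (auto simp: samples_def permutations_of_set_def distinct_card)
  also have "card \<dots> = (\<Sum>K\<in>?S. card (permutations_of_set K))"
  proof (rule card_UN_disjoint)
    show "finite ?S" by (rule finite_subset[OF _ finite_subsets_of_size[of n l]]) blast
    show "\<forall>K\<in>?S. finite (permutations_of_set K)" by simp
    show "\<forall>K\<in>?S. \<forall>L\<in>?S. K \<noteq> L \<longrightarrow> permutations_of_set K \<inter> permutations_of_set L = {}"
      unfolding permutations_of_set_def by blast
  qed
  also have "\<dots> = (\<Sum>K\<in>?S. fact l)"
  proof (intro sum.cong refl)
    fix K assume K: "K \<in> ?S"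
    then show "card (permutations_of_set K) = fact l"
      using card_permutations_of_set[OF fin[OF K]] by simp
  qed
  finally show ?thesis by (simp add: mult.commute)
qed

theorem sampling_tail:
  assumes frame: "tight_frame r n x" and b: "0 < b" "\<And>k. k < n \<Longrightarrow> nrm2 r (x k) \<le> b" and "l \<le> n"
  shows "real (card {ks \<in> samples n l. exceeds r x s a (set ks)})
    \<le> real (card (samples n l)) * (real r * exp ((exp (s * b) - 1) / b * real l / real n - s * a))"
proof -
  have "card (samples n l) = fact l * (n choose l)"
    using card_samples_set[of n l "\<lambda>_. True"] n_subsets[of "{..<n}" l] by simp
  moreover have "real (fact l) * real (card {K \<in> subsets_of_size n l. exceeds r x s a K})
      \<le> real (fact l) * (real (n choose l) * (real r * exp ((exp (s * b) - 1) / b * real l / real n - s * a)))"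
    by (intro mult_left_mono subset_sampling_tail[OF frame b assms(4)]) auto
  ultimately show ?thesis
    unfolding card_samples_set by (simp add: mult_ac)
qed

section \<open>Random phases do not lengthen the columns\<close>

text \<open>The power series are compared termwise, using \<open>2\<^sup>n n! \<le> (2 n)!\<close>.\<close>

lemma cosh_le_exp_half_square: "cosh (u::real) \<le> exp (u\<^sup>2 / 2)"
proof -
  have "(\<lambda>n. (\<lambda>n. if even n then u ^ n /\<^sub>R fact n else 0) (2 * n)) sums cosh u"
    by (subst sums_mono_reindex) (auto simp: strict_mono_def intro: cosh_converges)
  then have "(\<lambda>n. u ^ (2 * n) /\<^sub>R fact (2 * n)) sums cosh u"
    by simp
  moreover have "(\<lambda>n. (u\<^sup>2 / 2) ^ n /\<^sub>R fact n) sums exp (u\<^sup>2 / 2)"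
    by (rule exp_converges)
  moreover have "u ^ (2 * n) /\<^sub>R fact (2 * n) \<le> (u\<^sup>2 / 2) ^ n /\<^sub>R fact n" for n
  proof -
    have "2 ^ n * fact n \<le> (fact (2 * n) :: nat)"
    proof (induction n)
      case (Suc n)
      have "2 ^ Suc n * fact (Suc n) = (2 * Suc n) * (2 ^ n * fact n)" by (simp add: algebra_simps)
      also have "\<dots> \<le> (2 * Suc n) * fact (2 * n)" using Suc by (rule mult_le_mono2)
      also have "\<dots> \<le> (2 * Suc n) * (Suc (2 * n) * fact (2 * n))" by (intro mult_le_mono2) simp
      also have "\<dots> = fact (2 * Suc n)" by (simp add: mult_ac)
      finally show ?case .
    qed simp
    then have "real (2 ^ n * fact n) \<le> real (fact (2 * n))" by (simp only: of_nat_le_iff)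
    then have "2 ^ n * fact n \<le> (fact (2 * n) :: real)" by simp
    then have "u ^ (2 * n) / fact (2 * n) \<le> u ^ (2 * n) / (2 ^ n * fact n)"
      by (intro divide_left_mono) (auto simp: power_mult)
    moreover have "(u\<^sup>2 / 2) ^ n = u ^ (2 * n) / 2 ^ n"
      by (simp only: power_divide power_mult)
    ultimately show ?thesis
      by (simp only: real_scaleR_def divide_inverse inverse_mult_distrib mult_ac)
  qed
  ultimately show ?thesis by (rule sums_le[rotated])
qed

text \<open>The sum factors as a product of two hyperbolic cosines, whose arguments have squares adding
  up to \<open>(a\<^sup>2 + b\<^sup>2) / 2\<close>.\<close>

lemma cosh_add_cosh_le: "cosh a + cosh b \<le> 2 * exp ((a\<^sup>2 + b\<^sup>2) / 4)" for a b :: real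
proof -
  have "cosh a + cosh b = 2 * cosh ((a + b) / 2) * cosh ((a - b) / 2)"
    using cosh_add[of "(a + b) / 2" "(a - b) / 2"] cosh_diff[of "(a + b) / 2" "(a - b) / 2"]
    by (simp add: field_simps)
  also have "\<dots> \<le> 2 * exp (((a + b) / 2)\<^sup>2 / 2) * exp (((a - b) / 2)\<^sup>2 / 2)"
    by (intro mult_mono cosh_le_exp_half_square) auto
  also have "\<dots> = 2 * exp (((a + b) / 2)\<^sup>2 / 2 + ((a - b) / 2)\<^sup>2 / 2)"
    by (simp add: exp_add)
  also have "((a + b) / 2)\<^sup>2 / 2 + ((a - b) / 2)\<^sup>2 / 2 = (a\<^sup>2 + b\<^sup>2) / 4"
    by (simp add: power2_eq_square field_simps)
  finally show ?thesis .
qed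

lemma sets_uniform_circle [simp, measurable_cong]: "sets uniform_circle = sets borel"
  by (simp add: uniform_circle_def)

lemma borel_measurable_cis [measurable]: "cis \<in> borel_measurable borel"
  by (intro borel_measurable_continuous_onI continuous_intros)

lemma nn_integral_uniform_circle:
  assumes [measurable]: "f \<in> borel_measurable borel"
  shows "(\<integral>\<^sup>+z. f z \<partial>uniform_circle)
    = (\<integral>\<^sup>+x. f (cis x) * indicator {0..<2 * pi} x \<partial>lborel) / ennreal (2 * pi)"
  unfolding uniform_circle_def
  by (subst nn_integral_distr) (auto simp: nn_integral_uniform_measure)

text \<open>Averaging over rotations by quarter turns turns an integral over the circle into one of a
  symmetrised integrand.\<close>

lemma nn_integral_uniform_circle_quarter:
  assumes f[measurable]: "f \<in> borel_measurable borel"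
  shows "(\<integral>\<^sup>+z. f z \<partial>uniform_circle)
    = (\<integral>\<^sup>+x. (f (cis x) + f (\<i> * cis x) + f (- cis x) + f (- \<i> * cis x)) * indicator {0..<pi / 2} x \<partial>lborel)
        / ennreal (2 * pi)"
proof -
  define Q where "Q = (\<lambda>k. \<integral>\<^sup>+x. f (cis x) * indicator {k * (pi / 2)..<(k + 1) * (pi / 2)} x \<partial>lborel)"
  have Q: "Q k = (\<integral>\<^sup>+x. f (cis (k * (pi / 2)) * cis x) * indicator {0..<pi / 2} x \<partial>lborel)" for k
  proof -
    have "Q k = ennreal \<bar>1\<bar> * (\<integral>\<^sup>+x. f (cis (k * (pi / 2) + 1 * x))
        * indicator {k * (pi / 2)..<(k + 1) * (pi / 2)} (k * (pi / 2) + 1 * x) \<partial>lborel)"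
      unfolding Q_def by (rule nn_integral_real_affine) auto
    also have "\<dots> = (\<integral>\<^sup>+x. f (cis (k * (pi / 2)) * cis x) * indicator {0..<pi / 2} x \<partial>lborel)"
      by (simp add: cis_mult) (intro nn_integral_cong, auto simp: indicator_def algebra_simps)
    finally show ?thesis .
  qed
  have cis4: "cis (1 * (pi / 2)) = \<i>" "cis (2 * (pi / 2)) = -1" "cis (3 * (pi / 2)) = - \<i>"
  proof -
    have "cis (3 * (pi / 2)) = cis pi * cis (pi / 2)" unfolding cis_mult by (rule arg_cong[of _ _ cis]) simp
    then show "cis (3 * (pi / 2)) = - \<i>" by simp
  qed auto
  have "(\<integral>\<^sup>+x. f (cis x) * indicator {0..<2 * pi} x \<partial>lborel)
      = (\<integral>\<^sup>+x. f (cis x) * indicator {0 * (pi / 2)..<(0 + 1) * (pi / 2)} x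
          + f (cis x) * indicator {1 * (pi / 2)..<(1 + 1) * (pi / 2)} x
          + f (cis x) * indicator {2 * (pi / 2)..<(2 + 1) * (pi / 2)} x
          + f (cis x) * indicator {3 * (pi / 2)..<(3 + 1) * (pi / 2)} x \<partial>lborel)"
    by (intro nn_integral_cong) (auto simp: indicator_def)
  also have "\<dots> = Q 0 + Q 1 + Q 2 + Q 3"
    unfolding Q_def by (subst nn_integral_add; (measurable | simp)?)+
  also have "\<dots> = (\<integral>\<^sup>+x. f (cis x) * indicator {0..<pi / 2} x + f (\<i> * cis x) * indicator {0..<pi / 2} x
      + f (- cis x) * indicator {0..<pi / 2} x + f (- \<i> * cis x) * indicator {0..<pi / 2} x \<partial>lborel)"
    unfolding Q cis4 by (subst nn_integral_add; (measurable | simp)?)+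
  finally show ?thesis
    unfolding nn_integral_uniform_circle[OF f] by (simp add: distrib_right)
qed

text \<open>The symmetrised integrand is bounded pointwise. The constant \<open>1 / 4\<close> matches a complex
  Gaussian variable of unit variance; the bound \<open>1 / 2\<close> that follows from the modulus alone
  would double the typical squared length in the tail estimate.\<close>

lemma uniform_circle_exp_bound:
  "(\<integral>\<^sup>+z. ennreal (exp (Re (z * w))) \<partial>uniform_circle) \<le> ennreal (exp ((cmod w)\<^sup>2 / 4))"
proof -
  have pt: "exp (Re (cis x * w)) + exp (Re (\<i> * cis x * w)) + exp (Re (- cis x * w))
      + exp (Re (- \<i> * cis x * w)) \<le> 4 * exp ((cmod w)\<^sup>2 / 4)" for x
  proof -
    define u where "u = cis x * w"
    have "exp (Re u) + exp (- Im u) + exp (- Re u) + exp (Im u) = 2 * (cosh (Re u) + cosh (Im u))"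
      by (simp add: cosh_def field_simps)
    also have "\<dots> \<le> 4 * exp (((Re u)\<^sup>2 + (Im u)\<^sup>2) / 4)"
      using cosh_add_cosh_le[of "Re u" "Im u"] by simp
    also have "(Re u)\<^sup>2 + (Im u)\<^sup>2 = (cmod w)\<^sup>2"
      unfolding cmod_power2[symmetric] by (simp add: u_def norm_mult)
    finally show ?thesis by (simp add: u_def algebra_simps)
  qed
  have "(\<integral>\<^sup>+z. ennreal (exp (Re (z * w))) \<partial>uniform_circle)
      = (\<integral>\<^sup>+x. ennreal (exp (Re (cis x * w)) + exp (Re (\<i> * cis x * w)) + exp (Re (- cis x * w))
      + exp (Re (- \<i> * cis x * w))) * indicator {0..<pi / 2} x \<partial>lborel) / ennreal (2 * pi)"
  proof (subst nn_integral_uniform_circle_quarter)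
    have "(\<lambda>z. exp (Re (z * w))) \<in> borel_measurable borel"
      by (intro borel_measurable_continuous_onI continuous_intros)
    then show "(\<lambda>z. ennreal (exp (Re (z * w)))) \<in> borel_measurable borel" by measurable
  qed (simp only: ennreal_plus[symmetric] exp_ge_zero add_nonneg_nonneg)
  also have "\<dots> \<le> (\<integral>\<^sup>+x. ennreal (4 * exp ((cmod w)\<^sup>2 / 4)) * indicator {0..<pi / 2} x \<partial>lborel) / ennreal (2 * pi)"
    by (intro divide_right_mono_ennreal nn_integral_mono mult_right_mono ennreal_leI pt) auto
  also have "\<dots> = ennreal (4 * exp ((cmod w)\<^sup>2 / 4)) * ennreal (pi / 2) / ennreal (2 * pi)"
    by (subst nn_integral_cmult_indicator) auto
  also have "\<dots> = ennreal (exp ((cmod w)\<^sup>2 / 4))"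
    by (simp add: divide_ennreal flip: ennreal_mult'' )
  finally show ?thesis .
qed

abbreviation gauss :: "real measure" where
  "gauss \<equiv> density lborel std_normal_density"

text \<open>Completing the square shifts the density.\<close>

lemma nn_integral_gauss_exp:
  "(\<integral>\<^sup>+g. ennreal (exp (g * t)) \<partial>gauss) = ennreal (exp (t\<^sup>2 / 2))"
proof -
  have "(\<integral>\<^sup>+g. ennreal (exp (g * t)) \<partial>gauss) = (\<integral>\<^sup>+g. ennreal (exp (t\<^sup>2 / 2)) * ennreal (normal_density t 1 g) \<partial>lborel)"
  proof (subst nn_integral_density; (measurable)?)
    show "(\<integral>\<^sup>+g. ennreal (std_normal_density g) * ennreal (exp (g * t)) \<partial>lborel)
        = (\<integral>\<^sup>+g. ennreal (exp (t\<^sup>2 / 2)) * ennreal (normal_density t 1 g) \<partial>lborel)"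
      by (intro nn_integral_cong)
         (auto simp: normal_density_def power2_eq_square algebra_simps add_divide_distrib diff_divide_distrib
           simp flip: ennreal_mult exp_add)
  qed
  also have "\<dots> = ennreal (exp (t\<^sup>2 / 2)) * emeasure (density lborel (normal_density t 1)) UNIV"
    by (subst nn_integral_cmult) (auto simp: emeasure_density)
  also have "emeasure (density lborel (normal_density t 1)) UNIV = 1"
    using prob_space.emeasure_space_1[OF prob_space_normal_density[of 1 t]] by simp
  finally show ?thesis by simp
qed

text \<open>The integrand is a multiple of a Gaussian density of larger variance.\<close>

lemma nn_integral_gauss_exp_square:
  assumes "th < 1"
  shows "(\<integral>\<^sup>+g. ennreal (exp (th * g\<^sup>2 / 2)) \<partial>gauss) = ennreal (1 / sqrt (1 - th))"
proof -
  define sg where "sg = 1 / sqrt (1 - th)"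
  have sg: "sg > 0" and sg2: "sg\<^sup>2 = 1 / (1 - th)" using assms by (auto simp: sg_def power_divide)
  have pt: "std_normal_density g * exp (th * g\<^sup>2 / 2) = sg * normal_density 0 sg g" for g
  proof -
    have "- (g\<^sup>2) / (2 * sg\<^sup>2) = - (g\<^sup>2) / 2 + th * g\<^sup>2 / 2"
      unfolding sg2 using assms by (simp add: field_simps)
    moreover have "sqrt (2 * pi * sg\<^sup>2) = sqrt (2 * pi) * sg"
      using sg by (simp add: real_sqrt_mult)
    moreover have "exp (- (g\<^sup>2) / 2 + th * g\<^sup>2 / 2) = exp (- (g\<^sup>2) / 2) * exp (th * g\<^sup>2 / 2)"
      by (rule exp_add)
    ultimately show ?thesis using sg by (simp only: normal_density_def) simp
  qed
  have "(\<integral>\<^sup>+g. ennreal (exp (th * g\<^sup>2 / 2)) \<partial>gauss) = (\<integral>\<^sup>+g. ennreal sg * ennreal (normal_density 0 sg g) \<partial>lborel)"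
    using sg by (subst nn_integral_density) (auto simp: pt simp flip: ennreal_mult)
  also have "\<dots> = ennreal sg * emeasure (density lborel (normal_density 0 sg)) UNIV"
    by (subst nn_integral_cmult) (auto simp: emeasure_density)
  also have "emeasure (density lborel (normal_density 0 sg)) UNIV = 1"
    using prob_space.emeasure_space_1[OF prob_space_normal_density[OF sg]] by simp
  finally show ?thesis by (simp add: sg_def)
qed

lemma prob_space_gauss: "prob_space gauss"
  by (rule prob_space_normal_density) simp

abbreviation real_coords :: "nat \<Rightarrow> (nat \<times> bool) set" where
  "real_coords r \<equiv> {..<r} \<times> UNIV"

definition real_coord :: "(nat \<Rightarrow> complex) \<Rightarrow> nat \<times> bool \<Rightarrow> real" where
  "real_coord x p = (if snd p then Im (x (fst p)) else Re (x (fst p)))"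

lemma sum_real_coords: "(\<Sum>p\<in>real_coords r. f p) = (\<Sum>i<r. f (i, False) + f (i, True))"
  for f :: "nat \<times> bool \<Rightarrow> real"
proof -
  have "(\<Sum>p\<in>real_coords r. f p) = (\<Sum>i<r. \<Sum>b\<in>UNIV. f (i, b))"
    by (simp add: sum.cartesian_product)
  then show ?thesis by (simp add: UNIV_bool)
qed

lemma nrm2_real_coords: "nrm2 r x = (\<Sum>p\<in>real_coords r. (real_coord x p)\<^sup>2)"
  by (simp add: sum_real_coords nrm2_def real_coord_def cmod_power2)

text \<open>Complex vectors are paired with real Gaussian vectors on twice as many coordinates; the flag
  selects the imaginary part.\<close>

definition of_coords :: "(nat \<times> bool \<Rightarrow> real) \<Rightarrow> nat \<Rightarrow> complex" where
  "of_coords g = (\<lambda>i. Complex (g (i, False)) (g (i, True)))"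

lemma inner_real_coords: "(\<Sum>p\<in>real_coords r. g p * real_coord x p) = Re (ip r (of_coords g) x)"
  by (simp add: sum_real_coords real_coord_def ip_def of_coords_def Re_sum)

lemma nrm2_of_coords: "nrm2 r (of_coords g) = (\<Sum>p\<in>real_coords r. (g p)\<^sup>2)"
  by (simp add: sum_real_coords nrm2_def of_coords_def cmod_power2)

abbreviation gauss_vec :: "nat \<Rightarrow> (nat \<times> bool \<Rightarrow> real) measure" where
  "gauss_vec r \<equiv> (\<Pi>\<^sub>M p\<in>real_coords r. gauss)"

abbreviation phases :: "nat \<Rightarrow> (nat \<Rightarrow> complex) measure" where
  "phases n \<equiv> (\<Pi>\<^sub>M i\<in>{..<n}. uniform_circle)"

text \<open>An auxiliary Gaussian vector replaces the exponential of a square by that of a linear form,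
  which factorises over independent phases.\<close>

lemma gauss_linearisation:
  assumes "0 \<le> th"
  shows "(\<integral>\<^sup>+g. ennreal (exp (sqrt (2 * th) * Re (ip r (of_coords g) x))) \<partial>gauss_vec r)
    = ennreal (exp (th * nrm2 r x))"
proof -
  interpret prob_space gauss by (rule prob_space_gauss)
  interpret product_sigma_finite "\<lambda>_. gauss" by standard
  have "(\<integral>\<^sup>+g. ennreal (exp (sqrt (2 * th) * Re (ip r (of_coords g) x))) \<partial>gauss_vec r)
      = (\<integral>\<^sup>+g. (\<Prod>p\<in>real_coords r. ennreal (exp (g p * (sqrt (2 * th) * real_coord x p)))) \<partial>gauss_vec r)"
    unfolding inner_real_coords[symmetric] sum_distrib_left
    by (simp add: exp_sum prod_ennreal mult_ac)
  also have "\<dots> = (\<Prod>p\<in>real_coords r. ennreal (exp ((sqrt (2 * th) * real_coord x p)\<^sup>2 / 2)))"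
    by (subst product_nn_integral_prod) (simp_all add: nn_integral_gauss_exp)
  also have "\<dots> = ennreal (exp (th * nrm2 r x))"
    using assms by (simp add: prod_ennreal nrm2_real_coords sum_distrib_left power_mult_distrib flip: exp_sum)
  finally show ?thesis .
qed

lemma gauss_chi_square:
  assumes "th < 1"
  shows "(\<integral>\<^sup>+g. ennreal (exp (th / 2 * nrm2 r (of_coords g))) \<partial>gauss_vec r) = ennreal ((1 / (1 - th)) ^ r)"
proof -
  interpret prob_space gauss by (rule prob_space_gauss)
  interpret product_sigma_finite "\<lambda>_. gauss" by standard
  have "(\<integral>\<^sup>+g. ennreal (exp (th / 2 * nrm2 r (of_coords g))) \<partial>gauss_vec r)
      = (\<integral>\<^sup>+g. (\<Prod>p\<in>real_coords r. ennreal (exp (th * (g p)\<^sup>2 / 2))) \<partial>gauss_vec r)"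
    unfolding nrm2_of_coords sum_distrib_left by (simp add: exp_sum prod_ennreal)
  also have "\<dots> = (\<Prod>p\<in>real_coords r. ennreal (1 / sqrt (1 - th)))"
    by (subst product_nn_integral_prod) (simp_all add: nn_integral_gauss_exp_square[OF assms])
  also have "\<dots> = ennreal ((1 / sqrt (1 - th)) ^ (r * 2))"
    using assms by (simp add: card_cartesian_product ennreal_power)
  also have "(1 / sqrt (1 - th)) ^ (r * 2) = (1 / (1 - th)) ^ r"
    using assms by (simp add: power_mult power_divide mult.commute[of r])
  finally show ?thesis .
qed

lemma Re_ip_phase_sum:
  "Re (ip r y (\<lambda>i. \<Sum>k<n. d k * c k i)) = (\<Sum>k<n. Re (d k * ip r y (c k)))"
  by (simp add: ip_sum_right Re_sum)

text \<open>A linear form in the phases is a sum of independent terms.\<close>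

lemma phases_linear_mgf:
  "(\<integral>\<^sup>+d. ennreal (exp (s * Re (ip r y (\<lambda>i. \<Sum>k<n. d k * c k i)))) \<partial>phases n)
    \<le> ennreal (exp (s\<^sup>2 / 4 * (\<Sum>k<n. (cmod (ip r (c k) y))\<^sup>2)))"
proof -
  interpret prob_space uniform_circle by (rule prob_space_uniform_circle)
  interpret product_sigma_finite "\<lambda>_. uniform_circle" by standard
  have "(\<integral>\<^sup>+d. ennreal (exp (s * Re (ip r y (\<lambda>i. \<Sum>k<n. d k * c k i)))) \<partial>phases n)
      = (\<integral>\<^sup>+d. (\<Prod>k<n. ennreal (exp (Re (d k * (of_real s * ip r y (c k)))))) \<partial>phases n)"
    unfolding Re_ip_phase_sum sum_distrib_left
    by (simp add: exp_sum prod_ennreal mult.left_commute[of _ "complex_of_real s"])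
  also have "\<dots> = (\<Prod>k<n. \<integral>\<^sup>+z. ennreal (exp (Re (z * (of_real s * ip r y (c k))))) \<partial>uniform_circle)"
    by (subst product_nn_integral_prod) simp_all
  also have "\<dots> \<le> (\<Prod>k<n. ennreal (exp ((cmod (of_real s * ip r y (c k)))\<^sup>2 / 4)))"
    by (intro prod_mono_ennreal uniform_circle_exp_bound)
  also have "\<dots> = ennreal (exp (s\<^sup>2 / 4 * (\<Sum>k<n. (cmod (ip r (c k) y))\<^sup>2)))"
    by (simp add: prod_ennreal sum_distrib_left norm_mult power_mult_distrib cmod_ip_commute[of r y] flip: exp_sum)
  finally show ?thesis .
qed

lemma borel_measurable_phases_component [measurable]:
  "k < n \<Longrightarrow> (\<lambda>d. d k) \<in> borel_measurable (phases n)"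
proof -
  assume "k < n"
  then have "(\<lambda>d. d k) \<in> measurable (phases n) uniform_circle"
    by (intro measurable_component_singleton) auto
  then show ?thesis by (simp add: measurable_cong_sets[OF refl sets_uniform_circle])
qed

text \<open>After linearisation and exchange of the integrals, the bound for the linear form turns the
  tight frame condition into the squared length of the Gaussian vector: the phases behave no
  worse than independent Gaussian coefficients, for which the moment is explicit.\<close>

theorem phases_exp_moment:
  assumes frame: "tight_frame r n c" and th: "0 \<le> th" "th < 1"
  shows "(\<integral>\<^sup>+d. ennreal (exp (th * nrm2 r (\<lambda>i. \<Sum>k<n. d k * c k i))) \<partial>phases n)
    \<le> ennreal ((1 / (1 - th)) ^ r)"
proof -
  let ?L = "\<lambda>g d. sqrt (2 * th) * Re (ip r (of_coords g) (\<lambda>i. \<Sum>k<n. d k * c k i))"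
  interpret UP: prob_space "phases n" by (intro prob_space_PiM prob_space_uniform_circle)
  interpret GP: prob_space "gauss_vec r" by (intro prob_space_PiM prob_space_gauss)
  interpret pair_sigma_finite "gauss_vec r" "phases n" by standard
  have [measurable]: "(\<lambda>(g, d). ennreal (exp (?L g d))) \<in> borel_measurable (gauss_vec r \<Otimes>\<^sub>M phases n)"
  proof -
    have 1: "(\<lambda>gd. fst gd p) \<in> borel_measurable (gauss_vec r \<Otimes>\<^sub>M phases n)" if "p \<in> real_coords r" for p
    proof -
      have "(\<lambda>g. g p) \<in> measurable (gauss_vec r) gauss"
        using that by (intro measurable_component_singleton)
      then have "(\<lambda>g. g p) \<in> borel_measurable (gauss_vec r)"
        by (simp add: measurable_cong_sets[OF refl sets_density] cong: measurable_cong_sets)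
      from measurable_compose[OF measurable_fst this] show ?thesis .
    qed
    have 2: "(\<lambda>gd. snd gd k) \<in> borel_measurable (gauss_vec r \<Otimes>\<^sub>M phases n)" if "k < n" for k
      using measurable_compose[OF measurable_snd borel_measurable_phases_component[OF that]] .
    have "(\<lambda>gd. ennreal (exp (sqrt (2 * th) * (\<Sum>p\<in>real_coords r. fst gd p *
        real_coord (\<lambda>i. \<Sum>k<n. snd gd k * c k i) p)))) \<in> borel_measurable (gauss_vec r \<Otimes>\<^sub>M phases n)"
      unfolding sum_real_coords real_coord_def
      by (auto simp: Re_sum Im_sum intro!: measurable_compose[OF _ measurable_ennreal] borel_measurable_exp
          borel_measurable_times borel_measurable_sum borel_measurable_add borel_measurable_diff 1
          measurable_compose[OF 2 borel_measurable_Re] measurable_compose[OF 2 borel_measurable_Im])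
    then show ?thesis by (simp add: inner_real_coords case_prod_beta)
  qed
  have "(\<integral>\<^sup>+d. ennreal (exp (th * nrm2 r (\<lambda>i. \<Sum>k<n. d k * c k i))) \<partial>phases n)
      = (\<integral>\<^sup>+d. \<integral>\<^sup>+g. ennreal (exp (?L g d)) \<partial>gauss_vec r \<partial>phases n)"
    by (simp add: gauss_linearisation[OF th(1)])
  also have "\<dots> = (\<integral>\<^sup>+g. \<integral>\<^sup>+d. ennreal (exp (?L g d)) \<partial>phases n \<partial>gauss_vec r)"
    by (rule Fubini') measurable
  also have "\<dots> \<le> (\<integral>\<^sup>+g. ennreal (exp ((sqrt (2 * th))\<^sup>2 / 4 * (\<Sum>k<n. (cmod (ip r (c k) (of_coords g)))\<^sup>2))) \<partial>gauss_vec r)"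
    by (intro nn_integral_mono phases_linear_mgf)
  also have "\<dots> = (\<integral>\<^sup>+g. ennreal (exp (th / 2 * nrm2 r (of_coords g))) \<partial>gauss_vec r)"
    using frame th by (simp add: tight_frame_def)
  also have "\<dots> = ennreal ((1 / (1 - th)) ^ r)" by (rule gauss_chi_square[OF th(2)])
  finally show ?thesis .
qed

lemma borel_measurable_phases_nrm2 [measurable]:
  "(\<lambda>d. nrm2 r (\<lambda>i. \<Sum>k<n. d k * c k i)) \<in> borel_measurable (phases n)"
  unfolding nrm2_def
  by (auto intro!: borel_measurable_sum borel_measurable_power borel_measurable_norm borel_measurable_times)

text \<open>The Chernoff bound of a Gamma variable of shape \<open>r\<close>.\<close>

theorem phases_norm_tail:
  assumes frame: "tight_frame r n c" and "1 \<le> r" "0 \<le> t"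
  shows "measure (phases n) {d \<in> space (phases n). (sqrt (real r) + t)\<^sup>2 \<le> nrm2 r (\<lambda>i. \<Sum>k<n. d k * c k i)}
    \<le> exp (- (t\<^sup>2))"
proof -
  interpret UP: prob_space "phases n" by (intro prob_space_PiM prob_space_uniform_circle)
  define R where "R = (sqrt (real r) + t)\<^sup>2"
  (* the minimiser of (1 - th) powr (- r) * exp (- th * R) *)
  define th where "th = 1 - real r / R"
  let ?E = "{d \<in> space (phases n). R \<le> nrm2 r (\<lambda>i. \<Sum>k<n. d k * c k i)}"
  let ?f = "\<lambda>d. nrm2 r (\<lambda>i. \<Sum>k<n. d k * c k i)"
  have R: "R = real r + (2 * sqrt (real r) * t + t\<^sup>2)"
    by (simp add: R_def power2_sum algebra_simps)
  have r: "real r > 0" using assms by simp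
  have Rr: "R \<ge> real r" using assms by (simp add: R)
  then have th: "0 \<le> th" "th < 1" using r by (auto simp: th_def)
  have meas: "?E \<in> sets (phases n)" by measurable
  have "ennreal (exp (th * R)) * emeasure (phases n) ?E = (\<integral>\<^sup>+d. ennreal (exp (th * R)) * indicator ?E d \<partial>phases n)"
    using meas by (simp add: nn_integral_cmult_indicator)
  also have "\<dots> \<le> (\<integral>\<^sup>+d. ennreal (exp (th * ?f d)) \<partial>phases n)"
    using th by (intro nn_integral_mono) (auto simp: indicator_def intro!: ennreal_leI mult_left_mono)
  also have "\<dots> \<le> ennreal ((1 / (1 - th)) ^ r)"
    by (rule phases_exp_moment[OF frame th])
  finally have "ennreal (exp (th * R) * measure (phases n) ?E) \<le> ennreal ((1 / (1 - th)) ^ r)"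
    by (simp add: UP.emeasure_eq_measure ennreal_mult')
  then have "exp (th * R) * measure (phases n) ?E \<le> (1 / (1 - th)) ^ r"
    using th by (subst (asm) ennreal_le_iff) auto
  also have "(1 / (1 - th)) ^ r = (1 + t / sqrt (real r)) ^ (2 * r)"
  proof -
    have "1 / (1 - th) = R / real r" by (simp add: th_def)
    also have "\<dots> = ((sqrt (real r) + t) / sqrt (real r))\<^sup>2" using r by (simp add: R_def power_divide)
    also have "\<dots> = (1 + t / sqrt (real r))\<^sup>2" using r by (simp add: add_divide_distrib)
    finally show ?thesis by (simp add: power_mult)
  qed
  also have "\<dots> \<le> exp (t / sqrt (real r)) ^ (2 * r)"
    using assms by (intro power_mono exp_ge_add_one_self) auto
  also have "\<dots> = exp (2 * sqrt (real r) * t)"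
  proof -
    have "real (2 * r) * (t / sqrt (real r)) = 2 * sqrt (real r) * t"
      using r by (simp add: field_simps flip: real_sqrt_mult power2_eq_square)
    then show ?thesis by (simp flip: exp_of_nat_mult)
  qed
  also have "2 * sqrt (real r) * t = th * R - t\<^sup>2"
    using r Rr by (simp add: th_def left_diff_distrib) (simp add: R)
  also have "exp (th * R - t\<^sup>2) = exp (th * R) * exp (- (t\<^sup>2))"
    by (simp flip: exp_add)
  finally have "measure (phases n) ?E \<le> exp (- (t\<^sup>2))" by simp
  then show ?thesis by (simp add: R_def)
qed

lemma AE_uniform_circle_unit: "AE z in uniform_circle. cmod z = 1"
  unfolding uniform_circle_def by (subst AE_distr_iff) auto

lemma AE_phases_unit: "AE d in phases n. \<forall>k<n. cmod (d k) = 1"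
proof -
  have "AE d in phases n. \<forall>k\<in>{..<n}. cmod (d k) = 1"
    by (intro eventually_ball_finite ballI AE_PiM_component prob_space_uniform_circle AE_uniform_circle_unit) auto
  then show ?thesis by (rule eventually_mono) simp
qed

section \<open>The Hadamard and Fourier bases\<close>

text \<open>The two properties of the base matrix that the argument uses: flatness makes all columns
  behave alike under random phases, and orthonormal rows preserve tight frames.\<close>

definition flat_unitary :: "nat \<Rightarrow> complex mat \<Rightarrow> bool" where
  "flat_unitary n F \<longleftrightarrow> F \<in> carrier_mat n n \<and>
     (\<forall>i<n. \<forall>j<n. (cmod (F $$ (i, j)))\<^sup>2 = 1 / real n) \<and>
     (\<forall>i<n. \<forall>k<n. (\<Sum>j<n. F $$ (i, j) * cnj (F $$ (k, j))) = of_bool (i = k))"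

lemma hadamard_matrix_carrier: "hadamard_matrix k \<in> carrier_mat (2 ^ k) (2 ^ k)"
proof (induction k)
  case (Suc k)
  let ?H = "hadamard_matrix k"
  have "four_block_mat ?H ?H ?H (- ?H) \<in> carrier_mat (2 ^ k + 2 ^ k) (2 ^ k + 2 ^ k)"
    using Suc by (intro four_block_carrier_mat) auto
  moreover have "(2 :: nat) ^ Suc k = 2 ^ k + 2 ^ k" by simp
  ultimately show ?case by (simp only: hadamard_matrix.simps Let_def)
qed simp

text \<open>The recursion read off entry by entry, so that the induction need not look inside block
  matrices.\<close>

lemma hadamard_matrix_Suc_index:
  assumes "i < 2 ^ k" "j < 2 ^ k"
  shows "hadamard_matrix (Suc k) $$ (i, j) = hadamard_matrix k $$ (i, j)"
    and "hadamard_matrix (Suc k) $$ (i, j + 2 ^ k) = hadamard_matrix k $$ (i, j)"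
    and "hadamard_matrix (Suc k) $$ (i + 2 ^ k, j) = hadamard_matrix k $$ (i, j)"
    and "hadamard_matrix (Suc k) $$ (i + 2 ^ k, j + 2 ^ k) = - hadamard_matrix k $$ (i, j)"
  using assms hadamard_matrix_carrier[of k] by (auto simp: Let_def)

lemma split_index_double:
  assumes "i < (2 ^ Suc k :: nat)"
  obtains i' where "i' < 2 ^ k" "i = i' \<or> i = i' + 2 ^ k"
proof (cases "i < 2 ^ k")
  case True
  show thesis by (rule that[OF True]) simp
next
  case False
  have "i - 2 ^ k < 2 ^ k" "i = (i - 2 ^ k) + 2 ^ k" using False assms by auto
  then show thesis by (intro that[of "i - 2 ^ k"]) auto
qed

lemma hadamard_matrix_entries:
  "i < 2 ^ k \<Longrightarrow> j < 2 ^ k \<Longrightarrow> hadamard_matrix k $$ (i, j) \<in> {1, -1}"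
proof (induction k arbitrary: i j)
  case (Suc k)
  obtain i' where i': "i' < 2 ^ k" "i = i' \<or> i = i' + 2 ^ k"
    by (rule split_index_double[OF Suc.prems(1)])
  obtain j' where j': "j' < 2 ^ k" "j = j' \<or> j = j' + 2 ^ k"
    by (rule split_index_double[OF Suc.prems(2)])
  from i' j' Suc.IH[OF i'(1) j'(1)] show ?case
    by (auto simp: hadamard_matrix_Suc_index simp del: hadamard_matrix.simps)
qed auto

lemma sum_lessThan_double:
  fixes f :: "nat \<Rightarrow> 'a :: comm_monoid_add"
  shows "(\<Sum>j<m + m. f j) = (\<Sum>j<m. f j) + (\<Sum>j<m. f (j + m))"
proof -
  have "(\<Sum>j<m + m. f j) = (\<Sum>j<m. f j) + (\<Sum>j=m..<m + m. f j)"
    using sum.atLeastLessThan_concat[of 0 m "m + m" f] by (simp add: lessThan_atLeast0)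
  also have "(\<Sum>j=m..<m + m. f j) = (\<Sum>j<m. f (j + m))"
    using sum.shift_bounds_nat_ivl[of f 0 m m] by (simp add: lessThan_atLeast0)
  finally show ?thesis .
qed

lemma hadamard_matrix_rows:
  "i < 2 ^ k \<Longrightarrow> i' < 2 ^ k \<Longrightarrow>
    (\<Sum>j<2 ^ k. hadamard_matrix k $$ (i, j) * hadamard_matrix k $$ (i', j)) = (if i = i' then 2 ^ k else 0)"
proof (induction k arbitrary: i i')
  case (Suc k)
  obtain a where a: "a < 2 ^ k" "i = a \<or> i = a + 2 ^ k"
    by (rule split_index_double[OF Suc.prems(1)])
  obtain b where b: "b < 2 ^ k" "i' = b \<or> i' = b + 2 ^ k"
    by (rule split_index_double[OF Suc.prems(2)])
  have two: "(2 :: nat) ^ Suc k = 2 ^ k + 2 ^ k" by simp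
  show ?case
    unfolding two sum_lessThan_double
    using a b Suc.IH[OF a(1) b(1)]
    by (auto simp: hadamard_matrix_Suc_index sum_negf simp del: hadamard_matrix.simps)
qed auto

lemma flat_unitary_hadamard: "flat_unitary (2 ^ k) (unitary_hadamard k)"
proof -
  have c: "hadamard_matrix k \<in> carrier_mat (2 ^ k) (2 ^ k)" by (rule hadamard_matrix_carrier)
  have idx: "unitary_hadamard k $$ (i, j) = of_real (1 / sqrt (2 ^ k)) * hadamard_matrix k $$ (i, j)"
    if "i < 2 ^ k" "j < 2 ^ k" for i j
    using that c by (simp add: unitary_hadamard_def)
  have e: "cmod (hadamard_matrix k $$ (i, j)) = 1" "cnj (hadamard_matrix k $$ (i, j)) = hadamard_matrix k $$ (i, j)"
    if "i < 2 ^ k" "j < 2 ^ k" for i j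
    using hadamard_matrix_entries[OF that] by auto
  show ?thesis
    unfolding flat_unitary_def
  proof (intro conjI allI impI)
    show "unitary_hadamard k \<in> carrier_mat (2 ^ k) (2 ^ k)" using c by (simp add: unitary_hadamard_def)
  next
    fix i j :: nat assume "i < 2 ^ k" "j < 2 ^ k"
    then show "(cmod (unitary_hadamard k $$ (i, j)))\<^sup>2 = 1 / real (2 ^ k)"
      by (simp add: idx norm_mult norm_divide e power_divide)
  next
    fix i i' :: nat assume i: "i < 2 ^ k" "i' < 2 ^ k"
    have "(\<Sum>j<2 ^ k. unitary_hadamard k $$ (i, j) * cnj (unitary_hadamard k $$ (i', j)))
        = (\<Sum>j<2 ^ k. of_real (1 / 2 ^ k) * (hadamard_matrix k $$ (i, j) * hadamard_matrix k $$ (i', j)))"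
    proof (intro sum.cong refl)
      fix j :: nat assume "j \<in> {..<2 ^ k}"
      then have j: "j < 2 ^ k" by simp
      have "complex_of_real (1 / sqrt (2 ^ k)) * complex_of_real (1 / sqrt (2 ^ k)) = of_real (1 / 2 ^ k)"
        unfolding of_real_mult[symmetric] by simp
      then show "unitary_hadamard k $$ (i, j) * cnj (unitary_hadamard k $$ (i', j))
        = of_real (1 / 2 ^ k) * (hadamard_matrix k $$ (i, j) * hadamard_matrix k $$ (i', j))"
        unfolding idx[OF i(1) j] idx[OF i(2) j] complex_cnj_mult complex_cnj_complex_of_real e(2)[OF i(2) j]
        by (simp only: mult_ac)
    qed
    also have "\<dots> = of_bool (i = i')"
      unfolding sum_distrib_left[symmetric] hadamard_matrix_rows[OF i] by simp
    finally show "(\<Sum>j<2 ^ k. unitary_hadamard k $$ (i, j) * cnj (unitary_hadamard k $$ (i', j))) = of_bool (i = i')" .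
  qed
qed

lemma flat_unitary_dft:
  assumes "0 < n"
  shows "flat_unitary n (unitary_dft n)"
proof -
  define om where "om = exp (2 * of_real pi * \<i> / of_nat n)"
  have om: "cmod om = 1" by (simp add: om_def)
  have ompow: "om ^ j = exp (2 * of_real pi * \<i> * of_nat j / of_nat n)" for j
    unfolding om_def exp_of_nat_mult[symmetric] by (simp add: mult_ac)
  have omn: "om ^ n = 1" unfolding ompow using complex_root_unity_eq_1[of n n] assms by simp
  have idx: "unitary_dft n $$ (i, j) = of_real (1 / sqrt (real n)) * om ^ (i * j)" if "i < n" "j < n" for i j
    using that by (simp add: unitary_dft_def dft_matrix_def om_def)
  show ?thesis
    unfolding flat_unitary_def
  proof (intro conjI allI impI)
    show "unitary_dft n \<in> carrier_mat n n" by (simp add: unitary_dft_def dft_matrix_def)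
  next
    fix i j assume "i < n" "j < n"
    then show "(cmod (unitary_dft n $$ (i, j)))\<^sup>2 = 1 / real n"
      by (simp add: idx norm_mult norm_divide norm_power om power_divide)
  next
    fix i k assume i: "i < n" "k < n"
    define z where "z = om ^ i * cnj (om ^ k)"
    have ck: "om ^ k * cnj (om ^ k) = 1"
      unfolding complex_norm_square[symmetric] by (simp add: norm_power om)
    have zn: "z ^ n = 1"
      by (simp add: z_def power_mult_distrib power_mult[symmetric] mult.commute[of _ n])
         (simp add: power_mult omn flip: complex_cnj_power)
    have "(\<Sum>j<n. unitary_dft n $$ (i, j) * cnj (unitary_dft n $$ (k, j)))
        = (\<Sum>j<n. of_real (1 / real n) * z ^ j)"
    proof (intro sum.cong refl)
      fix j assume "j \<in> {..<n}"
      then have j: "j < n" by simp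
      have s: "complex_of_real (1 / sqrt (real n)) * complex_of_real (1 / sqrt (real n)) = of_real (1 / real n)"
        unfolding of_real_mult[symmetric] by simp
      have "z ^ j = om ^ (i * j) * cnj (om ^ (k * j))"
        by (simp add: z_def power_mult_distrib power_mult)
      with s show "unitary_dft n $$ (i, j) * cnj (unitary_dft n $$ (k, j)) = of_real (1 / real n) * z ^ j"
        unfolding idx[OF i(1) j] idx[OF i(2) j] complex_cnj_mult complex_cnj_complex_of_real
        by (simp only: mult_ac)
    qed
    also have "\<dots> = of_real (1 / real n) * (\<Sum>j<n. z ^ j)" by (simp only: sum_distrib_left)
    also have "\<dots> = of_bool (i = k)"
    proof (cases "i = k")
      case True
      then have "z = 1" using ck by (simp add: z_def)
      with True assms show ?thesis by simp
    next
      case False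
      have "z \<noteq> 1"
      proof
        assume "z = 1"
        then have "om ^ i = om ^ k" using ck unfolding z_def
          by (metis mult.assoc mult.commute mult.right_neutral)
        then show False
          using False i assms complex_root_unity_eq[of n i k] by (simp add: ompow)
      qed
      then have "(\<Sum>j<n. z ^ j) = 0" using zn by (simp add: geometric_sum)
      with False show ?thesis by simp
    qed
    finally show "(\<Sum>j<n. unitary_dft n $$ (i, j) * cnj (unitary_dft n $$ (k, j))) = of_bool (i = k)" .
  qed
qed

lemma flat_unitary_base:
  assumes "is_srht_base n F \<or> is_srft_base n F" "0 < n"
  shows "flat_unitary n F"
  using assms flat_unitary_dft flat_unitary_hadamard by (auto simp: is_srht_base_def is_srft_base_def)

lemma flat_unitaryD:
  assumes "flat_unitary n F"
  shows "F \<in> carrier_mat n n"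
    and "i < n \<Longrightarrow> j < n \<Longrightarrow> (cmod (F $$ (i, j)))\<^sup>2 = 1 / real n"
    and "i < n \<Longrightarrow> k < n \<Longrightarrow> (\<Sum>j<n. F $$ (i, j) * cnj (F $$ (k, j))) = of_bool (i = k)"
  using assms by (auto simp: flat_unitary_def)

lemma flat_unitary_isometry:
  assumes F: "flat_unitary n F"
  shows "(\<Sum>j<n. (cmod (\<Sum>k<n. cnj (F $$ (k, j)) * q k))\<^sup>2) = (\<Sum>k<n. (cmod (q k))\<^sup>2)"
proof -
  have "complex_of_real (\<Sum>j<n. (cmod (\<Sum>k<n. cnj (F $$ (k, j)) * q k))\<^sup>2)
      = (\<Sum>j<n. (\<Sum>k<n. cnj (F $$ (k, j)) * q k) * cnj (\<Sum>k<n. cnj (F $$ (k, j)) * q k))"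
    by (simp only: of_real_sum complex_norm_square)
  also have "\<dots> = (\<Sum>j<n. \<Sum>k<n. \<Sum>k'<n. (F $$ (k', j) * cnj (F $$ (k, j))) * (q k * cnj (q k')))"
    by (simp add: sum_product mult_ac)
  also have "\<dots> = (\<Sum>k<n. \<Sum>j<n. \<Sum>k'<n. (F $$ (k', j) * cnj (F $$ (k, j))) * (q k * cnj (q k')))"
    by (rule sum.swap)
  also have "\<dots> = (\<Sum>k<n. \<Sum>k'<n. \<Sum>j<n. (F $$ (k', j) * cnj (F $$ (k, j))) * (q k * cnj (q k')))"
    by (intro sum.cong refl sum.swap)
  also have "\<dots> = (\<Sum>k<n. \<Sum>k'<n. of_bool (k' = k) * (q k * cnj (q k')))"
    unfolding sum_distrib_right[symmetric]
    by (intro sum.cong refl) (simp add: flat_unitaryD(3)[OF F])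
  also have "\<dots> = (\<Sum>k<n. q k * cnj (q k))"
    by (intro sum.cong refl) (simp add: sum_of_bool_mult)
  also have "\<dots> = of_real (\<Sum>k<n. (cmod (q k))\<^sup>2)"
    by (simp only: of_real_sum complex_norm_square)
  finally show ?thesis by (simp only: of_real_eq_iff)
qed

section \<open>Mixing by a diagonal of random phases\<close>

text \<open>Column \<open>j\<close> of \<open>V D F\<close>, where \<open>V\<close> is the matrix with columns \<open>V k\<close>.\<close>

definition mixed_column ::
  "nat \<Rightarrow> complex mat \<Rightarrow> (nat \<Rightarrow> nat \<Rightarrow> complex) \<Rightarrow> (nat \<Rightarrow> complex) \<Rightarrow> nat \<Rightarrow> nat \<Rightarrow> complex" where
  "mixed_column n F V d j = (\<lambda>i. \<Sum>k<n. (d k * F $$ (k, j)) * V k i)"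

lemma ip_mixed_column:
  "ip r (mixed_column n F V d j) y = (\<Sum>k<n. cnj (F $$ (k, j)) * (cnj (d k) * ip r (V k) y))"
  unfolding mixed_column_def ip_sum_left by (simp add: mult_ac)

lemma tight_frame_mixed:
  assumes F: "flat_unitary n F" and V: "tight_frame r n V" and d: "\<And>k. k < n \<Longrightarrow> cmod (d k) = 1"
  shows "tight_frame r n (mixed_column n F V d)"
  unfolding tight_frame_def ip_mixed_column flat_unitary_isometry[OF F]
  using V d by (simp add: tight_frame_def norm_mult)

lemma tight_frame_scaled_entries:
  assumes V: "tight_frame r n V" and "\<And>k. k < n \<Longrightarrow> cmod (c k) = 1"
  shows "tight_frame r n (\<lambda>k i. c k * V k i)"
proof -
  have "ip r (\<lambda>i. c k * V k i) y = cnj (c k) * ip r (V k) y" for k y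
    by (simp add: ip_def sum_distrib_left mult_ac)
  with assms show ?thesis by (simp add: tight_frame_def norm_mult)
qed

lemma tight_frame_permute:
  assumes "tight_frame r n x" "p permutes {..<n}"
  shows "tight_frame r n (\<lambda>k. x (p k))"
proof -
  have "(\<Sum>k<n. (cmod (ip r (x (p k)) y))\<^sup>2) = (\<Sum>k<n. (cmod (ip r (x k) y))\<^sup>2)" for y
    using sum.permute[OF assms(2), of "\<lambda>k. (cmod (ip r (x k) y))\<^sup>2"] by (simp add: o_def)
  with assms(1) show ?thesis by (simp add: tight_frame_def)
qed

lemma borel_measurable_mixed_column_nrm2 [measurable]:
  "(\<lambda>d. nrm2 r (mixed_column n F V d j)) \<in> borel_measurable (phases n)"
  unfolding nrm2_def mixed_column_def
  by (auto intro!: borel_measurable_sum borel_measurable_power borel_measurable_norm borel_measurable_times)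

text \<open>Outside an event of small probability all columns of \<open>V D F\<close> have squared length below this
  number divided by \<open>n\<close>; the sample size in the final statement is expressed through it.\<close>

definition row_norm_bound :: "nat \<Rightarrow> nat \<Rightarrow> real" where
  "row_norm_bound r n = (sqrt (real r) + sqrt (8 * ln (real r * real n)))\<^sup>2"

text \<open>Scaled by the square root of \<open>n\<close>, the entries of one column of the base matrix are themselves
  phases, so that the tail estimate for tight frames applies to each column.\<close>

lemma mixed_column_norm_tail:
  assumes F: "flat_unitary n F" and V: "tight_frame r n V" and "1 \<le> r" "0 < n" "j < n"
  shows "measure (phases n) {d \<in> space (phases n). row_norm_bound r n / real n \<le> nrm2 r (mixed_column n F V d j)}
    \<le> 1 / (real r * real n)"
proof -
  define c where "c = (\<lambda>k i. (of_real (sqrt (real n)) * F $$ (k, j)) * V k i)"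
  have "cmod (of_real (sqrt (real n)) * F $$ (k, j)) = 1" if "k < n" for k
  proof -
    have "(cmod (of_real (sqrt (real n)) * F $$ (k, j)))\<^sup>2 = 1"
      using flat_unitaryD(2)[OF F that assms(5)] assms(4) by (simp add: norm_mult power_mult_distrib)
    then show ?thesis by (simp add: power2_eq_1_iff) (metis norm_ge_zero not_one_le_zero neg_0_le_iff_le)
  qed
  then have c: "tight_frame r n c"
    unfolding c_def by (rule tight_frame_scaled_entries[OF V])
  have nrm: "nrm2 r (\<lambda>i. \<Sum>k<n. d k * c k i) = real n * nrm2 r (mixed_column n F V d j)" for d
  proof -
    have "(\<Sum>k<n. d k * c k i) = of_real (sqrt (real n)) * mixed_column n F V d j i" for i
      by (simp add: c_def mixed_column_def sum_distrib_left mult_ac)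
    then show ?thesis by (simp add: nrm2_def norm_mult power_mult_distrib sum_distrib_left)
  qed
  have rn: "1 \<le> real r * real n" using assms(3,4) by (metis One_nat_def Suc_leI mult_le_mono of_nat_1 of_nat_le_iff of_nat_mult mult_1)
  then have L: "0 \<le> ln (real r * real n)" by simp
  have "{d \<in> space (phases n). row_norm_bound r n / real n \<le> nrm2 r (mixed_column n F V d j)}
      = {d \<in> space (phases n). (sqrt (real r) + sqrt (8 * ln (real r * real n)))\<^sup>2 \<le> nrm2 r (\<lambda>i. \<Sum>k<n. d k * c k i)}"
    using assms(4) by (simp add: nrm row_norm_bound_def divide_le_eq mult.commute)
  also have "measure (phases n) \<dots> \<le> exp (- ((sqrt (8 * ln (real r * real n)))\<^sup>2))"
    using L by (intro phases_norm_tail[OF c assms(3)]) simp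
  (* the union bound over n columns needs only the first power of r n *)
  also have "\<dots> \<le> exp (- ln (real r * real n))" using L by simp
  also have "\<dots> = 1 / (real r * real n)" using rn by (simp add: exp_minus divide_inverse)
  finally show ?thesis .
qed

lemma row_norms_bad_event:
  assumes F: "flat_unitary n F" and V: "tight_frame r n V" and "1 \<le> r" "0 < n"
  defines "B \<equiv> {d \<in> space (phases n). \<exists>j<n. row_norm_bound r n / real n \<le> nrm2 r (mixed_column n F V d j)}"
  shows "B \<in> sets (phases n)" "measure (phases n) B \<le> 1 / real r"
proof -
  interpret UP: prob_space "phases n" by (intro prob_space_PiM prob_space_uniform_circle)
  define S where "S = (\<lambda>j. {d \<in> space (phases n). row_norm_bound r n / real n \<le> nrm2 r (mixed_column n F V d j)})"
  have S: "S j \<in> sets (phases n)" for j unfolding S_def by measurable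
  have B: "B = (\<Union>j\<in>{..<n}. S j)" by (auto simp: B_def S_def)
  show "B \<in> sets (phases n)" unfolding B using S by auto
  have "measure (phases n) B \<le> (\<Sum>j<n. measure (phases n) (S j))"
    unfolding B using S by (intro UP.finite_measure_subadditive_finite) auto
  also have "\<dots> \<le> (\<Sum>j<n. 1 / (real r * real n))"
    unfolding S_def by (intro sum_mono mixed_column_norm_tail[OF F V assms(3,4)]) auto
  also have "\<dots> = 1 / real r" using assms(4) by simp
  finally show "measure (phases n) B \<le> 1 / real r" .
qed

lemma adjoint_energy_ip:
  assumes "A \<in> carrier_mat r l"
  shows "adjoint_energy A y = (\<Sum>k<l. (cmod (ip r (\<lambda>a. A $$ (a, k)) y))\<^sup>2)"
  using assms by (simp add: adjoint_energy_def ip_def)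

section \<open>Measurability and conditioning\<close>

text \<open>A condition on all vectors is an uncountable intersection of events; a countable set that is
  dense in the first \<open>r\<close> coordinates reduces it to a countable one.\<close>

lemma countable_dense_vectors:
  obtains Y :: "(nat \<Rightarrow> complex) set" where "countable Y"
    "\<And>y. \<exists>f. (\<forall>m. f m \<in> Y) \<and> (\<forall>i<r. (\<lambda>m. f m i) \<longlonglongrightarrow> y i)"
proof -
  obtain D :: "complex set" where D: "countable D" "\<And>X. open X \<Longrightarrow> X \<noteq> {} \<Longrightarrow> \<exists>d\<in>D. d \<in> X"
    using countable_dense_exists by blast
  define Y where "Y = (\<lambda>L i. L ! i) ` lists D"
  have "countable Y" unfolding Y_def by (intro countable_image countable_lists D(1))
  moreover have "\<exists>f. (\<forall>m. f m \<in> Y) \<and> (\<forall>i<r. (\<lambda>m. f m i) \<longlonglongrightarrow> y i)" for y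
  proof -
    define g where "g = (\<lambda>m i. SOME d. d \<in> D \<and> dist d (y i) < 1 / real (Suc m))"
    have "g m i \<in> D \<and> dist (g m i) (y i) < 1 / real (Suc m)" for m i
      unfolding g_def
    proof (rule someI_ex)
      show "\<exists>d. d \<in> D \<and> dist d (y i) < 1 / real (Suc m)"
        using D(2)[of "ball (y i) (1 / real (Suc m))"] by (auto simp: dist_commute)
    qed
    then have g: "\<And>m i. g m i \<in> D" "\<And>m i. dist (g m i) (y i) < 1 / real (Suc m)" by blast+
    define f where "f = (\<lambda>m i. map (g m) [0..<r] ! i)"
    have "f m \<in> Y" for m unfolding Y_def f_def using g(1) by (intro imageI) auto
    moreover have "(\<lambda>m. f m i) \<longlonglongrightarrow> y i" if "i < r" for i
    proof -
      have "(\<lambda>m. dist (g m i) (y i)) \<longlonglongrightarrow> 0"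
      proof (rule tendsto_sandwich[of "\<lambda>_. 0" _ _ "\<lambda>m. inverse (real (Suc m))"])
        show "\<forall>\<^sub>F m in sequentially. dist (g m i) (y i) \<le> inverse (real (Suc m))"
          using g(2) by (intro always_eventually allI less_imp_le) (simp only: inverse_eq_divide)
        show "(\<lambda>m. inverse (real (Suc m))) \<longlonglongrightarrow> 0" by (rule LIMSEQ_inverse_real_of_nat)
      qed simp_all
      then have "(\<lambda>m. g m i) \<longlonglongrightarrow> y i" by (rule tendsto_dist_iff[THEN iffD2])
      with that show ?thesis by (simp add: f_def)
    qed
    ultimately show ?thesis by blast
  qed
  ultimately show thesis by (rule that)
qed

lemma tendsto_nrm2: "(\<And>i. i < r \<Longrightarrow> (\<lambda>m. f m i) \<longlonglongrightarrow> y i) \<Longrightarrow> (\<lambda>m. nrm2 r (f m)) \<longlonglongrightarrow> nrm2 r y"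
  unfolding nrm2_def by (intro tendsto_intros) auto

lemma tendsto_ip: "(\<And>i. i < r \<Longrightarrow> (\<lambda>m. f m i) \<longlonglongrightarrow> y i) \<Longrightarrow> (\<lambda>m. ip r x (f m)) \<longlonglongrightarrow> ip r x y"
  unfolding ip_def by (intro tendsto_intros) auto

lemma quadratic_inequality_on_dense:
  assumes dense: "\<And>y. \<exists>f. (\<forall>m. f m \<in> Y) \<and> (\<forall>i<r. (\<lambda>m. f m i) \<longlonglongrightarrow> y i)"
    and A: "A \<in> carrier_mat r l"
  shows "(\<forall>y. adjoint_energy A y \<le> c * nrm2 r y) \<longleftrightarrow> (\<forall>y\<in>Y. adjoint_energy A y \<le> c * nrm2 r y)"
    and "(\<forall>y. c * nrm2 r y \<le> adjoint_energy A y) \<longleftrightarrow> (\<forall>y\<in>Y. c * nrm2 r y \<le> adjoint_energy A y)"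
proof -
  have lim: "\<exists>f. (\<forall>m. f m \<in> Y) \<and> (\<lambda>m. adjoint_energy A (f m)) \<longlonglongrightarrow> adjoint_energy A y
      \<and> (\<lambda>m. c * nrm2 r (f m)) \<longlonglongrightarrow> c * nrm2 r y" for y
  proof -
    obtain f where f: "\<And>m. f m \<in> Y" "\<And>i. i < r \<Longrightarrow> (\<lambda>m. f m i) \<longlonglongrightarrow> y i"
      using dense[of y] by blast
    have "(\<lambda>m. adjoint_energy A (f m)) \<longlonglongrightarrow> adjoint_energy A y"
      unfolding adjoint_energy_ip[OF A] by (intro tendsto_sum tendsto_power tendsto_norm tendsto_ip f(2))
    moreover have "(\<lambda>m. c * nrm2 r (f m)) \<longlonglongrightarrow> c * nrm2 r y"
      by (intro tendsto_mult tendsto_const tendsto_nrm2 f(2))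
    ultimately show ?thesis using f(1) by blast
  qed
  show "(\<forall>y. adjoint_energy A y \<le> c * nrm2 r y) \<longleftrightarrow> (\<forall>y\<in>Y. adjoint_energy A y \<le> c * nrm2 r y)"
  proof (intro iffI allI ballI)
    fix y assume H: "\<forall>y\<in>Y. adjoint_energy A y \<le> c * nrm2 r y"
    obtain f where f: "\<And>m. f m \<in> Y" "(\<lambda>m. adjoint_energy A (f m)) \<longlonglongrightarrow> adjoint_energy A y"
      "(\<lambda>m. c * nrm2 r (f m)) \<longlonglongrightarrow> c * nrm2 r y" using lim[of y] by blast
    show "adjoint_energy A y \<le> c * nrm2 r y"
      by (rule LIMSEQ_le[OF f(2,3)]) (use H f(1) in auto)
  qed blast
  show "(\<forall>y. c * nrm2 r y \<le> adjoint_energy A y) \<longleftrightarrow> (\<forall>y\<in>Y. c * nrm2 r y \<le> adjoint_energy A y)"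
  proof (intro iffI allI ballI)
    fix y assume H: "\<forall>y\<in>Y. c * nrm2 r y \<le> adjoint_energy A y"
    obtain f where f: "\<And>m. f m \<in> Y" "(\<lambda>m. adjoint_energy A (f m)) \<longlonglongrightarrow> adjoint_energy A y"
      "(\<lambda>m. c * nrm2 r (f m)) \<longlonglongrightarrow> c * nrm2 r y" using lim[of y] by blast
    show "c * nrm2 r y \<le> adjoint_energy A y"
      by (rule LIMSEQ_le[OF f(3,2)]) (use H f(1) in auto)
  qed blast
qed

lemma measurable_singular_value_bounds:
  assumes A: "\<And>d. A d \<in> carrier_mat r l" and "1 \<le> r" "r \<le> l" and c: "0 \<le> c" "0 \<le> c'"
    and meas: "\<And>i k. i < r \<Longrightarrow> k < l \<Longrightarrow> (\<lambda>d. A d $$ (i, k)) \<in> borel_measurable M"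
  shows "{d \<in> space M. \<not> (c \<le> singular_value r (A d) \<and> singular_value 1 (A d) \<le> c')} \<in> sets M"
proof -
  obtain Y :: "(nat \<Rightarrow> complex) set" where Y: "countable Y"
    "\<And>y. \<exists>f. (\<forall>m. f m \<in> Y) \<and> (\<forall>i<r. (\<lambda>m. f m i) \<longlonglongrightarrow> y i)"
    using countable_dense_vectors by blast
  have "Y \<noteq> {}" using Y(2) by blast
  then have Yseq: "(\<forall>y\<in>Y. Q y) \<longleftrightarrow> (\<forall>m. Q (from_nat_into Y m))" for Q
    using range_from_nat_into[OF _ Y(1)] by (metis imageE rangeI)
  have cmod: "cmod \<in> borel_measurable borel"
    by (intro borel_measurable_continuous_onI continuous_intros)
  have cnj: "cnj \<in> borel_measurable borel"
    by (intro borel_measurable_continuous_onI continuous_intros)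
  have [measurable]: "(\<lambda>d. adjoint_energy (A d) y) \<in> borel_measurable M" for y
    unfolding adjoint_energy_ip[OF A] ip_def
    by (auto intro!: borel_measurable_sum borel_measurable_power borel_measurable_times
        measurable_compose[OF _ cmod] measurable_compose[OF meas cnj])
  have "{d \<in> space M. c \<le> singular_value r (A d) \<and> singular_value 1 (A d) \<le> c'}
      = {d \<in> space M. (\<forall>y\<in>Y. c\<^sup>2 * nrm2 r y \<le> adjoint_energy (A d) y) \<and> (\<forall>y\<in>Y. adjoint_energy (A d) y \<le> c'\<^sup>2 * nrm2 r y)}"
    unfolding singular_value_bounds_iff[OF A assms(2,3) c(1)] singular_value_bounds_iff[OF A assms(2,3) c(2)]
      quadratic_inequality_on_dense[OF Y(2) A] ..
  also have "\<dots> \<in> sets M"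
    unfolding Yseq by measurable
  finally have "space M - {d \<in> space M. c \<le> singular_value r (A d) \<and> singular_value 1 (A d) \<le> c'} \<in> sets M"
    by (rule sets.compl_sets)
  also have "space M - {d \<in> space M. c \<le> singular_value r (A d) \<and> singular_value 1 (A d) \<le> c'}
      = {d \<in> space M. \<not> (c \<le> singular_value r (A d) \<and> singular_value 1 (A d) \<le> c')}" by auto
  finally show ?thesis .
qed

abbreviation sampling_space :: "nat \<Rightarrow> nat \<Rightarrow> ((nat \<Rightarrow> nat) \<times> nat list) measure" where
  "sampling_space n l \<equiv>
     uniform_count_measure {p. p permutes {..<n}} \<Otimes>\<^sub>M uniform_count_measure (samples n l)"

lemma transform_space_alt: "transform_space n l = phases n \<Otimes>\<^sub>M sampling_space n l"
  by (simp add: transform_space_def)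

lemma space_sampling_space: "space (sampling_space n l) = {p. p permutes {..<n}} \<times> samples n l"
  by (simp add: space_pair_measure space_uniform_count_measure)

text \<open>Permutation and sample take finitely many values.\<close>

lemma measurable_transform_space_slices:
  assumes "\<And>p ks. p permutes {..<n} \<Longrightarrow> ks \<in> samples n l \<Longrightarrow> {d \<in> space (phases n). P (d, p, ks)} \<in> sets (phases n)"
  shows "{\<omega> \<in> space (transform_space n l). P \<omega>} \<in> sets (transform_space n l)"
proof -
  have fin: "finite ({p. p permutes {..<n}} \<times> samples n l)"
    by (intro finite_cartesian_product finite_permutations finite_samples) simp
  have "{\<omega> \<in> space (transform_space n l). P \<omega>}
      = (\<Union>q\<in>{p. p permutes {..<n}} \<times> samples n l. {d \<in> space (phases n). P (d, q)} \<times> {q})"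
    unfolding transform_space_alt space_pair_measure[of "phases n"] space_sampling_space by auto
  also have "\<dots> \<in> sets (transform_space n l)"
  proof (rule sets.finite_UN[OF fin])
    fix q assume q: "q \<in> {p. p permutes {..<n}} \<times> samples n l"
    have "{fst q} \<times> {snd q} \<in> sets (sampling_space n l)"
      using q by (intro pair_measureI) (auto simp: sets_uniform_count_measure)
    then have "{q} \<in> sets (sampling_space n l)" by simp
    then show "{d \<in> space (phases n). P (d, q)} \<times> {q} \<in> sets (transform_space n l)"
      unfolding transform_space_alt using q assms by (intro pair_measureI) auto
  qed
  finally show ?thesis .
qed

lemma emeasure_sampling_space_le:
  assumes S: "S \<in> sets (sampling_space n l)" and "l \<le> n" "0 \<le> c"
    and bound: "\<And>p. p permutes {..<n} \<Longrightarrow>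
      real (card {ks \<in> samples n l. (p, ks) \<in> S}) \<le> c * real (card (samples n l))"
  shows "emeasure (sampling_space n l) S \<le> ennreal c"
proof -
  let ?P = "{p. p permutes {..<n}}"
  have "[0..<l] \<in> samples n l"
    using assms(2) by (auto simp: samples_def)
  then have ne: "samples n l \<noteq> {}" by blast
  interpret Sm: prob_space "uniform_count_measure (samples n l)"
    using finite_samples ne by (intro prob_space_uniform_count_measure)
  have "id \<in> ?P" by (simp add: permutes_id)
  then interpret Pm: prob_space "uniform_count_measure ?P"
    by (intro prob_space_uniform_count_measure finite_permutations) blast+
  have card: "real (card (samples n l)) > 0" using finite_samples ne by (simp add: card_gt_0_iff)
  have "emeasure (sampling_space n l) S
      = (\<integral>\<^sup>+p. emeasure (uniform_count_measure (samples n l)) (Pair p -` S) \<partial>uniform_count_measure ?P)"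
    by (rule Sm.emeasure_pair_measure_alt[OF S])
  also have "\<dots> \<le> (\<integral>\<^sup>+p. ennreal c \<partial>uniform_count_measure ?P)"
  proof (rule nn_integral_mono)
    fix p assume "p \<in> space (uniform_count_measure ?P)"
    then have p: "p permutes {..<n}" by (simp add: space_uniform_count_measure)
    have "Pair p -` S \<subseteq> samples n l"
      using sets.sets_into_space[OF S] by (auto simp: space_sampling_space)
    then have eq: "Pair p -` S = {ks \<in> samples n l. (p, ks) \<in> S}" by auto
    then have "emeasure (uniform_count_measure (samples n l)) (Pair p -` S)
        = ennreal (real (card {ks \<in> samples n l. (p, ks) \<in> S}) / real (card (samples n l)))"
      by (subst emeasure_uniform_count_measure) (auto simp: finite_samples divide_ennreal card
          simp flip: ennreal_of_nat_eq_real_of_nat)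
    also have "\<dots> \<le> ennreal c"
      using bound[OF p] card by (intro ennreal_leI) (simp add: divide_le_eq)
    finally show "emeasure (uniform_count_measure (samples n l)) (Pair p -` S) \<le> ennreal c" .
  qed
  also have "\<dots> = ennreal c" by (simp add: Pm.emeasure_space_1)
  finally show ?thesis .
qed

text \<open>Conditioning on the phases: outside the exceptional event \<open>B\<close> the failure probability is
  governed by the sample alone, for every fixed permutation.\<close>

lemma measure_transform_space_le:
  assumes X: "X \<in> sets (transform_space n l)" and "l \<le> n" "0 \<le> c"
    and B: "B \<in> sets (phases n)" "measure (phases n) B \<le> e"
    and bound: "\<And>d p. d \<in> space (phases n) \<Longrightarrow> d \<notin> B \<Longrightarrow> \<forall>k<n. cmod (d k) = 1 \<Longrightarrow> p permutes {..<n} \<Longrightarrow>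
      real (card {ks \<in> samples n l. (d, p, ks) \<in> X}) \<le> c * real (card (samples n l))"
  shows "measure (transform_space n l) X \<le> e + c"
proof -
  interpret T: prob_space "transform_space n l" by (rule prob_space_transform_space[OF assms(2)])
  interpret UP: prob_space "phases n" by (intro prob_space_PiM prob_space_uniform_circle)
  have "[0..<l] \<in> samples n l" "id \<in> {p. p permutes {..<n}}"
    using assms(2) by (auto simp: samples_def permutes_id)
  then interpret S: prob_space "sampling_space n l"
    by (intro prob_space_pair prob_space_uniform_count_measure finite_samples finite_permutations) blast+
  have e: "0 \<le> e" using B(2) measure_nonneg order_trans by blast
  have "emeasure (transform_space n l) X = (\<integral>\<^sup>+d. emeasure (sampling_space n l) (Pair d -` X) \<partial>phases n)"
    using X unfolding transform_space_alt by (rule S.emeasure_pair_measure_alt)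
  also have "\<dots> \<le> (\<integral>\<^sup>+d. indicator B d + ennreal c \<partial>phases n)"
  proof (rule nn_integral_mono_AE)
    show "AE d in phases n. emeasure (sampling_space n l) (Pair d -` X) \<le> indicator B d + ennreal c"
      using AE_phases_unit AE_space
    proof eventually_elim
      case (elim d)
      show ?case
      proof (cases "d \<in> B")
        case True
        have "emeasure (sampling_space n l) (Pair d -` X) \<le> 1" by (rule S.emeasure_le_1)
        also have "\<dots> \<le> 1 + ennreal c" by simp
        finally show ?thesis using True by simp
      next
        case False
        have "Pair d -` X \<in> sets (sampling_space n l)"
          using X unfolding transform_space_alt by (rule sets_Pair1)
        then have "emeasure (sampling_space n l) (Pair d -` X) \<le> ennreal c"
          by (rule emeasure_sampling_space_le) (use assms(2,3) bound[OF elim(2) False elim(1)] in auto)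
        with False show ?thesis by simp
      qed
    qed
  qed
  also have "\<dots> = emeasure (phases n) B + ennreal c"
    using B(1) by (subst nn_integral_add) (auto simp: UP.emeasure_space_1)
  also have "\<dots> \<le> ennreal e + ennreal c"
    using B(2) by (intro add_right_mono) (simp add: UP.emeasure_eq_measure ennreal_leI)
  finally have "ennreal (measure (transform_space n l) X) \<le> ennreal (e + c)"
    using e assms(3) by (simp add: T.emeasure_eq_measure)
  then show ?thesis using e assms(3) by (subst (asm) ennreal_le_iff) auto
qed

section \<open>Reduction to a tight frame and conclusion\<close>

text \<open>In an eigenbasis of \<open>W W\<^sup>*\<close> the rows of \<open>W\<close> are orthogonal with lengths the singular values.
  Normalising them gives the matrix \<open>V\<close>, with orthonormal rows, and \<open>tr\<close> is the change of variables
  that undoes the normalisation; it distorts squared lengths by squares of singular values.\<close>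

lemma whitening:
  assumes W: "W \<in> carrier_mat r n" and r: "1 \<le> r" "r \<le> n" and pos: "0 < singular_value r W"
  shows "\<exists>V tr. tight_frame r n V \<and>
    (\<forall>k y. ip r (\<lambda>a. W $$ (a, k)) y = ip r (V k) (tr y)) \<and>
    (\<forall>y. (singular_value r W)\<^sup>2 * nrm2 r y \<le> nrm2 r (tr y)) \<and>
    (\<forall>y. nrm2 r (tr y) \<le> (singular_value 1 W)\<^sup>2 * nrm2 r y)"
proof -
  define w where "w = (\<lambda>k a. W $$ (a, k))"
  obtain lam u where sb: "spectral_basis r (\<lambda>a b. \<Sum>k<n. w k a * cnj (w k b)) lam u"
    using hermitian_spectral[OF hermitian_gram[of r w "{..<n}"]] by blast
  then have ob: "orthonormal_basis r u" by (simp add: spectral_basis_def)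
  note ext = singular_value_extremes[OF W r sb[unfolded w_def]]
  have lam0: "0 \<le> lam i" if "i < r" for i
    using spectral_gram_nonneg(2)[OF sb that] .
  have lo: "(singular_value r W)\<^sup>2 \<le> lam i" if "i < r" for i
  proof -
    have "(singular_value r W)\<^sup>2 \<le> (sqrt (lam i))\<^sup>2"
      using ext(4)[OF that] pos by (intro power_mono) auto
    with lam0[OF that] show ?thesis by simp
  qed
  have hi: "lam i \<le> (singular_value 1 W)\<^sup>2" if "i < r" for i
    using ext(2)[OF that] by (rule sqrt_le_D)
  have lampos: "0 < lam i" if "i < r" for i
    using lo[OF that] pos by (meson less_le_trans zero_less_power)
  define V where "V = (\<lambda>k i. ip r (u i) (w k) / of_real (sqrt (lam i)))"
  define tr where "tr = (\<lambda>y i. of_real (sqrt (lam i)) * ip r (u i) y)"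
  have frame: "tight_frame r n V"
    unfolding tight_frame_def
  proof
    fix y
    define z where "z = (\<lambda>a. \<Sum>i<r. (y i / of_real (sqrt (lam i))) * u i a)"
    have "ip r (V k) y = ip r (w k) z" for k
    proof -
      have "ip r (w k) z = (\<Sum>i<r. (y i / of_real (sqrt (lam i))) * ip r (w k) (u i))"
        unfolding z_def by (rule ip_sum_right)
      then show ?thesis unfolding ip_def[of r "V k"] by (simp add: V_def cnj_ip mult_ac)
    qed
    then have "(\<Sum>k<n. (cmod (ip r (V k) y))\<^sup>2) = (\<Sum>k<n. (cmod (ip r (w k) z))\<^sup>2)" by simp
    also have "\<dots> = (\<Sum>i<r. lam i * (cmod (ip r (u i) z))\<^sup>2)"
      by (rule spectral_gram_energy[OF sb])
    also have "\<dots> = (\<Sum>i<r. (cmod (y i))\<^sup>2)"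
    proof (intro sum.cong refl)
      fix i assume "i \<in> {..<r}"
      then have i: "i < r" by simp
      have "ip r (u i) z = (\<Sum>j<r. (y j / of_real (sqrt (lam j))) * ip r (u i) (u j))"
        unfolding z_def by (rule ip_sum_right)
      also have "\<dots> = (\<Sum>j<r. of_bool (i = j) * (y j / of_real (sqrt (lam j))))"
        using i by (intro sum.cong refl) (simp add: orthonormal_basisD(1)[OF ob])
      also have "\<dots> = y i / of_real (sqrt (lam i))" using i by (simp only: sum_of_bool_mult)
      finally show "lam i * (cmod (ip r (u i) z))\<^sup>2 = (cmod (y i))\<^sup>2"
        using lampos[OF i] by (simp add: norm_divide power_divide)
    qed
    finally show "(\<Sum>k<n. (cmod (ip r (V k) y))\<^sup>2) = nrm2 r y" by (simp add: nrm2_def)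
  qed
  have fact: "ip r (w k) y = ip r (V k) (tr y)" for k y
  proof -
    have "ip r (V k) (tr y) = (\<Sum>i<r. ip r (w k) (u i) * ip r (u i) y)"
      unfolding ip_def[of r "V k"]
    proof (intro sum.cong refl)
      fix i assume "i \<in> {..<r}"
      then have "lam i > 0" using lampos by simp
      then show "cnj (V k i) * tr y i = ip r (w k) (u i) * ip r (u i) y"
        by (simp add: V_def tr_def cnj_ip)
    qed
    then show ?thesis by (simp add: parseval[OF ob, of "w k" y])
  qed
  have nt: "nrm2 r (tr y) = (\<Sum>i<r. lam i * (cmod (ip r (u i) y))\<^sup>2)" for y
    unfolding nrm2_def
  proof (intro sum.cong refl)
    fix i assume "i \<in> {..<r}"
    then have "lam i \<ge> 0" using lam0 by simp
    then show "(cmod (tr y i))\<^sup>2 = lam i * (cmod (ip r (u i) y))\<^sup>2"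
      by (simp add: tr_def norm_mult power_mult_distrib)
  qed
  show ?thesis
  proof (intro exI[of _ V] exI[of _ tr] conjI allI frame)
    show "ip r (\<lambda>a. W $$ (a, k)) y = ip r (V k) (tr y)" for k y
      using fact[of k y] by (simp add: w_def)
    show "(singular_value r W)\<^sup>2 * nrm2 r y \<le> nrm2 r (tr y)" for y
      unfolding nt unfolding parseval_nrm2[OF ob] sum_distrib_left by (intro sum_mono mult_right_mono lo) auto
    show "nrm2 r (tr y) \<le> (singular_value 1 W)\<^sup>2 * nrm2 r y" for y
      unfolding nt unfolding parseval_nrm2[OF ob] sum_distrib_left by (intro sum_mono mult_right_mono hi) auto
  qed
qed

lemma mat_mult_index:
  assumes "X \<in> carrier_mat m n" "Y \<in> carrier_mat n q" "i < m" "j < q"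
  shows "(X * Y) $$ (i, j) = (\<Sum>k<n. X $$ (i, k) * Y $$ (k, j))"
  using assms by (simp add: scalar_prod_def lessThan_atLeast0)

lemma subsampled_transform_index:
  assumes F: "F \<in> carrier_mat n n" and p: "p permutes {..<n}" and ks: "ks \<in> samples n l"
    and "k < n" "t < l"
  shows "subsampled_transform F n l (d, p, ks) $$ (k, t)
    = of_real (sqrt (real n / real l)) * (d k * F $$ (k, p (ks ! t)))"
proof -
  have len: "length ks = l" and kt: "ks ! t < n"
    using ks assms(5) by (auto simp: samples_def subset_iff)
  have pt: "p (ks ! t) < n" using permutes_in_image[OF p, of "ks ! t"] kt by simp
  have P: "permutation_matrix n p \<in> carrier_mat n n" by (simp add: permutation_matrix_def)
  have D: "mat_diag n d \<in> carrier_mat n n" by (simp add: mat_diag_def)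
  have DF: "mat_diag n d * F \<in> carrier_mat n n" by (rule mult_carrier_mat[OF D F])
  have "(mat_diag n d * F * permutation_matrix n p) $$ (k, ks ! t)
      = (\<Sum>m<n. (mat_diag n d * F) $$ (k, m) * (if m = p (ks ! t) then 1 else 0))"
  proof -
    have "(mat_diag n d * F * permutation_matrix n p) $$ (k, ks ! t)
        = (\<Sum>m<n. (mat_diag n d * F) $$ (k, m) * permutation_matrix n p $$ (m, ks ! t))"
      by (rule mat_mult_index[OF DF P assms(4) kt])
    then show ?thesis using kt by (simp add: permutation_matrix_def)
  qed
  also have "\<dots> = (\<Sum>m<n. if m = p (ks ! t) then (mat_diag n d * F) $$ (k, m) else 0)"
    by (intro sum.cong) auto
  also have "\<dots> = (mat_diag n d * F) $$ (k, p (ks ! t))" using pt by simp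
  also have "\<dots> = d k * F $$ (k, p (ks ! t))"
    using F assms(4) pt by (simp add: mat_diag_mult_left[OF F] del: index_mult_mat)
  finally have entry: "(mat_diag n d * F * permutation_matrix n p) $$ (k, ks ! t) = d k * F $$ (k, p (ks ! t))" .
  define Q where "Q = mat_diag n d * F * permutation_matrix n p"
  have Q: "Q \<in> carrier_mat n n" unfolding Q_def by (rule mult_carrier_mat[OF DF P])
  show ?thesis
    using len kt assms(4,5) Q entry[folded Q_def]
    unfolding subsampled_transform_def split_conv Q_def[symmetric] by (simp add: mat_of_cols_index)
qed

lemma subsampled_transform_carrier:
  "ks \<in> samples n l \<Longrightarrow> subsampled_transform F n l (d, p, ks) \<in> carrier_mat n l"
  by (rule carrier_matI) (simp_all add: subsampled_transform_def samples_def)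

lemma product_index:
  assumes W: "W \<in> carrier_mat r n" and F: "F \<in> carrier_mat n n" and p: "p permutes {..<n}"
    and ks: "ks \<in> samples n l" and "a < r" "t < l"
  shows "(W * subsampled_transform F n l (d, p, ks)) $$ (a, t)
    = (\<Sum>k<n. (of_real (sqrt (real n / real l)) * (d k * F $$ (k, p (ks ! t)))) * W $$ (a, k))"
proof -
  have "(W * subsampled_transform F n l (d, p, ks)) $$ (a, t)
      = (\<Sum>k<n. W $$ (a, k) * subsampled_transform F n l (d, p, ks) $$ (k, t))"
    by (rule mat_mult_index[OF W subsampled_transform_carrier[OF ks] assms(5,6)])
  also have "\<dots> = (\<Sum>k<n. (of_real (sqrt (real n / real l)) * (d k * F $$ (k, p (ks ! t)))) * W $$ (a, k))"
    using assms by (intro sum.cong refl) (simp add: subsampled_transform_index[OF F p ks])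
  finally show ?thesis .
qed

text \<open>Up to the factor \<open>n / l\<close>, the matrix of the sampled transform is the Gram matrix of the sampled
  columns of \<open>V D F\<close>.\<close>

lemma energy_product:
  assumes W: "W \<in> carrier_mat r n" and F: "F \<in> carrier_mat n n" and p: "p permutes {..<n}"
    and ks: "ks \<in> samples n l"
    and tr: "\<And>k y. k < n \<Longrightarrow> ip r (\<lambda>a. W $$ (a, k)) y = ip r (V k) (tr y)"
  shows "adjoint_energy (W * subsampled_transform F n l (d, p, ks)) y
    = real n / real l * (\<Sum>k\<in>set ks. (cmod (ip r (mixed_column n F V d (p k)) (tr y)))\<^sup>2)"
proof -
  let ?A = "W * subsampled_transform F n l (d, p, ks)"
  have A: "?A \<in> carrier_mat r l" using W subsampled_transform_carrier[OF ks, of F d p] by simp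
  have len: "length ks = l" and dist: "distinct ks" using ks by (auto simp: samples_def)
  have col: "(cmod (ip r (\<lambda>a. ?A $$ (a, t)) y))\<^sup>2
      = real n / real l * (cmod (ip r (mixed_column n F V d (p (ks ! t))) (tr y)))\<^sup>2" if t: "t < l" for t
  proof -
    let ?s = "complex_of_real (sqrt (real n / real l))"
    have "ip r (\<lambda>a. ?A $$ (a, t)) y
        = ip r (\<lambda>a. \<Sum>k<n. (?s * (d k * F $$ (k, p (ks ! t)))) * W $$ (a, k)) y"
      by (intro ip_cong product_index[OF W F p ks _ t] refl)
    also have "\<dots> = (\<Sum>k<n. cnj (?s * (d k * F $$ (k, p (ks ! t)))) * ip r (\<lambda>a. W $$ (a, k)) y)"
      by (rule ip_sum_left)
    also have "\<dots> = (\<Sum>k<n. ?s * (cnj (F $$ (k, p (ks ! t))) * (cnj (d k) * ip r (V k) (tr y))))"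
      by (intro sum.cong refl) (simp add: tr mult_ac)
    also have "\<dots> = ?s * ip r (mixed_column n F V d (p (ks ! t))) (tr y)"
      unfolding ip_mixed_column by (rule sum_distrib_left[symmetric])
    finally show ?thesis by (simp add: norm_mult power_mult_distrib)
  qed
  have "adjoint_energy ?A y
      = real n / real l * (\<Sum>t<l. (cmod (ip r (mixed_column n F V d (p (ks ! t))) (tr y)))\<^sup>2)"
    unfolding adjoint_energy_ip[OF A] sum_distrib_left by (intro sum.cong refl col) simp
  also have "(\<Sum>t<l. (cmod (ip r (mixed_column n F V d (p (ks ! t))) (tr y)))\<^sup>2)
      = (\<Sum>k\<in>set ks. (cmod (ip r (mixed_column n F V d (p k)) (tr y)))\<^sup>2)"
    using bij_betw_nth[OF dist refl refl] len
    by (intro sum.reindex_bij_betw[of "(!) ks" _ _ "\<lambda>k. (cmod (ip r (mixed_column n F V d (p k)) (tr y)))\<^sup>2"])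
      (simp add: lessThan_atLeast0)
  finally show ?thesis .
qed

lemma exp_three_quarters: "exp (3 / 4 :: real) \<le> 2.1428"
proof -
  have "(exp (3 / 4 :: real)) ^ 4 = (exp 1) ^ 3"
    by (simp flip: exp_of_nat_mult)
  also have "\<dots> \<le> (272 / 100) ^ 3" using e_less_272 by (intro power_mono) auto
  also have "\<dots> \<le> (2.1428 :: real) ^ 4" by (simp add: power_numeral_reduce)
  finally show ?thesis by (rule power_le_imp_le_base[of _ 3, simplified]) simp_all
qed

lemma exp_minus_two: "exp (- 2 :: real) \<le> 0.18"
proof -
  have "(5 / 2 :: real) \<le> exp 1" using exp_lower_Taylor_quadratic[of "1 :: real"] by simp
  then have "(5 / 2) ^ 2 \<le> (exp 1 :: real) ^ 2" by (intro power_mono) auto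
  also have "\<dots> = exp 2" by (simp flip: exp_of_nat_mult)
  finally have "25 / 4 \<le> exp (2 :: real)" by (simp add: power2_eq_square)
  then have "inverse (exp 2) \<le> inverse (25 / 4 :: real)" by (intro le_imp_inverse_le) auto
  then show ?thesis by (simp add: exp_minus)
qed

text \<open>As \<open>l / M\<close> is at least \<open>4 ln r\<close>, the rate \<open>- 1 / 2\<close> beats the dimension factor \<open>r\<close>:
  \<open>r exp (- 2 ln r) = 1 / r\<close>.\<close>

lemma sampling_tail_numeric:
  assumes "tight_frame r n x" "\<And>k. k < n \<Longrightarrow> nrm2 r (x k) \<le> M / real n" "l \<le> n" "0 < n"
    and "1 \<le> r" "0 < M" "4 * M * ln (real r) \<le> real l"
    and rate: "exp tau - 1 - tau * g \<le> - (1 / 2)"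
  shows "real (card {ks \<in> samples n l. exceeds r x (tau * real n / M) (g * real l / real n) (set ks)})
    \<le> 1 / real r * real (card (samples n l))"
proof -
  let ?s = "tau * real n / M"
  have "(exp (?s * (M / real n)) - 1) / (M / real n) * real l / real n - ?s * (g * real l / real n)
      = real l / M * (exp tau - 1 - tau * g)"
    using assms(4,6) by (simp add: field_simps)
  also have "\<dots> \<le> real l / M * (- (1 / 2))"
    using assms(6) rate by (intro mult_left_mono) auto
  also have "\<dots> \<le> - 2 * ln (real r)"
    using assms(6,7) by (simp add: field_simps)
  finally have "real r * exp ((exp (?s * (M / real n)) - 1) / (M / real n) * real l / real n - ?s * (g * real l / real n))
      \<le> real r * exp (- 2 * ln (real r))"
    by (intro mult_left_mono) auto
  also have "exp (- 2 * ln (real r)) = 1 / (real r)\<^sup>2"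
  proof -
    have "exp (2 * ln (real r)) = (exp (ln (real r)))\<^sup>2" by (simp flip: exp_of_nat_mult)
    then show ?thesis using assms(5) by (simp add: exp_minus divide_inverse)
  qed
  also have "real r * (1 / (real r)\<^sup>2) = 1 / real r" using assms(5) by (simp add: power2_eq_square)
  finally have *: "real r * exp ((exp (?s * (M / real n)) - 1) / (M / real n) * real l / real n - ?s * (g * real l / real n))
      \<le> 1 / real r" .
  have "real (card {ks \<in> samples n l. exceeds r x ?s (g * real l / real n) (set ks)})
    \<le> real (card (samples n l)) * (real r * exp ((exp (?s * (M / real n)) - 1) / (M / real n) * real l / real n - ?s * (g * real l / real n)))"
    using assms by (intro sampling_tail) auto
  also have "\<dots> \<le> real (card (samples n l)) * (1 / real r)" by (intro mult_left_mono *) auto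
  finally show ?thesis by (simp add: mult.commute)
qed

theorem corollary85:
  shows "\<exists>C::real. \<forall>(r::nat) (n::nat) (l::nat) (F::complex mat) (W::complex mat).
    1 \<le> r \<longrightarrow>
    is_srht_base n F \<or> is_srft_base n F \<longrightarrow>
    4 * (sqrt (real r) + sqrt (8 * ln (real r * real n)))\<^sup>2 * ln (real r) \<le> real l \<longrightarrow>
    l \<le> n \<longrightarrow>
    W \<in> carrier_mat r n \<longrightarrow>
    singular_value r W > 0 \<longrightarrow>
    (let failure = {\<omega> \<in> space (transform_space n l).
           \<not> (0.40 * singular_value r W
                \<le> singular_value r (W * subsampled_transform F n l \<omega>) \<and>
              singular_value 1 (W * subsampled_transform F n l \<omega>)
                \<le> 1.48 * singular_value 1 W)}
     in failure \<in> sets (transform_space n l) \<and>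
        measure (transform_space n l) failure \<le> C / real r)"
proof (intro exI[of _ 3] allI impI)
  fix r n l :: nat and F W :: "complex mat"
  assume r1: "1 \<le> r" and base: "is_srht_base n F \<or> is_srft_base n F"
    and size: "4 * (sqrt (real r) + sqrt (8 * ln (real r * real n)))\<^sup>2 * ln (real r) \<le> real l"
    and ln: "l \<le> n" and W: "W \<in> carrier_mat r n" and pos: "0 < singular_value r W"
  define good where "good = (\<lambda>\<omega>. 0.40 * singular_value r W \<le> singular_value r (W * subsampled_transform F n l \<omega>) \<and>
      singular_value 1 (W * subsampled_transform F n l \<omega>) \<le> 1.48 * singular_value 1 W)"
  define failure where "failure = {\<omega> \<in> space (transform_space n l). \<not> good \<omega>}"
  interpret T: prob_space "transform_space n l" by (rule prob_space_transform_space[OF ln])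
  have rn: "r \<le> n"
  proof (rule ccontr)
    assume "\<not> r \<le> n"
    then have "singular_value r W = 0"
      using W by (auto simp: singular_value_def singular_values_def)
    with pos show False by simp
  qed
  with r1 have n: "0 < n" by simp
  have F: "flat_unitary n F" by (rule flat_unitary_base[OF base n])
  note Fc = flat_unitaryD(1)[OF F]
  have "0 \<le> ln (real r * real n)"
  proof -
    have "real 1 \<le> real (r * n)" unfolding of_nat_le_iff using r1 n by (simp add: Suc_le_eq)
    then show ?thesis by simp
  qed
  then have M_ge: "real r \<le> row_norm_bound r n"
  proof -
    have "real r = (sqrt (real r))\<^sup>2" by simp
    also have "\<dots> \<le> row_norm_bound r n"
      unfolding row_norm_bound_def using \<open>0 \<le> ln (real r * real n)\<close> by (intro power_mono) auto
    finally show ?thesis .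
  qed
  then have M: "0 < row_norm_bound r n" using r1 by simp
  have size': "4 * row_norm_bound r n * ln (real r) \<le> real l" using size by (simp add: row_norm_bound_def)
  (* the logarithm vanishes for r = 1, where the sample may even be empty *)
  have r_le_l: "r \<le> l" if "2 \<le> r"
  proof -
    have "ln (1 / real r) \<le> 1 / real r - 1" using that by (intro ln_le_minus_one) simp
    moreover have "1 / real r \<le> 1 / 2" using that by (intro divide_left_mono) auto
    moreover have "ln (1 / real r) = - ln (real r)" using that by (simp add: ln_div)
    ultimately have "1 / 4 \<le> ln (real r)" by linarith
    then have "row_norm_bound r n * 1 \<le> row_norm_bound r n * (4 * ln (real r))"
      using M by (intro mult_left_mono) auto
    with size' M_ge have "real r \<le> real l" by (simp add: mult_ac)
    then show ?thesis by simp
  qed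
  have s1: "0 \<le> singular_value 1 W"
  proof -
    obtain lam u where sb: "spectral_basis r (\<lambda>a b. \<Sum>k<n. W $$ (a, k) * cnj (W $$ (b, k))) lam u"
      using hermitian_spectral[OF hermitian_gram[of r "\<lambda>k a. W $$ (a, k)" "{..<n}"]] by blast
    from singular_value_extremes(2,4)[OF W r1 rn sb, of 0] r1 pos show ?thesis by linarith
  qed
  have carrier: "W * subsampled_transform F n l (d, p, ks) \<in> carrier_mat r l" if "ks \<in> samples n l" for d p ks
    using W subsampled_transform_carrier[OF that, of F d p] by simp
  have meas: "failure \<in> sets (transform_space n l)"
    unfolding failure_def
  proof (rule measurable_transform_space_slices)
    fix p ks assume p: "p permutes {..<n}" and ks: "ks \<in> samples n l"
    show "{d \<in> space (phases n). \<not> good (d, p, ks)} \<in> sets (phases n)"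
    proof (cases "r \<le> l")
      case True
      have "(\<lambda>d. (W * subsampled_transform F n l (d, p, ks)) $$ (i, k)) \<in> borel_measurable (phases n)"
        if "i < r" "k < l" for i k
        unfolding product_index[OF W Fc p ks that]
        by (auto intro!: borel_measurable_sum borel_measurable_times)
      then show ?thesis
        unfolding good_def using carrier[OF ks] pos s1
        by (intro measurable_singular_value_bounds[OF _ r1 True]) auto
    next
      case False
      have "r = 1"
      proof (rule ccontr)
        assume "r \<noteq> 1"
        with r1 have "2 \<le> r" by simp
        with r_le_l False show False by simp
      qed
      with False have "l = 0" by simp
      then have "singular_value j (W * subsampled_transform F n l (d, p, ks)) = 0" for j d
        using carrier[OF ks, of d p] by (auto simp: singular_value_def singular_values_def)
      then show ?thesis unfolding good_def by simp
    qed
  qed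
  have prob: "measure (transform_space n l) failure \<le> 3 / real r"
  proof (cases "r = 1")
    case True
    have "measure (transform_space n l) failure \<le> 1" by (rule T.prob_le_1)
    also have "\<dots> \<le> 3 / real r" using True by simp
    finally show ?thesis .
  next
    case False
    with r1 have r2: "2 \<le> r" by simp
    then have rl: "r \<le> l" by (rule r_le_l)
    with r1 have l: "0 < l" by simp
    obtain V tr where V: "tight_frame r n V"
      and tr: "\<forall>k y. ip r (\<lambda>a. W $$ (a, k)) y = ip r (V k) (tr y)"
      and tr_lo: "\<forall>y. (singular_value r W)\<^sup>2 * nrm2 r y \<le> nrm2 r (tr y)"
      and tr_hi: "\<forall>y. nrm2 r (tr y) \<le> (singular_value 1 W)\<^sup>2 * nrm2 r y"
      using whitening[OF W r1 rn pos] by blast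
    define B where "B = {d \<in> space (phases n). \<exists>j<n. row_norm_bound r n / real n \<le> nrm2 r (mixed_column n F V d j)}"
    have B: "B \<in> sets (phases n)" "measure (phases n) B \<le> 1 / real r"
      unfolding B_def by (rule row_norms_bad_event[OF F V r1 n])+
    have "measure (transform_space n l) failure \<le> 1 / real r + 2 / real r"
    proof (rule measure_transform_space_le[OF meas ln _ B])
      fix d p
      assume d: "d \<in> space (phases n)" "d \<notin> B" "\<forall>k<n. cmod (d k) = 1" and p: "p permutes {..<n}"
      define x where "x = (\<lambda>k. mixed_column n F V d (p k))"
      have frame: "tight_frame r n x"
        unfolding x_def by (intro tight_frame_permute[OF _ p] tight_frame_mixed[OF F V]) (use d in auto)
      have nrm: "nrm2 r (x k) \<le> row_norm_bound r n / real n" if "k < n" for k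
        using d(1,2) permutes_in_image[OF p, of k] that by (auto simp: B_def x_def not_le intro: less_imp_le)
      (* 2.1904 and 0.16 are the squares of 1.48 and 0.40; the multipliers 3 / 4 and - 2 of n / M
         are simple numbers near their logarithms ln 2.1904 and ln 0.16 *)
      define U where "U = {ks \<in> samples n l. exceeds r x (3 / 4 * real n / row_norm_bound r n) (2.1904 * real l / real n) (set ks)}"
      define L where "L = {ks \<in> samples n l. exceeds r x (- 2 * real n / row_norm_bound r n) (0.16 * real l / real n) (set ks)}"
      have cU: "real (card U) \<le> 1 / real r * real (card (samples n l))"
        unfolding U_def using exp_three_quarters
        by (intro sampling_tail_numeric[OF frame nrm ln n r1 M size']) auto
      have cL: "real (card L) \<le> 1 / real r * real (card (samples n l))"
        unfolding L_def using exp_minus_two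
        by (intro sampling_tail_numeric[OF frame nrm ln n r1 M size']) auto
      have "{ks \<in> samples n l. (d, p, ks) \<in> failure} \<subseteq> U \<union> L"
      proof
        fix ks assume "ks \<in> {ks \<in> samples n l. (d, p, ks) \<in> failure}"
        then have ks: "ks \<in> samples n l" and bad: "\<not> good (d, p, ks)" by (auto simp: failure_def)
        show "ks \<in> U \<union> L"
        proof (rule ccontr)
          assume nUL: "ks \<notin> U \<union> L"
          let ?A = "W * subsampled_transform F n l (d, p, ks)"
          let ?S = "\<lambda>z. \<Sum>k\<in>set ks. (cmod (ip r (x k) z))\<^sup>2"
          have energy: "adjoint_energy ?A y = real n / real l * ?S (tr y)" for y
            unfolding x_def by (rule energy_product[OF W Fc p ks tr[rule_format]])
          have hi: "?S z \<le> 2.1904 * real l / real n * nrm2 r z" for z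
          proof -
            have "0 < 3 / 4 * real n / row_norm_bound r n" using n M by simp
            moreover have "3 / 4 * real n / row_norm_bound r n * ?S z
                \<le> 3 / 4 * real n / row_norm_bound r n * (2.1904 * real l / real n * nrm2 r z)"
              using nUL ks unfolding U_def exceeds_def by (auto simp: not_less mult.assoc)
            ultimately show ?thesis by (rule mult_left_le_imp_le[rotated])
          qed
          have lo: "0.16 * real l / real n * nrm2 r z \<le> ?S z" for z
          proof -
            have "0 < 2 * real n / row_norm_bound r n" using n M by simp
            moreover have "- 2 * real n / row_norm_bound r n * ?S z
                \<le> - 2 * real n / row_norm_bound r n * (0.16 * real l / real n * nrm2 r z)"
              using nUL ks unfolding L_def exceeds_def by (auto simp: not_less mult.assoc)
            then have "2 * real n / row_norm_bound r n * (0.16 * real l / real n * nrm2 r z)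
                \<le> 2 * real n / row_norm_bound r n * ?S z" by simp
            ultimately show ?thesis by (rule mult_left_le_imp_le[rotated])
          qed
          have "adjoint_energy ?A y \<le> (1.48 * singular_value 1 W)\<^sup>2 * nrm2 r y" for y
          proof -
            have "adjoint_energy ?A y \<le> real n / real l * (2.1904 * real l / real n * nrm2 r (tr y))"
              unfolding energy by (intro mult_left_mono hi) auto
            also have "\<dots> = 2.1904 * nrm2 r (tr y)" using n l by simp
            also have "\<dots> \<le> 2.1904 * ((singular_value 1 W)\<^sup>2 * nrm2 r y)"
              by (intro mult_left_mono tr_hi[rule_format]) auto
            finally show ?thesis by (simp add: power_mult_distrib power2_eq_square)
          qed
          moreover have "(0.40 * singular_value r W)\<^sup>2 * nrm2 r y \<le> adjoint_energy ?A y" for y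
          proof -
            have "(0.40 * singular_value r W)\<^sup>2 * nrm2 r y = 0.16 * ((singular_value r W)\<^sup>2 * nrm2 r y)"
              by (simp add: power_mult_distrib power2_eq_square)
            also have "\<dots> \<le> 0.16 * nrm2 r (tr y)" by (intro mult_left_mono tr_lo[rule_format]) auto
            also have "\<dots> = real n / real l * (0.16 * real l / real n * nrm2 r (tr y))" using n l by simp
            also have "\<dots> \<le> adjoint_energy ?A y"
              unfolding energy by (intro mult_left_mono lo) auto
            finally show ?thesis .
          qed
          moreover have "0 \<le> 1.48 * singular_value 1 W" "0 \<le> 0.40 * singular_value r W"
            using s1 pos by auto
          ultimately have "good (d, p, ks)"
            unfolding good_def using singular_value_bounds_iff[OF carrier[OF ks] r1 rl] by blast
          with bad show False ..
        qed
      qed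
      moreover have "finite (U \<union> L)" using finite_samples by (auto simp: U_def L_def)
      ultimately have "card {ks \<in> samples n l. (d, p, ks) \<in> failure} \<le> card U + card L"
        by (meson card_Un_le card_mono order_trans)
      then have "real (card {ks \<in> samples n l. (d, p, ks) \<in> failure}) \<le> real (card U) + real (card L)"
        by (simp flip: of_nat_add)
      also have "\<dots> \<le> 2 / real r * real (card (samples n l))" using cU cL by simp
      finally show "real (card {ks \<in> samples n l. (d, p, ks) \<in> failure}) \<le> 2 / real r * real (card (samples n l))" .
    qed simp
    then show ?thesis by simp
  qed
  show "let failure = {\<omega> \<in> space (transform_space n l).
           \<not> (0.40 * singular_value r W
                \<le> singular_value r (W * subsampled_transform F n l \<omega>) \<and>
              singular_value 1 (W * subsampled_transform F n l \<omega>)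
                \<le> 1.48 * singular_value 1 W)}
     in failure \<in> sets (transform_space n l) \<and>
        measure (transform_space n l) failure \<le> 3 / real r"
    using meas prob unfolding failure_def good_def Let_def by blast
qed

end
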